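(* Let $d\ge2$, $0<\sigma<1$, and let $e_d$ be the north pole of $\mathbb{S}^d$. Then for every $f\in\mathbf{H}^\sigma$, \[ 2^\sigma Q_{\sigma,(d-1)/2}\int_{\mathbb{S}^d}\frac{f^2(x)}{(|x-e_d|\,|x+e_d|)^{\sigma}}\,dx\le\int_{\mathbb{S}^d}f(x)\,\mathbf{A}_\sigma f(x)\,dx, \qquad Q_{\sigma,(d-1)/2}=2^\sigma\frac{\Gamma\!\left(\frac{d+\sigma}{4}\right)^2}{\Gamma\!\left(\frac{d-\sigma}{4}\right)^2}. \]
   Context: $\mathbb{S}^d\subset\mathbb{R}^{d+1}$ is the unit sphere with surface measure $dx$; points are written $x=(t,\sqrt{1-t^2}\,x')$ with $t\in(-1,1)$, $x'\in\mathbb{S}^{d-1}$, and the north pole is $e_d=(1,0,\dots,0)$ (the point $t=1$). $L^2(\mathbb{S}^d)=\bigoplus_{n\ge0}\mathcal H_n(\mathbb{S}^d)$, where $\mathcal H_n(\mathbb{S}^d)$ is the space of spherical harmonics of degree $n$, and $\operatorname{proj}_{\mathcal H_n(\mathbb{S}^d)}$ is the orthogonal projection onto it. For $\sigma>0$ define $\mathbf{A}_\sigma f=\sum_{n\ge0}\frac{\Gamma(n+\frac{d-1}{2}+\frac{1+\sigma}{2})}{\Gamma(n+\frac{d-1}{2}+\frac{1-\sigma}{2})}\operatorname{proj}_{\mathcal H_n(\mathbb{S}^d)}f$ (i.e. $\Gamma(\sqrt{-\Delta}+\frac{1+\sigma}2)/\Gamma(\sqrt{-\Delta}+\frac{1-\sigma}2)$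 with $-\Delta$ the Laplace–Beltrami operator shifted by $((d-1)/2)^2$). The Sobolev space is $\mathbf{H}^\sigma=\{f\in L^2(\mathbb{S}^d):\sum_{n\ge0}(n+\frac{d-1}{2})^\sigma\|\operatorname{proj}_{\mathcal H_n(\mathbb{S}^d)}f\|_{L^2(\mathbb{S}^d)}^2<\infty\}$, and for $f\in\mathbf{H}^\sigma$, $\int_{\mathbb{S}^d} f\,\mathbf{A}_\sigma f\,dx$ means $\sum_{n\ge0}\frac{\Gamma(n+\frac{d-1}{2}+\frac{1+\sigma}{2})}{\Gamma(n+\frac{d-1}{2}+\frac{1-\sigma}{2})}\|\operatorname{proj}_{\mathcal H_n(\mathbb{S}^d)}f\|_{L^2(\mathbb{S}^d)}^2$. *)

theory Defs
  imports "HOL-Analysis.Analysis"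
begin

text \<open>The ambient space R^(d+1) is real^'n with CARD('n) = d+1.
  The unit sphere S^d is sphere 0 1.\<close>

text \<open>Surface measure on the unit sphere, defined as the cone measure:
  sigma(A) = (d+1) * Lebesgue measure of the cone {r x : 0 < r <= 1, x in A}.
  This coincides with the standard (d-dimensional Hausdorff) surface measure.\<close>
definition sphere_measure :: "(real^'n) measure" where
  "sphere_measure =
     density (distr (restrict_space lborel (cball 0 1 - {0}))
                    (restrict_space borel (sphere 0 1)) (\<lambda>x. x /\<^sub>R norm x))
             (\<lambda>_. ennreal (real CARD('n)))"

definition hom_poly :: "nat \<Rightarrow> (real^'n \<Rightarrow> real) \<Rightarrow> bool" where
  "hom_poly n p \<longleftrightarrow> (\<exists>c :: ('n \<Rightarrow> nat) \<Rightarrow> real. \<forall>x.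
     p x = (\<Sum>\<alpha>\<in>{\<alpha>::'n\<Rightarrow>nat. sum \<alpha> UNIV = n}. c \<alpha> * (\<Prod>i\<in>UNIV. (x $ i) ^ \<alpha> i)))"

definition harmonic_fun :: "(real^'n \<Rightarrow> real) \<Rightarrow> bool" where
  "harmonic_fun p \<longleftrightarrow> (\<forall>x. (\<Sum>i\<in>UNIV.
      deriv (\<lambda>t. deriv (\<lambda>s. p (x + s *\<^sub>R axis i 1)) t) 0) = 0)"

text \<open>H_n(S^d): spherical harmonics of degree n, represented by homogeneous
  harmonic polynomials of degree n (restricted to the sphere via sphere_measure).\<close>
definition sph_harm :: "nat \<Rightarrow> (real^'n \<Rightarrow> real) set" where
  "sph_harm n = {p. hom_poly n p \<and> harmonic_fun p}"

definition proj_H :: "nat \<Rightarrow> (real^'n \<Rightarrow> real) \<Rightarrow> (real^'n \<Rightarrow> real)" where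
  "proj_H n f = (THE g. g \<in> sph_harm n \<and>
     (\<forall>h\<in>sph_harm n. (LINT x|sphere_measure. (f x - g x) * h x) = 0))"

definition proj_norm2 :: "nat \<Rightarrow> (real^'n \<Rightarrow> real) \<Rightarrow> real" where
  "proj_norm2 n f = (LINT x|sphere_measure. (proj_H n f x)\<^sup>2)"

text \<open>lambda = (d-1)/2 where d + 1 = CARD('n).\<close>
definition lam :: "'n itself \<Rightarrow> real" where
  "lam _ = (real CARD('n) - 2) / 2"

definition sobolev_H :: "real \<Rightarrow> (real^'n \<Rightarrow> real) \<Rightarrow> bool" where
  "sobolev_H \<sigma> f \<longleftrightarrow>
     f \<in> borel_measurable sphere_measure \<and>
     integrable sphere_measure (\<lambda>x. (f x)\<^sup>2) \<and>
     summable (\<lambda>n. (real n + lam TYPE('n)) powr \<sigma> * proj_norm2 n f)"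

text \<open>The quadratic form of A_sigma: integral of f * A_sigma f over S^d.\<close>
definition A_form :: "real \<Rightarrow> (real^'n \<Rightarrow> real) \<Rightarrow> real" where
  "A_form \<sigma> f = (\<Sum>n. Gamma (real n + lam TYPE('n) + (1 + \<sigma>) / 2)
                       / Gamma (real n + lam TYPE('n) + (1 - \<sigma>) / 2) * proj_norm2 n f)"

end

theory Submission
  imports Defs "HOL-Probability.Distributions"
begin

text \<open>
  Write \<open>N = d + 1\<close>, \<open>\<beta> = (d - \<sigma>)/4\<close>, \<open>\<delta> = (d + \<sigma>)/4\<close> and \<open>|y'|\<^sup>2 = 1 - t\<^sup>2\<close>, so that
  \<open>|x - e| |x + e| = 2 |x'|\<close>. The inverse of \<open>A\<^sub>\<sigma>\<close> is, up to a constant, the integral operator \<open>K\<close>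
  with the positive and positive definite kernel \<open>(1 - x \<bullet> y)\<close> to the power \<open>-2\<beta>\<close> (Funk--Hecke), and
  \<open>K\<close> maps \<open>\<phi> = |y'|\<close> to the power \<open>-2\<delta>\<close> to \<open>\<psi>/Q\<close>, where \<open>\<psi> = |y'|\<close> to the power \<open>-2\<beta>\<close>
  and \<open>\<phi> = W \<psi>\<close> with the Hardy weight \<open>W\<close>. For a polynomial \<open>f = K u\<close> the Schur test with the
  ground state \<open>\<phi>\<close> gives \<open>\<langle>K (W f), W f\<rangle> \<le> (1/Q) \<integral> W f\<^sup>2\<close>, and expanding
  \<open>0 \<le> \<langle>K (u - Q W f), u - Q W f\<rangle>\<close> yields the inequality; completeness of the spherical harmonics
  and Fatou's lemma extend it to the Sobolev space.

  Eigenvalues of \<open>K\<close> and moments of \<open>\<phi>\<close>, \<open>\<psi>\<close> against spherical harmonics are both obtained from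
  Gaussian integrals over \<open>\<real>\<^sup>N\<close>: Gaussian integration by parts and Euler's identity replace Green's
  theorem, and no rotation invariance is needed.
\<close>

subsection \<open>Homogeneous polynomials\<close>

text \<open>\<open>A_form\<close> is nonlocal and belongs to an unbounded operator, whereas the
  kernel of the inverse is explicit, positive and integrable, \<open>1 - x \<bullet> y\<close> being
  half the squared chord. For a polynomial f the preimage u is again a finite sum of harmonics, so K
  u = f holds exactly and no domain question arises. The exponents are fixed by 2(\<beta> +
  \<delta>) = N - 1 and 2(\<delta> - \<beta>) = \<sigma>. By the first relation the map \<gamma> ->
  (N - 1)/2 - \<gamma> exchanges \<beta> and \<delta>; that exchange makes the moments of \<phi> and
  \<psi> against a harmonic differ only by the eigenvalue of K and the constant Q. By the second,
  \<phi>/\<psi> is the Hardy weight up to a constant factor. The obstacle is that \<phi> blows up at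
  the poles, so K \<phi> is not computed pointwise: it is identified almost everywhere from its
  moments, which is one reason why completeness of the harmonics is proved for L1 functions. Since
  the kernel and its Taylor coefficients are nonnegative, the decisive exchanges of sum and integral
  can be justified by nonnegative integrals before any integrability is known.\<close>

inductive hp :: "nat \<Rightarrow> (real^'n \<Rightarrow> real) \<Rightarrow> bool" where
  hp_zero: "hp n (\<lambda>_. 0)"
| hp_const: "hp 0 (\<lambda>_. c)"
| hp_coord_mult: "hp n p \<Longrightarrow> hp (Suc n) (\<lambda>x. x $ i * p x)"
| hp_add: "hp n p \<Longrightarrow> hp n q \<Longrightarrow> hp n (\<lambda>x. p x + q x)"

definition pd :: "'n \<Rightarrow> (real^'n \<Rightarrow> real) \<Rightarrow> real^'n \<Rightarrow> real" where
  "pd i p x = deriv (\<lambda>s. p (x + s *\<^sub>R axis i 1)) 0"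

definition lap :: "(real^'n \<Rightarrow> real) \<Rightarrow> real^'n \<Rightarrow> real" where
  "lap p x = (\<Sum>i\<in>UNIV. pd i (pd i p) x)"

lemma hp_cmult: "hp n p \<Longrightarrow> hp n (\<lambda>x. c * p x)"
proof (induction rule: hp.induct)
  case (hp_coord_mult n p i)
  from hp.hp_coord_mult[OF hp_coord_mult.IH, of i] show ?case by (simp add: mult.left_commute)
next
  case (hp_add n p q)
  from hp.hp_add[OF hp_add.IH] show ?case by (simp add: distrib_left)
qed (auto intro: hp.intros)

lemma hp_mult: "hp n p \<Longrightarrow> hp m q \<Longrightarrow> hp (n + m) (\<lambda>x. p x * q x)"
proof (induction rule: hp.induct)
  case (hp_zero n)
  show ?case using hp.hp_zero[of "n+m"] by simp
next
  case (hp_const c)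
  then show ?case by (simp add: hp_cmult)
next
  case (hp_coord_mult n p i)
  from hp.hp_coord_mult[OF hp_coord_mult.IH[OF hp_coord_mult.prems], of i]
  show ?case by (simp add: mult.assoc)
next
  case (hp_add n p q)
  from hp.hp_add[OF hp_add.IH] hp_add.prems show ?case by (simp add: distrib_right)
qed

lemma hp_sum: "finite A \<Longrightarrow> (\<And>a. a \<in> A \<Longrightarrow> hp n (p a)) \<Longrightarrow> hp n (\<lambda>x. \<Sum>a\<in>A. p a x)"
  by (induction A rule: finite_induct) (auto intro: hp_zero hp_add)

lemma hp_coord: "hp 1 (\<lambda>x. x $ i)"
  using hp_coord_mult[OF hp_const[of 1], of i] by simp

lemma hp_power: "hp n p \<Longrightarrow> hp (k * n) (\<lambda>x. p x ^ k)"
  by (induction k) (auto intro: hp_const hp_mult)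

lemma hp_inner: "hp 1 (\<lambda>y. x \<bullet> y)"
  unfolding inner_vec_def by (auto intro!: hp_sum hp_cmult hp_coord[unfolded One_nat_def])

lemma hp_inner_power: "hp k (\<lambda>y. (x \<bullet> y) ^ k)"
  using hp_power[OF hp_inner, of k] by simp

lemma hp_norm_power: "hp (2 * j) (\<lambda>x. norm x ^ (2 * j))"
proof -
  have "hp 2 (\<lambda>x::real^'n. x \<bullet> x)"
    unfolding inner_vec_def
    using hp_mult[OF hp_coord hp_coord] by (auto intro!: hp_sum simp: numeral_2_eq_2)
  from hp_power[OF this, of j] show ?thesis
    by (simp add: power_mult power2_norm_eq_inner[symmetric] mult.commute power_commutes[symmetric])
       (simp add: mult.commute flip: power_mult)
qed

lemma hp_homogeneous: "hp n p \<Longrightarrow> p (c *\<^sub>R x) = c ^ n * p x"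
  by (induction rule: hp.induct) (auto simp: algebra_simps)

lemma hp_continuous: "hp n p \<Longrightarrow> continuous_on A p"
  by (induction rule: hp.induct) (auto intro!: continuous_intros)

lemma hp_measurable [measurable_dest]: "hp n p \<Longrightarrow> p \<in> borel_measurable borel"
  by (intro borel_measurable_continuous_onI hp_continuous)

lemma hp_0_const: "hp 0 p \<Longrightarrow> \<exists>c. p = (\<lambda>_. c)"
  by (induction "0::nat" p rule: hp.induct) auto

lemma hp_has_pd: "hp n p \<Longrightarrow> ((\<lambda>s. p (x + s *\<^sub>R axis i 1)) has_real_derivative pd i p x) (at 0)"
proof -
  assume "hp n p"
  then have "\<exists>D. ((\<lambda>s. p (x + s *\<^sub>R axis i 1)) has_real_derivative D) (at 0)"
  proof (induction rule: hp.induct)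
    case (hp_coord_mult n p j)
    then obtain D where D: "((\<lambda>s. p (x + s *\<^sub>R axis i 1)) has_real_derivative D) (at 0)" by blast
    show ?case by (rule exI, simp, (rule derivative_eq_intros D refl)+)
  next
    case (hp_add n p q)
    then obtain D E where "((\<lambda>s. p (x + s *\<^sub>R axis i 1)) has_real_derivative D) (at 0)"
      "((\<lambda>s. q (x + s *\<^sub>R axis i 1)) has_real_derivative E) (at 0)" by blast
    from DERIV_add[OF this] show ?case by blast
  qed (auto intro: DERIV_const)
  then show ?thesis unfolding pd_def using DERIV_imp_deriv by blast
qed

lemma pd_eqI: "((\<lambda>s. p (x + s *\<^sub>R axis i 1)) has_real_derivative D) (at 0) \<Longrightarrow> pd i p x = D"
  unfolding pd_def by (rule DERIV_imp_deriv)

lemma pd_mult: "hp n p \<Longrightarrow> hp m q \<Longrightarrow> pd i (\<lambda>x. p x * q x) = (\<lambda>x. pd i p x * q x + p x * pd i q x)"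
  by (rule ext, rule pd_eqI, rule derivative_eq_intros, rule hp_has_pd, assumption, rule hp_has_pd, assumption)
     simp

lemma pd_add: "hp n p \<Longrightarrow> hp m q \<Longrightarrow> pd i (\<lambda>x. p x + q x) = (\<lambda>x. pd i p x + pd i q x)"
  by (rule ext, rule pd_eqI) (auto intro!: DERIV_add hp_has_pd)

lemma pd_const: "pd i (\<lambda>x. c) = (\<lambda>x. 0)"
  by (rule ext, rule pd_eqI) simp

lemma pd_cmult: "hp n p \<Longrightarrow> pd i (\<lambda>x. c * p x) = (\<lambda>x. c * pd i p x)"
  by (rule ext, rule pd_eqI, rule DERIV_cmult, rule hp_has_pd)

lemma pd_sum: "finite A \<Longrightarrow> (\<And>a. a \<in> A \<Longrightarrow> hp n (p a)) \<Longrightarrow>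
    pd i (\<lambda>x. \<Sum>a\<in>A. p a x) = (\<lambda>x. \<Sum>a\<in>A. pd i (p a) x)"
  by (rule ext, rule pd_eqI) (auto intro!: DERIV_sum hp_has_pd)

lemma pd_coord: "pd i (\<lambda>x. x $ j) = (\<lambda>x. if i = j then 1 else 0)"
  by (rule ext, rule pd_eqI) (auto simp: axis_def intro!: derivative_eq_intros)

lemma pd_coord_mult: "hp n p \<Longrightarrow>
    pd i (\<lambda>x. x $ j * p x) = (\<lambda>x. (if i = j then p x else 0) + x $ j * pd i p x)"
  by (subst pd_mult[OF hp_coord]) (auto simp: pd_coord)

text \<open>Degree 0 has to be carried along in the induction: for a linear \<open>x $ j * p\<close>
  the term \<open>x $ j * pd i p x\<close> has degree 0 only because the derivative of the constant
  p vanishes.\<close>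

lemma hp_pd_aux: "hp n p \<Longrightarrow> (n = 0 \<longrightarrow> pd i p = (\<lambda>_. 0)) \<and> (\<forall>m. n = Suc m \<longrightarrow> hp m (pd i p))"
proof (induction rule: hp.induct)
  case (hp_coord_mult n p j)
  have "hp n (\<lambda>x. x $ j * pd i p x)"
  proof (cases n)
    case 0
    then show ?thesis using hp_coord_mult.IH hp_zero[of 0] by simp
  next
    case (Suc m)
    then show ?thesis using hp_coord_mult.IH by (auto intro: hp.intros)
  qed
  moreover have "hp n (\<lambda>x. if i = j then p x else 0)"
    using hp_coord_mult.hyps by (cases "i = j") (auto intro: hp_zero)
  ultimately show ?case
    by (auto simp: pd_coord_mult[OF hp_coord_mult.hyps] intro!: hp_add)
next
  case (hp_add n p q)
  then show ?case by (auto simp: pd_add[OF hp_add.hyps] intro: hp.hp_add)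
qed (auto simp: pd_const intro: hp_zero)

lemma hp_pd_Suc: "hp (Suc n) p \<Longrightarrow> hp n (pd i p)"
  using hp_pd_aux by blast

lemma pd_hp_0: "hp 0 p \<Longrightarrow> pd i p = (\<lambda>_. 0)"
  using hp_pd_aux by blast

lemma hp_pd: "hp n p \<Longrightarrow> hp (n - 1) (pd i p)"
  by (cases n) (auto simp: pd_hp_0 intro: hp_zero hp_pd_Suc)

text \<open>No Schwarz theorem is involved: after two applications of the product rule to
  \<open>x $ k * p x\<close> the result is visibly symmetric in the two directions, up to the
  induction hypothesis.\<close>

lemma pd_comm: "hp n p \<Longrightarrow> pd i (pd j p) = pd j (pd i p)"
proof (induction rule: hp.induct)
  case (hp_coord_mult n p k)
  have 1: "hp n (\<lambda>x. if j = k then p x else 0)" for j using hp_coord_mult.hyps by (cases "j = k") (auto intro: hp_zero)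
  have *: "pd i (pd j (\<lambda>x. x $ k * p x)) =
     (\<lambda>x. (if j = k then pd i p x else 0) + (if i = k then pd j p x else 0) + x $ k * pd i (pd j p) x)" for i j
    unfolding pd_coord_mult[OF hp_coord_mult.hyps]
    apply (subst pd_add[OF 1 hp.hp_coord_mult[OF hp_pd[OF hp_coord_mult.hyps]]])
    apply (subst pd_coord_mult[OF hp_pd[OF hp_coord_mult.hyps]])
    by (cases "j = k") (auto simp: pd_const)
  show ?case unfolding * hp_coord_mult.IH by auto
next
  case (hp_add n p q)
  show ?case
    by (simp add: pd_add[OF hp_add.hyps] pd_add[OF hp_pd[OF hp_add.hyps(1)] hp_pd[OF hp_add.hyps(2)]] hp_add.IH)
qed (auto simp: pd_const)

lemma euler: "hp n p \<Longrightarrow> (\<Sum>i\<in>UNIV. x $ i * pd i p x) = real n * p x"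
proof (induction rule: hp.induct)
  case (hp_coord_mult n p k)
  have "(\<Sum>i\<in>UNIV. x $ i * pd i (\<lambda>x. x $ k * p x) x) =
     (\<Sum>i\<in>UNIV. x $ i * (if i = k then p x else 0)) + x $ k * (\<Sum>i\<in>UNIV. x $ i * pd i p x)"
    unfolding pd_coord_mult[OF hp_coord_mult.hyps]
    by (simp add: algebra_simps sum.distrib sum_distrib_left)
  also have "(\<Sum>i\<in>UNIV. x $ i * (if i = k then p x else 0)) = (\<Sum>i\<in>UNIV. if k = i then x $ i * p x else 0)"
    by (intro sum.cong) auto
  also have "\<dots> = x $ k * p x" by simp
  finally show ?case by (simp add: hp_coord_mult.IH algebra_simps)
next
  case (hp_add n p q)
  then show ?case by (simp add: pd_add[OF hp_add.hyps] algebra_simps sum.distrib)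
qed (auto simp: pd_const)

lemma hp_lap: "hp n p \<Longrightarrow> hp (n - 2) (lap p)"
  unfolding lap_def using hp_pd[OF hp_pd, of n p]
  by (auto intro!: hp_sum simp: numeral_2_eq_2 diff_diff_eq)

lemma lap_add: "hp n p \<Longrightarrow> hp m q \<Longrightarrow> lap (\<lambda>x. p x + q x) = (\<lambda>x. lap p x + lap q x)"
  by (rule ext) (simp add: lap_def pd_add pd_add[OF hp_pd hp_pd] sum.distrib)

lemma lap_cmult: "hp n p \<Longrightarrow> lap (\<lambda>x. c * p x) = (\<lambda>x. c * lap p x)"
  by (rule ext) (simp add: lap_def pd_cmult pd_cmult[OF hp_pd] sum_distrib_left)

lemma lap_const: "lap (\<lambda>_. c) = (\<lambda>_. 0)"
  by (rule ext) (simp add: lap_def pd_const)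

lemma lap_sum: "finite A \<Longrightarrow> (\<And>a. a \<in> A \<Longrightarrow> hp n (p a)) \<Longrightarrow>
    lap (\<lambda>x. \<Sum>a\<in>A. p a x) = (\<lambda>x. \<Sum>a\<in>A. lap (p a) x)"
proof (induction A rule: finite_induct)
  case (insert a A)
  then show ?case by (simp add: lap_add[of n _ n] hp_sum)
qed (simp add: lap_const)

lemma lap_hp_small: "hp n p \<Longrightarrow> n < 2 \<Longrightarrow> lap p = (\<lambda>_. 0)"
proof -
  assume p: "hp n p" "n < 2"
  have "pd i (pd i p) = (\<lambda>_. 0)" for i
    using p(2) by (intro pd_hp_0) (use hp_pd[OF p(1), of i] in \<open>auto simp: less_2_cases_iff\<close>)
  then show ?thesis by (intro ext) (simp add: lap_def)
qed

text \<open>In the constant, 2N is the Laplacian of the squared norm, and 4m comes from the cross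
  term, which is 4 times the Euler field applied to \<open>q\<close>.\<close>

lemma lap_norm_mult:
  fixes q :: "real^'n \<Rightarrow> real"
  assumes q: "hp m q"
  shows "lap (\<lambda>x. (norm x)\<^sup>2 * q x) =
    (\<lambda>x. (norm x)\<^sup>2 * lap q x + (2 * real CARD('n) + 4 * real m) * q x)"
proof
  fix x :: "real^'n"
  have n2: "(norm y)\<^sup>2 = (\<Sum>i\<in>UNIV. y $ i * y $ i)" for y :: "real^'n"
    by (simp add: power2_norm_eq_inner inner_vec_def)
  have c: "hp m (\<lambda>x. if b then q x else 0)" for b using q by (cases b) (auto intro: hp_zero)
  have 0: "pd i (\<lambda>x. if b then q x else 0) = (\<lambda>x. if b then pd i q x else 0)" for i b by (cases b) (auto simp: pd_const)
  have 1: "pd i (\<lambda>x. x $ j * (x $ j * q x)) =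
      (\<lambda>x. (if i = j then 2 * (x $ j * q x) else 0) + x $ j * (x $ j * pd i q x))" for i j
    unfolding pd_coord_mult[OF hp_coord_mult[OF q]] pd_coord_mult[OF q] by (simp add: fun_eq_iff algebra_simps)
  have c2: "hp (Suc m) (\<lambda>x. if b then 2 * (x $ j * q x) else 0)" for b j
    using hp_cmult[OF hp_coord_mult[OF q]] by (cases b) (auto intro: hp_zero)
  have d2: "pd i (\<lambda>x. if i = j then 2 * (x $ j * q x) else 0) = (\<lambda>x. if i = j then 2 * (q x + x $ j * pd i q x) else 0)" for i j
    by (cases "i = j") (auto simp: pd_const pd_cmult[OF hp_coord_mult[OF q]] pd_coord_mult[OF q])
  have 2: "pd i (pd i (\<lambda>x. x $ j * (x $ j * q x))) x =
      (if i = j then 2 * q x + 4 * (x $ j * pd i q x) else 0) + x $ j * (x $ j * pd i (pd i q) x)" for i j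
    unfolding 1
    apply (subst pd_add[OF c2 hp_coord_mult[OF hp_coord_mult[OF hp_pd[OF q]]]])
    apply (subst pd_coord_mult[OF hp_coord_mult[OF hp_pd[OF q]]])
    apply (subst pd_coord_mult[OF hp_pd[OF q]])
    unfolding d2 by (simp add: algebra_simps)
  have h: "hp (Suc (Suc m)) (\<lambda>x. x $ j * (x $ j * q x))" for j by (intro hp_coord_mult q)
  have "(\<lambda>x. (norm x)\<^sup>2 * q x) = (\<lambda>x. \<Sum>j\<in>UNIV. x $ j * (x $ j * q x))"
    by (simp add: n2 sum_distrib_right mult.assoc)
  then have "lap (\<lambda>x. (norm x)\<^sup>2 * q x) x = (\<Sum>j\<in>UNIV. lap (\<lambda>x. x $ j * (x $ j * q x)) x)"
    using lap_sum[OF finite[of UNIV], where p="\<lambda>j x. x $ j * (x $ j * q x)" and n="Suc (Suc m)"] h by simp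
  also have "\<dots> = (\<Sum>j\<in>UNIV. (\<Sum>i\<in>UNIV. if i = j then 2 * q x + 4 * (x $ j * pd i q x) else 0) + x $ j * x $ j * lap q x)"
    unfolding lap_def 2 by (simp add: sum.distrib sum_distrib_left mult.assoc)
  also have "\<dots> = (\<Sum>j\<in>UNIV. 2 * q x + 4 * (x $ j * pd j q x)) + (norm x)\<^sup>2 * lap q x"
    by (simp add: sum.distrib n2 sum_distrib_right)
  also have "\<dots> = 2 * real CARD('n) * q x + 4 * (real m * q x) + (norm x)\<^sup>2 * lap q x"
    by (simp add: sum.distrib euler[OF q] flip: sum_distrib_left)
  finally show "lap (\<lambda>x. (norm x)\<^sup>2 * q x) x = (norm x)\<^sup>2 * lap q x + (2 * real CARD('n) + 4 * real m) * q x"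
    by (simp add: algebra_simps)
qed

text \<open>One factor of the squared norm is peeled off at a time; the remaining factor has degree
  2j + m, and the constants 2N + 4(m + 2j) add up to the stated product.\<close>

lemma lap_norm_power_mult:
  fixes q :: "real^'n \<Rightarrow> real"
  assumes q: "hp m q"
  shows "lap (\<lambda>x. norm x ^ (2 * Suc j) * q x) =
    (\<lambda>x. norm x ^ (2 * Suc j) * lap q x
       + 2 * real (Suc j) * (2 * real (Suc j) + real CARD('n) - 2 + 2 * real m) * (norm x ^ (2 * j) * q x))"
proof (induction j)
  case 0
  have "2 * Suc 0 = 2" by simp
  then show ?case by (simp only: lap_norm_mult[OF q]) (simp add: fun_eq_iff algebra_simps)
next
  case (Suc j)
  have h: "hp (2 * Suc j + m) (\<lambda>x. norm x ^ (2 * Suc j) * q x)" by (intro hp_mult hp_norm_power q)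
  have "(\<lambda>x. norm x ^ (2 * Suc (Suc j)) * q x) = (\<lambda>x. (norm x)\<^sup>2 * (norm x ^ (2 * Suc j) * q x))"
    by (simp add: fun_eq_iff power2_eq_square)
  then show ?case
    by (simp only: lap_norm_mult[OF h] Suc.IH)
       (simp add: fun_eq_iff algebra_simps power2_eq_square)
qed

section \<open>Monomials and the link to the coefficient description of homogeneous
  polynomials\<close>

definition monom_fn :: "('n \<Rightarrow> nat) \<Rightarrow> real^'n \<Rightarrow> real" where
  "monom_fn \<alpha> x = (\<Prod>i\<in>UNIV. (x $ i) ^ \<alpha> i)"

lemma finite_multi_index: "finite {\<alpha>::'n::finite \<Rightarrow> nat. sum \<alpha> UNIV = n}"
proof (rule finite_subset)
  show "{\<alpha>::'n \<Rightarrow> nat. sum \<alpha> UNIV = n} \<subseteq> (UNIV \<rightarrow>\<^sub>E {..n})"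
    by (auto simp: PiE_def extensional_def intro: member_le_sum)
qed (auto intro!: finite_PiE)

lemma monom_fn_Suc: "monom_fn (\<alpha>(i := Suc (\<alpha> i))) x = x $ i * monom_fn \<alpha> x"
  unfolding monom_fn_def by (simp add: prod.remove[of UNIV i])

lemma sum_fun_upd_UNIV: "sum (\<alpha>(i := k)) UNIV + \<alpha> i = sum \<alpha> UNIV + (k::nat)" for \<alpha> :: "'n::finite \<Rightarrow> nat"
proof -
  have "sum (\<alpha>(i := k)) (UNIV - {i}) = sum \<alpha> (UNIV - {i})" by (intro sum.cong) auto
  then show ?thesis by (simp add: sum.remove[of UNIV i])
qed

lemma multi_index_cases:
  fixes \<alpha> :: "'n::finite \<Rightarrow> nat"
  assumes "sum \<alpha> UNIV = Suc n"
  obtains i \<beta> where "\<alpha> = \<beta>(i := Suc (\<beta> i))" "sum \<beta> UNIV = n"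
proof -
  obtain i where i: "\<alpha> i \<noteq> 0" using assms by (metis sum.neutral nat.distinct(1))
  have "\<alpha> = (\<alpha>(i := \<alpha> i - 1))(i := Suc ((\<alpha>(i := \<alpha> i - 1)) i))" using i by auto
  moreover have "sum (\<alpha>(i := \<alpha> i - 1)) UNIV = n" using sum_fun_upd_UNIV[of \<alpha> i "\<alpha> i - 1"] i assms by simp
  ultimately show ?thesis using that by blast
qed

lemma hp_monom_fn: "hp (sum \<alpha> UNIV) (monom_fn \<alpha>)"
proof (induction "sum \<alpha> UNIV" arbitrary: \<alpha>)
  case 0
  then have "\<alpha> = (\<lambda>_. 0)" by (auto simp: fun_eq_iff)
  then show ?case by (simp add: monom_fn_def[abs_def] hp_const)
next
  case (Suc n)
  then obtain i \<beta> where b: "\<alpha> = \<beta>(i := Suc (\<beta> i))" "sum \<beta> UNIV = n" by (metis multi_index_cases)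
  have "monom_fn \<alpha> = (\<lambda>x. x $ i * monom_fn \<beta> x)" by (simp add: b monom_fn_Suc fun_eq_iff)
  then show ?case using hp_coord_mult[of n "monom_fn \<beta>" i] Suc(1)[of \<beta>] b Suc(2) by simp
qed

lemma hom_poly_alt: "hom_poly n p \<longleftrightarrow> (\<exists>c. \<forall>x. p x = (\<Sum>\<alpha> | sum \<alpha> UNIV = n. c \<alpha> * monom_fn \<alpha> x))"
  by (simp add: hom_poly_def monom_fn_def)

text \<open>The inductive predicate supports structural induction for calculus; the coefficient form
  yields finite spanning families and reduces Gaussian integrals to monomials. Both are used from
  here on.\<close>

lemma hom_poly_iff_hp: "hom_poly n p \<longleftrightarrow> hp n p"
proof
  assume "hom_poly n p"
  then obtain c where "p = (\<lambda>x. \<Sum>\<alpha> | sum \<alpha> UNIV = n. c \<alpha> * monom_fn \<alpha> x)"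
    by (auto simp: hom_poly_alt fun_eq_iff)
  then show "hp n p" using hp_monom_fn by (auto intro!: hp_sum hp_cmult finite_multi_index)
next
  assume "hp n p"
  then show "hom_poly n p"
  proof (induction rule: hp.induct)
    case (hp_zero n)
    show ?case unfolding hom_poly_alt by (rule exI[of _ "\<lambda>_. 0"]) simp
  next
    case (hp_const c)
    have "{\<alpha>::'a \<Rightarrow> nat. sum \<alpha> UNIV = 0} = {\<lambda>_. 0}" by (auto simp: fun_eq_iff)
    then show ?case unfolding hom_poly_alt by (intro exI[of _ "\<lambda>_. c"]) (simp add: monom_fn_def)
  next
    case (hp_coord_mult n p i)
    then obtain c where c: "\<And>x. p x = (\<Sum>\<alpha> | sum \<alpha> UNIV = n. c \<alpha> * monom_fn \<alpha> x)" by (auto simp: hom_poly_alt)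
    \<comment> \<open>Multiplication by \<open>x $ i\<close> raises the i-th exponent. Multi-indices
      with \<open>\<beta> i = 0\<close> are not hit; the guard gives them coefficient 0, as the
      truncated \<open>\<beta> i - 1\<close> would pick a wrong one.\<close>
    define d where "d \<beta> = (if \<beta> i = 0 then 0 else c (\<beta>(i := \<beta> i - 1)))" for \<beta>
    have "x $ i * p x = (\<Sum>\<beta> | sum \<beta> UNIV = Suc n. d \<beta> * monom_fn \<beta> x)" for x
    proof -
      let ?u = "\<lambda>\<alpha>::'a\<Rightarrow>nat. \<alpha>(i := Suc (\<alpha> i))"
      have s: "sum (?u \<alpha>) UNIV = Suc (sum \<alpha> UNIV)" for \<alpha> using sum_fun_upd_UNIV[of \<alpha> i "Suc (\<alpha> i)"] by simp
      have "(\<Sum>\<beta> | sum \<beta> UNIV = Suc n. d \<beta> * monom_fn \<beta> x) = (\<Sum>\<beta> | sum \<beta> UNIV = Suc n \<and> \<beta> i \<noteq> 0. d \<beta> * monom_fn \<beta> x)"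
        by (rule sum.mono_neutral_right[OF finite_multi_index]) (auto simp: d_def)
      also have "\<dots> = (\<Sum>\<alpha> | sum \<alpha> UNIV = n. d (?u \<alpha>) * monom_fn (?u \<alpha>) x)"
      proof (rule sum.reindex_bij_witness[where i="?u" and j="\<lambda>\<beta>. \<beta>(i := \<beta> i - 1)"])
        fix \<beta> assume b: "\<beta> \<in> {\<beta>. sum \<beta> UNIV = Suc n \<and> \<beta> i \<noteq> 0}"
        then show "(\<beta>(i := \<beta> i - 1)) \<in> {\<alpha>. sum \<alpha> UNIV = n}"
          using sum_fun_upd_UNIV[of \<beta> i "\<beta> i - 1"] by simp
      qed (use s in auto)
      also have "\<dots> = x $ i * p x"
        by (simp add: c d_def monom_fn_Suc sum_distrib_left mult.left_commute)
      finally show ?thesis by simp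
    qed
    then show ?case by (auto simp: hom_poly_alt)
  next
    case (hp_add n p q)
    then obtain c d where "\<And>x. p x = (\<Sum>\<alpha> | sum \<alpha> UNIV = n. c \<alpha> * monom_fn \<alpha> x)"
      "\<And>x. q x = (\<Sum>\<alpha> | sum \<alpha> UNIV = n. d \<alpha> * monom_fn \<alpha> x)" by (auto simp: hom_poly_alt)
    then have "p x + q x = (\<Sum>\<alpha> | sum \<alpha> UNIV = n. (c \<alpha> + d \<alpha>) * monom_fn \<alpha> x)" for x
      by (simp add: algebra_simps sum.distrib)
    then show ?case by (auto simp: hom_poly_alt)
  qed
qed

text \<open>The definition differentiates twice along one line through x, while \<open>pd\<close>
  always differentiates at parameter 0; moving the base point along the line reconciles the
  two.\<close>

lemma harmonic_fun_iff_lap: "hp n p \<Longrightarrow> harmonic_fun p \<longleftrightarrow> lap p = (\<lambda>_. 0)"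
proof -
  assume p: "hp n p"
  have "deriv (\<lambda>s. p (x + s *\<^sub>R axis i 1)) t = pd i p (x + t *\<^sub>R axis i 1)" for x i t
  proof -
    have "((\<lambda>s. p ((x + t *\<^sub>R axis i 1) + s *\<^sub>R axis i 1)) has_real_derivative pd i p (x + t *\<^sub>R axis i 1)) (at (t - t))"
      using hp_has_pd[OF p] by simp
    then have "((\<lambda>s. p ((x + t *\<^sub>R axis i 1) + (s - t) *\<^sub>R axis i 1)) has_real_derivative pd i p (x + t *\<^sub>R axis i 1)) (at t)"
      using DERIV_at_within_shift[of "\<lambda>s. p ((x + t *\<^sub>R axis i 1) + (s - t) *\<^sub>R axis i 1)" _ t 0 UNIV]
      by simp
    then show ?thesis by (intro DERIV_imp_deriv) (simp add: algebra_simps)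
  qed
  then show ?thesis by (simp add: harmonic_fun_def fun_eq_iff lap_def pd_def[symmetric])
qed

lemma sph_harm_iff: "p \<in> sph_harm n \<longleftrightarrow> hp n p \<and> lap p = (\<lambda>_. 0)"
  by (auto simp: sph_harm_def hom_poly_iff_hp harmonic_fun_iff_lap)

lemma sph_harm_hp: "p \<in> sph_harm n \<Longrightarrow> hp n p"
  by (simp add: sph_harm_iff)

lemma sph_harm_zero: "(\<lambda>_. 0) \<in> sph_harm n"
  by (simp add: sph_harm_iff hp_zero lap_const)

lemma sph_harm_add: "p \<in> sph_harm n \<Longrightarrow> q \<in> sph_harm n \<Longrightarrow> (\<lambda>x. p x + q x) \<in> sph_harm n"
  by (auto simp: sph_harm_iff hp_add lap_add)

lemma sph_harm_cmult: "p \<in> sph_harm n \<Longrightarrow> (\<lambda>x. c * p x) \<in> sph_harm n"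
  by (auto simp: sph_harm_iff hp_cmult lap_cmult)

lemma sph_harm_diff: "p \<in> sph_harm n \<Longrightarrow> q \<in> sph_harm n \<Longrightarrow> (\<lambda>x. p x - q x) \<in> sph_harm n"
  using sph_harm_add[of p n "\<lambda>x. (-1) * q x"] sph_harm_cmult[of q n "-1"] by simp

lemma sph_harm_sum: "finite A \<Longrightarrow> (\<And>a. a \<in> A \<Longrightarrow> p a \<in> sph_harm n) \<Longrightarrow> (\<lambda>x. \<Sum>a\<in>A. p a x) \<in> sph_harm n"
  by (induction A rule: finite_induct) (auto intro: sph_harm_zero sph_harm_add)

lemma lap_pd: "hp n p \<Longrightarrow> lap (pd i p) = pd i (lap p)"
proof
  fix x
  assume p: "hp n p"
  have h: "hp (n - 1 - 1) (pd j (pd j p))" for j by (intro hp_pd p)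
  have "pd i (lap p) x = (\<Sum>j\<in>UNIV. pd i (pd j (pd j p)) x)"
    unfolding lap_def[abs_def] by (subst pd_sum[OF finite[of UNIV], where p="\<lambda>j. pd j (pd j p)", OF h]) simp
  also have "\<dots> = (\<Sum>j\<in>UNIV. pd j (pd j (pd i p)) x)"
    by (intro sum.cong refl) (metis pd_comm p hp_pd)
  finally show "lap (pd i p) x = pd i (lap p) x" by (simp add: lap_def)
qed

lemma sph_harm_pd: "p \<in> sph_harm (Suc n) \<Longrightarrow> pd i p \<in> sph_harm n"
  by (auto simp: sph_harm_iff hp_pd_Suc lap_pd pd_const)

lemma sph_harm_0_const: "p \<in> sph_harm 0 \<Longrightarrow> \<exists>c. p = (\<lambda>_. c)"
  by (simp add: sph_harm_iff hp_0_const)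

lemma sph_harm_const: "(\<lambda>_. c) \<in> sph_harm 0"
  by (simp add: sph_harm_iff hp_const lap_const)

text \<open>The coefficients for which \<open>\<Sum>\<^sub>j c\<^sub>j |x|\<^sup>2\<^sup>j \<Delta>\<^sup>j p\<close> is the harmonic component of \<open>p\<close>.\<close>

fun hcoef :: "real \<Rightarrow> nat \<Rightarrow> nat \<Rightarrow> real" where
  "hcoef N n 0 = 1"
| "hcoef N n (Suc j) = - hcoef N n j / (2 * real (Suc j) * (N + 2 * real n - 2 * real j - 4))"

definition harm_comp :: "nat \<Rightarrow> (real^'n \<Rightarrow> real) \<Rightarrow> real^'n \<Rightarrow> real" where
  "harm_comp n p x = (\<Sum>j\<le>n div 2. hcoef (real CARD('n)) n j * (norm x ^ (2 * j) * (lap ^^ j) p x))"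

lemma hp_lap_funpow: "hp n p \<Longrightarrow> hp (n - 2 * j) ((lap ^^ j) p)"
proof (induction j)
  case (Suc j)
  then show ?case using hp_lap[OF Suc.IH] by (simp add: diff_diff_eq add.commute)
qed simp

lemma hp_harm_term: "hp n p \<Longrightarrow> 2 * j \<le> n \<Longrightarrow> hp n (\<lambda>x. c * (norm x ^ (2 * j) * (lap ^^ j) p x))"
  using hp_mult[OF hp_norm_power hp_lap_funpow, of n p j j] by (intro hp_cmult) simp

text \<open>The sum telescopes: the recursion for \<open>hcoef\<close> is chosen so that the
  lower-order term of the Laplacian of the new summand cancels what the previous partial sum has
  left over.\<close>

lemma lap_harm_partial:
  fixes p :: "real^'n \<Rightarrow> real"
  assumes p: "hp n p" and N: "CARD('n) \<ge> 3"
  shows "2 * J \<le> n \<Longrightarrow> lap (\<lambda>x. \<Sum>j\<le>J. hcoef (real CARD('n)) n j * (norm x ^ (2 * j) * (lap ^^ j) p x)) =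
     (\<lambda>x. hcoef (real CARD('n)) n J * (norm x ^ (2 * J) * (lap ^^ (Suc J)) p x))"
proof (induction J)
  case 0
  then show ?case by simp
next
  case (Suc J)
  let ?N = "real CARD('n)"
  have m: "real (n - 2 * Suc J) = real n - 2 * real J - 2" using Suc.prems by (simp add: of_nat_diff)
  \<comment> \<open>The denominator in \<open>hcoef\<close> is safe because 2J + 2 <= n and N >= 3
    bound it below by n + 1.\<close>
  have nz: "?N + 2 * real n - 2 * real J - 4 > 0"
  proof -
    have "real n \<ge> 2 * real J + 2" "?N \<ge> 3" using Suc.prems N by simp_all
    then show ?thesis by linarith
  qed
  have h1: "hp n (\<lambda>x. \<Sum>j\<le>J. hcoef ?N n j * (norm x ^ (2 * j) * (lap ^^ j) p x))"
    using Suc.prems by (intro hp_sum hp_harm_term p) auto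
  have h3: "hp n (\<lambda>x. norm x ^ (2 * Suc J) * (lap ^^ (Suc J)) p x)"
    using hp_harm_term[OF p Suc.prems, of 1] by simp
  have h2: "hp n (\<lambda>x. hcoef ?N n (Suc J) * (norm x ^ (2 * Suc J) * (lap ^^ (Suc J)) p x))"
    by (rule hp_harm_term[OF p Suc.prems])
  have l: "lap (\<lambda>x. norm x ^ (2 * Suc J) * (lap ^^ (Suc J)) p x) =
    (\<lambda>x. norm x ^ (2 * Suc J) * (lap ^^ (Suc (Suc J))) p x
       + 2 * real (Suc J) * (?N + 2 * real n - 2 * real J - 4) * (norm x ^ (2 * J) * (lap ^^ (Suc J)) p x))"
    unfolding lap_norm_power_mult[OF hp_lap_funpow[OF p]] m by (simp add: algebra_simps)
  have IH: "lap (\<lambda>x. \<Sum>j\<le>J. hcoef ?N n j * (norm x ^ (2 * j) * (lap ^^ j) p x)) =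
     (\<lambda>x. hcoef ?N n J * (norm x ^ (2 * J) * (lap ^^ (Suc J)) p x))" using Suc by simp
  have cc: "hcoef ?N n (Suc J) * (2 * real (Suc J) * (?N + 2 * real n - 2 * real J - 4)) = - hcoef ?N n J"
    using nz by (simp del: of_nat_Suc)
  have "lap (\<lambda>x. (\<Sum>j\<le>J. hcoef ?N n j * (norm x ^ (2 * j) * (lap ^^ j) p x)) +
       hcoef ?N n (Suc J) * (norm x ^ (2 * Suc J) * (lap ^^ (Suc J)) p x)) =
    (\<lambda>x. hcoef ?N n J * (norm x ^ (2 * J) * (lap ^^ (Suc J)) p x) +
      (hcoef ?N n (Suc J) * (norm x ^ (2 * Suc J) * (lap ^^ (Suc (Suc J))) p x)
       + (hcoef ?N n (Suc J) * (2 * real (Suc J) * (?N + 2 * real n - 2 * real J - 4))) * (norm x ^ (2 * J) * (lap ^^ (Suc J)) p x)))"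
    unfolding lap_add[OF h1 h2] lap_cmult[OF h3] IH l by (simp only: distrib_left mult.assoc)
  then show ?case unfolding cc by simp
qed

text \<open>After the last summand the leftover contains one more Laplacian of a polynomial of
  degree 0 or 1, hence vanishes.\<close>

lemma harm_comp_sph_harm:
  fixes p :: "real^'n \<Rightarrow> real"
  assumes p: "hp n p" and N: "CARD('n) \<ge> 3"
  shows "harm_comp n p \<in> sph_harm n"
proof -
  have h: "hp n (harm_comp n p)"
    unfolding harm_comp_def[abs_def] by (intro hp_sum hp_harm_term p) auto
  have "n - 2 * (n div 2) < 2" by presburger
  then have "(lap ^^ (Suc (n div 2))) p = (\<lambda>_. 0)"
    using lap_hp_small[OF hp_lap_funpow[OF p, of "n div 2"]] by simp
  then have "lap (harm_comp n p) = (\<lambda>_. 0)"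
    unfolding harm_comp_def[abs_def] by (subst lap_harm_partial[OF p N]) (auto simp del: funpow.simps)
  with h show ?thesis by (simp add: sph_harm_iff)
qed

lemma funpow_lap_const_zero: "(lap ^^ j) (\<lambda>_. 0) = (\<lambda>_. 0)"
  by (induction j) (auto simp: lap_const)

lemma harm_comp_harmonic: "p \<in> sph_harm n \<Longrightarrow> harm_comp n p = p"
proof
  fix x assume p: "p \<in> sph_harm n"
  have 0: "(lap ^^ j) p = (\<lambda>_. 0)" if "j \<noteq> 0" for j
    using that p by (cases j) (auto simp: sph_harm_iff funpow_swap1 funpow_lap_const_zero)
  have "harm_comp n p x = (\<Sum>j\<le>n div 2. if j = 0 then p x else 0)"
    unfolding harm_comp_def by (intro sum.cong) (auto simp: 0)
  then show "harm_comp n p x = p x" by simp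
qed

lemma lap_funpow_add: "hp n p \<Longrightarrow> hp n q \<Longrightarrow> (lap ^^ j) (\<lambda>x. p x + q x) = (\<lambda>x. (lap ^^ j) p x + (lap ^^ j) q x)"
  by (induction j) (auto simp: lap_add[OF hp_lap_funpow hp_lap_funpow])

lemma lap_funpow_cmult: "hp n p \<Longrightarrow> (lap ^^ j) (\<lambda>x. c * p x) = (\<lambda>x. c * (lap ^^ j) p x)"
  by (induction j) (auto simp: lap_cmult[OF hp_lap_funpow])

lemma harm_comp_add: "hp n p \<Longrightarrow> hp n q \<Longrightarrow> harm_comp n (\<lambda>x. p x + q x) = (\<lambda>x. harm_comp n p x + harm_comp n q x)"
  by (rule ext) (simp add: harm_comp_def lap_funpow_add algebra_simps sum.distrib)

lemma harm_comp_cmult: "hp n p \<Longrightarrow> harm_comp n (\<lambda>x. c * p x) = (\<lambda>x. c * harm_comp n p x)"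
  by (rule ext) (simp add: harm_comp_def lap_funpow_cmult sum_distrib_left algebra_simps)

lemma harm_comp_sum: "finite A \<Longrightarrow> (\<And>a. a \<in> A \<Longrightarrow> hp n (p a)) \<Longrightarrow>
   harm_comp n (\<lambda>x. \<Sum>a\<in>A. c a * p a x) = (\<lambda>x. \<Sum>a\<in>A. c a * harm_comp n (p a) x)"
proof (induction A rule: finite_induct)
  case empty
  then show ?case using harm_comp_cmult[OF hp_zero, of n 0] by simp
next
  case (insert a A)
  have "hp n (\<lambda>x. \<Sum>a\<in>A. c a * p a x)" using insert by (auto intro!: hp_sum hp_cmult)
  then show ?case using insert by (simp add: harm_comp_add hp_cmult harm_comp_cmult)
qed

text \<open>\<open>harm_comp n\<close> is linear and fixes harmonics, so the images of the finitely
  many monomials span. This finite family is what makes the orthogonal projection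
  constructible.\<close>

lemma sph_harm_span:
  assumes "Y \<in> sph_harm n"
  shows "\<exists>c. Y = (\<lambda>x. \<Sum>\<alpha> | sum \<alpha> UNIV = n. c \<alpha> * harm_comp n (monom_fn \<alpha>) x)"
proof -
  have "hom_poly n Y" using assms by (simp add: sph_harm_def)
  then obtain c where Y: "Y = (\<lambda>x. \<Sum>\<alpha> | sum \<alpha> UNIV = n. c \<alpha> * monom_fn \<alpha> x)"
    by (auto simp: hom_poly_alt fun_eq_iff)
  have m: "hp n (monom_fn \<alpha>)" if "\<alpha> \<in> {\<alpha>. sum \<alpha> UNIV = n}" for \<alpha> using hp_monom_fn[of \<alpha>] that by simp
  have "Y = harm_comp n Y" using harm_comp_harmonic[OF assms] by simp
  also have "\<dots> = (\<lambda>x. \<Sum>\<alpha> | sum \<alpha> UNIV = n. c \<alpha> * harm_comp n (monom_fn \<alpha>) x)"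
    unfolding Y by (intro harm_comp_sum finite_multi_index m)
  finally show ?thesis by blast
qed

lemma hp_eq_sum_harmonics_on_sphere:
  fixes p :: "real^'n \<Rightarrow> real"
  assumes N: "CARD('n) \<ge> 3"
  shows "hp n p \<Longrightarrow> \<exists>Y. (\<forall>m. Y m \<in> sph_harm m) \<and> (\<forall>x\<in>sphere 0 1. p x = (\<Sum>m\<le>n. Y m x))"
proof (induction n arbitrary: p rule: less_induct)
  case (less n)
  show ?case
  proof (cases "n < 2")
    case True
    then have p: "p \<in> sph_harm n" using less.prems lap_hp_small by (auto simp: sph_harm_iff)
    have "p x = (\<Sum>m\<le>n. (if m = n then p else (\<lambda>_. 0)) x)" for x
    proof -
      have "(\<Sum>m\<le>n. (if m = n then p else (\<lambda>_. 0)) x) = (\<Sum>m\<le>n. if n = m then p x else 0)" by (intro sum.cong) auto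
      then show ?thesis by simp
    qed
    then show ?thesis using p by (intro exI[of _ "\<lambda>m. if m = n then p else (\<lambda>_. 0)"]) (auto simp: sph_harm_zero)
  next
    case False
    \<comment> \<open>Each summand with j >= 1 loses two powers of the norm compared with
      \<open>harm_comp\<close>. That changes nothing on the unit sphere but makes \<open>q\<close>
      homogeneous of degree n - 2, to which the induction hypothesis applies.\<close>
    define q where "q x = - (\<Sum>j\<in>{1..n div 2}. hcoef (real CARD('n)) n j * (norm x ^ (2 * (j - 1)) * (lap ^^ j) p x))" for x :: "real^'n"
    have q: "hp (n - 2) q"
    proof -
      have "hp (n - 2) (\<lambda>x. hcoef (real CARD('n)) n j * (norm x ^ (2 * (j - 1)) * (lap ^^ j) p x))"
        if "j \<in> {1..n div 2}" for j
      proof -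
        have "2 * (j - 1) + (n - 2 * j) = n - 2" using that by auto
        then show ?thesis using hp_mult[OF hp_norm_power hp_lap_funpow[OF less.prems], of "j - 1" j] by (intro hp_cmult) simp
      qed
      then have "hp (n - 2) (\<lambda>x. (-1) * (\<Sum>j\<in>{1..n div 2}. hcoef (real CARD('n)) n j * (norm x ^ (2 * (j - 1)) * (lap ^^ j) p x)))"
        by (intro hp_cmult[where c="-1"] hp_sum) auto
      then show ?thesis unfolding q_def[abs_def] by simp
    qed
    have pq: "p x = harm_comp n p x + q x" if "x \<in> sphere 0 1" for x
    proof -
      have "{..n div 2} = insert 0 {1..n div 2}" by auto
      then show ?thesis using that by (simp add: harm_comp_def q_def)
    qed
    from less.IH[OF _ q] False obtain Y where Y: "\<forall>m. Y m \<in> sph_harm m" "\<forall>x\<in>sphere 0 1. q x = (\<Sum>m\<le>n-2. Y m x)" by auto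
    define Z where "Z m = (if m \<le> n - 2 then Y m else if m = n then harm_comp n p else (\<lambda>_. 0))" for m
    have "(\<Sum>m\<le>n. Z m x) = (\<Sum>m\<le>n-2. Y m x) + harm_comp n p x" for x
    proof -
      have "n = Suc (Suc (n - 2))" using False by simp
      then obtain k where k: "n = Suc (Suc k)" by blast
      show ?thesis unfolding k Z_def by simp
    qed
    moreover have "Z m \<in> sph_harm m" for m
      using Y harm_comp_sph_harm[OF less.prems N] by (simp add: Z_def sph_harm_zero)
    ultimately show ?thesis using pq Y(2) by (intro exI[of _ Z]) simp
  qed
qed

subsection \<open>Gaussian integrals of polynomials\<close>

lemma Basis_vec_real: "(Basis :: (real^'n) set) = (\<lambda>i. axis i 1) ` UNIV"
  by (auto simp: Basis_vec_def)

lemma inj_axis_one: "inj (\<lambda>i. axis i (1::real))"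
  by (auto simp: inj_on_def axis_eq_axis)

text \<open>Lebesgue measure on \<open>real^'n\<close> is the image of a product over
  \<open>Basis\<close>; the work is the reindexing of \<open>Basis\<close> by coordinates along
  \<open>\<lambda>i. axis i 1\<close>.\<close>

lemma lborel_integral_prod_coords:
  fixes F :: "'n::finite \<Rightarrow> real \<Rightarrow> real"
  assumes int: "\<And>i. integrable lborel (F i)"
  shows "integrable lborel (\<lambda>x::real^'n. \<Prod>i\<in>UNIV. F i (x $ i))"
    and "(LINT x|(lborel::(real^'n) measure). (\<Prod>i\<in>UNIV. F i (x $ i))) = (\<Prod>i\<in>UNIV. LINT t|lborel. F i t)"
proof -
  define G where "G b = F (inv (\<lambda>i. axis i (1::real)) b)" for b :: "real^'n"
  have G: "G (axis i 1) = F i" for i by (simp add: G_def inv_f_f[OF inj_axis_one])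
  interpret product_sigma_finite "\<lambda>_::real^'n. lborel :: real measure" ..
  let ?T = "\<lambda>f::(real^'n) \<Rightarrow> real. \<Sum>b\<in>Basis. f b *\<^sub>R b"
  let ?P = "\<Pi>\<^sub>M b\<in>(Basis::(real^'n) set). (lborel :: real measure)"
  have lb: "lborel = distr ?P (borel :: (real^'n) measure) ?T"
    by (subst (1) lborel_def, subst lborel_eq_real) simp
  have T: "?T \<in> measurable ?P borel" by measurable
  have [measurable]: "F i \<in> borel_measurable borel" for i using int[of i] by (simp add: borel_measurable_integrable)
  have m: "(\<lambda>x::real^'n. \<Prod>i\<in>UNIV. F i (x $ i)) \<in> borel_measurable borel" by measurable
  have eq: "(\<Prod>i\<in>UNIV. F i (?T f $ i)) = (\<Prod>b\<in>Basis. G b (f b))" for f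
  proof -
    have "(\<Prod>b\<in>Basis. G b (f b)) = (\<Prod>i\<in>UNIV. F i (f (axis i 1)))"
      unfolding Basis_vec_real by (subst prod.reindex[OF inj_axis_one]) (simp add: G)
    moreover have "?T f $ i = f (axis i 1)" for i
      using inner_sum_left_Basis[of "axis i 1" f] by (simp add: Basis_vec_real inner_axis)
    ultimately show ?thesis by simp
  qed
  have iG: "integrable lborel (G b)" for b unfolding G_def by (rule int)
  have "integrable ?P (\<lambda>f. \<Prod>b\<in>Basis. G b (f b))" by (rule product_integrable_prod) (auto intro: iG)
  then show "integrable lborel (\<lambda>x::real^'n. \<Prod>i\<in>UNIV. F i (x $ i))"
    unfolding lb by (subst integrable_distr_eq[OF T m]) (simp only: eq)
  have "(LINT x|(lborel::(real^'n) measure). (\<Prod>i\<in>UNIV. F i (x $ i))) = (LINT f|?P. (\<Prod>b\<in>Basis. G b (f b)))"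
    unfolding lb by (subst integral_distr[OF T m]) (simp only: eq)
  also have "\<dots> = (\<Prod>b\<in>Basis. LINT t|lborel. G b t)" by (rule product_integral_prod) (auto intro: iG)
  also have "\<dots> = (\<Prod>i\<in>UNIV. LINT t|lborel. F i t)"
    unfolding Basis_vec_real by (subst prod.reindex[OF inj_axis_one]) (simp add: G)
  finally show "(LINT x|(lborel::(real^'n) measure). (\<Prod>i\<in>UNIV. F i (x $ i))) = (\<Prod>i\<in>UNIV. LINT t|lborel. F i t)" .
qed

definition gmom :: "real \<Rightarrow> nat \<Rightarrow> real" where
  "gmom v k = (LINT t|lborel. t ^ k * exp (- t\<^sup>2 / (2 * v)))"

lemma normal_density_conv: "v > 0 \<Longrightarrow> t ^ k * exp (- t\<^sup>2 / (2 * v)) = sqrt (2 * pi * v) * (normal_density 0 (sqrt v) t * (t - 0) ^ k)"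
  by (simp add: normal_density_def)

lemma integrable_gmom: "v > 0 \<Longrightarrow> integrable lborel (\<lambda>t::real. t ^ k * exp (- t\<^sup>2 / (2 * v)))"
  unfolding normal_density_conv by (intro integrable_mult_right integrable_normal_moment) simp

lemma gmom_even: "v > 0 \<Longrightarrow> gmom v (2 * k) = sqrt (2 * pi * v) * (fact (2 * k) / ((2 / v) ^ k * fact k))"
  unfolding gmom_def normal_density_conv integral_mult_right_zero
  by (subst integral_normal_moment_even) auto

lemma gmom_odd: "v > 0 \<Longrightarrow> gmom v (2 * k + 1) = 0"
  unfolding gmom_def normal_density_conv integral_mult_right_zero
  by (subst integral_normal_moment_odd) auto

lemma gmom_0: "v > 0 \<Longrightarrow> gmom v 0 = sqrt (2 * pi * v)"
  using gmom_even[of v 0] by simp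

lemma gmom_1: "v > 0 \<Longrightarrow> gmom v (Suc 0) = 0"
  using gmom_odd[of v 0] by simp

text \<open>This is one-dimensional Gaussian integration by parts, read off from the closed form of
  the moments.\<close>

lemma gmom_Suc_Suc: "v > 0 \<Longrightarrow> gmom v (Suc (Suc k)) = v * real (Suc k) * gmom v k"
proof -
  assume v: "v > 0"
  show ?thesis
  proof (cases "even k")
    case True
    then obtain j where k: "k = 2 * j" by (elim evenE)
    have e: "Suc (Suc k) = 2 * Suc j" by (simp add: k)
    have f: "fact (2 * Suc j) = (2 * real j + 2) * (2 * real j + 1) * (fact (2 * j) :: real)" by (simp add: algebra_simps)
    have "(fact (2 * Suc j) :: real) / ((2 / v) ^ Suc j * fact (Suc j)) = v * (2 * real j + 1) * (fact (2 * j) / ((2 / v) ^ j * fact j))"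
      unfolding f using v by (simp add: divide_simps)
    moreover have "s * (v * (2 * real j + 1) * F) = v * real (Suc k) * (s * F)" for s F by (simp add: k)
    ultimately show ?thesis unfolding e gmom_even[OF v] by (simp only: k gmom_even[OF v])
  next
    case False
    then obtain j where k: "k = 2 * j + 1" by (elim oddE)
    then have "Suc (Suc k) = 2 * Suc j + 1" by simp
    then show ?thesis using gmom_odd[OF v, of "Suc j"] gmom_odd[OF v, of j] k by simp
  qed
qed

text \<open>An unnormalised centred Gaussian with independent coordinates of variances
  \<open>v i\<close>. Unequal variances are allowed so that a factor
  \<open>exp (- t * perp i y)\<close> can later be absorbed into the weight.\<close>

definition gw :: "('n \<Rightarrow> real) \<Rightarrow> real^'n \<Rightarrow> real" where
  "gw v x = exp (- (\<Sum>i\<in>UNIV. (x $ i)\<^sup>2 / (2 * v i)))"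

definition gint :: "('n \<Rightarrow> real) \<Rightarrow> (real^'n \<Rightarrow> real) \<Rightarrow> real" where
  "gint v p = (LINT x|lborel. p x * gw v x)"

lemma gw_measurable [measurable]: "gw v \<in> borel_measurable borel"
  unfolding gw_def[abs_def] by measurable

lemma monom_fn_gw: "monom_fn \<alpha> x * gw v x = (\<Prod>i\<in>UNIV. (x $ i) ^ \<alpha> i * exp (- (x $ i)\<^sup>2 / (2 * v i)))"
  by (simp add: monom_fn_def gw_def exp_sum prod.distrib sum_negf[symmetric])

context
  fixes v :: "'n::finite \<Rightarrow> real"
  assumes v: "\<And>i. v i > 0"
begin

lemma integrable_monom_gw: "integrable lborel (\<lambda>x. monom_fn \<alpha> x * gw v x)"
  unfolding monom_fn_gw by (intro lborel_integral_prod_coords(1) integrable_gmom v)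

lemma gint_monom: "gint v (monom_fn \<alpha>) = (\<Prod>i\<in>UNIV. gmom (v i) (\<alpha> i))"
  unfolding gint_def monom_fn_gw gmom_def
  by (rule lborel_integral_prod_coords(2), rule integrable_gmom, rule v)

lemma gint_monom_upd: "gint v (monom_fn (\<alpha>(i := k))) = gmom (v i) k * (\<Prod>j\<in>UNIV - {i}. gmom (v j) (\<alpha> j))"
  unfolding gint_monom by (simp add: prod.remove[of UNIV i])

lemma hp_integrable_gw: "hp n p \<Longrightarrow> integrable lborel (\<lambda>x. p x * gw v x)"
proof -
  assume "hp n p"
  then obtain c where p: "p = (\<lambda>x. \<Sum>\<alpha> | sum \<alpha> UNIV = n. c \<alpha> * monom_fn \<alpha> x)"
    unfolding hom_poly_iff_hp[symmetric] hom_poly_alt by (auto simp: fun_eq_iff)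
  show ?thesis unfolding p
    unfolding sum_distrib_right mult.assoc
    by (intro Bochner_Integration.integrable_sum integrable_mult_right integrable_monom_gw)
qed

lemma gint_add: "hp n p \<Longrightarrow> hp m q \<Longrightarrow> gint v (\<lambda>x. p x + q x) = gint v p + gint v q"
  unfolding gint_def by (simp add: distrib_right hp_integrable_gw)

lemma gint_cmult: "gint v (\<lambda>x. c * p x) = c * gint v p"
  unfolding gint_def by (simp add: mult.assoc)

lemma gint_sum: "finite A \<Longrightarrow> (\<And>a. a \<in> A \<Longrightarrow> hp n (p a)) \<Longrightarrow> gint v (\<lambda>x. \<Sum>a\<in>A. p a x) = (\<Sum>a\<in>A. gint v (p a))"
  unfolding gint_def sum_distrib_right by (rule Bochner_Integration.integral_sum) (rule hp_integrable_gw)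

lemma gint_const: "gint v (\<lambda>_. c) = c * (\<Prod>i\<in>UNIV. sqrt (2 * pi * v i))"
  using gint_monom[of "\<lambda>_. 0"] gint_cmult[of c "\<lambda>_. 1"] v
  by (simp add: monom_fn_def[abs_def] gmom_0)

lemma pd_monom: "pd i (monom_fn \<alpha>) = (\<lambda>x. real (\<alpha> i) * monom_fn (\<alpha>(i := \<alpha> i - 1)) x)"
proof
  fix x
  have m: "monom_fn \<alpha> y = (y $ i) ^ \<alpha> i * (\<Prod>j\<in>UNIV - {i}. (y $ j) ^ \<alpha> j)" for y
    by (simp add: monom_fn_def prod.remove[of UNIV i])
  have m': "monom_fn (\<alpha>(i := \<alpha> i - 1)) x = (x $ i) ^ (\<alpha> i - 1) * (\<Prod>j\<in>UNIV - {i}. (x $ j) ^ \<alpha> j)"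
    by (simp add: monom_fn_def prod.remove[of UNIV i])
  have "monom_fn \<alpha> (x + s *\<^sub>R axis i 1) = (x $ i + s) ^ \<alpha> i * (\<Prod>j\<in>UNIV - {i}. (x $ j) ^ \<alpha> j)" for s
    unfolding m by (auto simp: axis_def intro!: prod.cong)
  then show "pd i (monom_fn \<alpha>) x = real (\<alpha> i) * monom_fn (\<alpha>(i := \<alpha> i - 1)) x"
    unfolding m' by (intro pd_eqI) (auto intro!: derivative_eq_intros)
qed

text \<open>Only the i-th one-dimensional factor changes. If \<open>\<alpha> i = 0\<close> the
  derivative vanishes, matching the vanishing first moment; otherwise the moment recursion
  applies.\<close>

lemma gint_ibp_monom: "gint v (\<lambda>x. x $ i * monom_fn \<alpha> x) = v i * gint v (pd i (monom_fn \<alpha>))"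
proof -
  have "gint v (\<lambda>x. x $ i * monom_fn \<alpha> x) = gint v (monom_fn (\<alpha>(i := Suc (\<alpha> i))))"
    unfolding monom_fn_Suc[abs_def] ..
  then have l: "gint v (\<lambda>x. x $ i * monom_fn \<alpha> x) = gmom (v i) (Suc (\<alpha> i)) * (\<Prod>j\<in>UNIV - {i}. gmom (v j) (\<alpha> j))"
    unfolding gint_monom_upd .
  show ?thesis
    unfolding l pd_monom gint_cmult gint_monom_upd
    using v[of i] by (cases "\<alpha> i") (auto simp: gmom_1 gmom_Suc_Suc)
qed

lemma gint_ibp: "hp n p \<Longrightarrow> gint v (\<lambda>x. x $ i * p x) = v i * gint v (pd i p)"
proof -
  assume "hp n p"
  then obtain c where p: "p = (\<lambda>x. \<Sum>\<alpha> | sum \<alpha> UNIV = n. c \<alpha> * monom_fn \<alpha> x)"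
    unfolding hom_poly_iff_hp[symmetric] hom_poly_alt by (auto simp: fun_eq_iff)
  have h: "hp n (monom_fn \<alpha>)" if "\<alpha> \<in> {\<alpha>. sum \<alpha> UNIV = n}" for \<alpha> using hp_monom_fn[of \<alpha>] that by simp
  have "gint v (\<lambda>x. x $ i * p x) = gint v (\<lambda>x. \<Sum>\<alpha> | sum \<alpha> UNIV = n. c \<alpha> * (x $ i * monom_fn \<alpha> x))"
    unfolding p by (simp add: sum_distrib_left mult.left_commute)
  also have "\<dots> = (\<Sum>\<alpha> | sum \<alpha> UNIV = n. c \<alpha> * (v i * gint v (pd i (monom_fn \<alpha>))))"
    by (subst gint_sum[where n="Suc n"])
       (auto intro!: hp_cmult hp_coord_mult hp_monom_fn finite_multi_index simp: gint_cmult gint_ibp_monom)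
  also have "\<dots> = v i * gint v (\<lambda>x. \<Sum>\<alpha> | sum \<alpha> UNIV = n. c \<alpha> * pd i (monom_fn \<alpha>) x)"
    by (subst gint_sum[where n="n - 1"])
       (auto intro!: hp_cmult hp_pd[OF hp_monom_fn, simplified] finite_multi_index simp: gint_cmult sum_distrib_left mult.left_commute)
  also have "(\<lambda>x. \<Sum>\<alpha> | sum \<alpha> UNIV = n. c \<alpha> * pd i (monom_fn \<alpha>) x) = pd i p"
    unfolding p by (subst pd_sum[OF finite_multi_index, where n=n])
      (auto intro!: hp_cmult hp_monom_fn simp: fun_eq_iff pd_cmult[OF hp_monom_fn])
  finally show ?thesis .
qed

text \<open>Euler's identity writes np as the sum of the \<open>x $ i * pd i p x\<close>, and
  integration by parts trades each coordinate for a further derivative. The integral of p is thus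
  expressed by polynomials of degree lower by two.\<close>

lemma gint_euler: "hp n p \<Longrightarrow> real n * gint v p = (\<Sum>i\<in>UNIV. v i * gint v (pd i (pd i p)))"
proof (cases n)
  case 0
  assume "hp n p"
  then show ?thesis using 0 by (simp add: pd_hp_0 pd_const gint_def)
next
  case (Suc m)
  assume p: "hp n p"
  have "real n * gint v p = gint v (\<lambda>x. \<Sum>i\<in>UNIV. x $ i * pd i p x)"
    by (simp add: euler[OF p] gint_cmult)
  also have "\<dots> = (\<Sum>i\<in>UNIV. gint v (\<lambda>x. x $ i * pd i p x))"
    using hp_coord_mult[OF hp_pd[OF p]] by (intro gint_sum) auto
  also have "\<dots> = (\<Sum>i\<in>UNIV. v i * gint v (pd i (pd i p)))"
    by (simp add: gint_ibp[OF hp_pd[OF p]])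
  finally show ?thesis .
qed

end

text \<open>For harmonic \<open>Y\<close> the isotropic part of the covariance is invisible, so only its excess
  \<open>1 - s\<close> in direction \<open>i\<close> contributes.\<close>

lemma gint_axial_sph_harm:
  fixes Y :: "real^'n \<Rightarrow> real"
  assumes "Y \<in> sph_harm n"
  shows "\<exists>c. \<forall>s>0. gint (\<lambda>j. if j = i then 1 else s) Y =
    (if even n then c * (1 - s) ^ (n div 2) else 0) * (\<Prod>j\<in>UNIV. sqrt (2 * pi * (if j = i then 1 else s)))"
  using assms
proof (induction n arbitrary: Y rule: less_induct)
  case (less n)
  consider "n = 0" | "n = 1" | m where "n = Suc (Suc m)" by (metis One_nat_def not0_implies_Suc)
  then show ?case
  proof cases
    case 1
    then obtain c where "Y = (\<lambda>_. c)" using less.prems sph_harm_0_const by blast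
    then show ?thesis using 1 by (intro exI[of _ c]) (simp add: gint_const)
  next
    case 2
    have h: "hp 1 Y" using less.prems 2 by (simp add: sph_harm_iff)
    have "pd j (pd j Y) = (\<lambda>_. 0)" for j using pd_hp_0[OF hp_pd_Suc[of 0 Y j]] h by simp
    then show ?thesis using gint_euler[OF _ h] 2 by (simp add: gint_def)
  next
    case (3 m)
    have h: "hp n Y" using less.prems by (simp add: sph_harm_iff)
    have "pd i (pd i Y) \<in> sph_harm m" using less.prems 3 by (auto intro!: sph_harm_pd)
    from less.IH[OF _ this] 3 obtain c where c: "\<And>s. s > 0 \<Longrightarrow> gint (\<lambda>j. if j = i then 1 else s) (pd i (pd i Y)) =
      (if even m then c * (1 - s) ^ (m div 2) else 0) * (\<Prod>j\<in>UNIV. sqrt (2 * pi * (if j = i then 1 else s)))" by auto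
    have "gint (\<lambda>j. if j = i then 1 else s) Y = (1 - s) / real n * gint (\<lambda>j. if j = i then 1 else s) (pd i (pd i Y))" if s: "s > 0" for s
    proof -
      let ?v = "\<lambda>j. if j = i then 1 else s"
      have v: "\<And>j. ?v j > 0" using s by simp
      have hh: "hp (n - 1 - 1) (pd j (pd j Y))" for j by (intro hp_pd h)
      have "(\<Sum>j\<in>UNIV. gint ?v (pd j (pd j Y))) = gint ?v (lap Y)"
        unfolding lap_def[abs_def] by (rule gint_sum[OF v, symmetric]) (use hh in auto)
      also have "\<dots> = 0" using less.prems by (simp add: sph_harm_iff gint_def)
      finally have z: "(\<Sum>j\<in>UNIV. gint ?v (pd j (pd j Y))) = 0" .
      have "real n * gint ?v Y = (\<Sum>j\<in>UNIV. ?v j * gint ?v (pd j (pd j Y)))" by (rule gint_euler[OF v h])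
      also have "\<dots> = (\<Sum>j\<in>UNIV. s * gint ?v (pd j (pd j Y)) + (if i = j then (1 - s) * gint ?v (pd j (pd j Y)) else 0))"
        by (intro sum.cong) (auto simp: algebra_simps)
      also have "\<dots> = (1 - s) * gint ?v (pd i (pd i Y))"
        by (simp add: sum.distrib z flip: sum_distrib_left)
      finally show ?thesis using 3 by (simp add: field_simps)
    qed
    then show ?thesis using c 3 by (intro exI[of _ "c / real n"]) auto
  qed
qed

lemma gint_sph_harm_pos:
  assumes "Y \<in> sph_harm (Suc n)"
  shows "gint (\<lambda>_. 1) Y = 0"
proof -
  have h: "hp (Suc n) Y" using assms by (simp add: sph_harm_iff)
  have hh: "hp (n - 1) (pd j (pd j Y))" for j using hp_pd[OF hp_pd[OF h]] by simp
  have "real (Suc n) * gint (\<lambda>_. 1) Y = (\<Sum>j\<in>UNIV. gint (\<lambda>_. 1) (pd j (pd j Y)))"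
    using gint_euler[OF _ h, of "\<lambda>_. 1"] by simp
  also have "\<dots> = gint (\<lambda>_. 1) (lap Y)"
    unfolding lap_def[abs_def] by (rule gint_sum[symmetric]) (use hh in auto)
  also have "\<dots> = 0" using assms by (simp add: sph_harm_iff gint_def)
  finally show ?thesis by simp
qed

text \<open>For harmonic Y, the Euler identity and integration by parts turn n times the inner
  product into the inner product of the gradients. That expression is symmetric in Y and Z, so n and
  m give the same value.\<close>

lemma gint_sph_harm_orthogonal:
  assumes Y: "Y \<in> sph_harm n" and Z: "Z \<in> sph_harm m" and "n \<noteq> m"
  shows "gint (\<lambda>_. 1) (\<lambda>x. Y x * Z x) = 0"
proof -
  have key: "real n * gint (\<lambda>_. 1) (\<lambda>x. Y x * Z x) = (\<Sum>i\<in>UNIV. gint (\<lambda>_. 1) (\<lambda>x. pd i Y x * pd i Z x))"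
    if Y: "Y \<in> sph_harm n" and Z: "Z \<in> sph_harm m" for n m and Y Z :: "real^'a \<Rightarrow> real"
  proof -
    have hY: "hp n Y" and hZ: "hp m Z" using Y Z by (auto simp: sph_harm_iff)
    have hdY: "hp (n - 1) (pd i Y)" and hdZ: "hp (m - 1) (pd i Z)" and hddY: "hp (n - 1 - 1) (pd i (pd i Y))" for i
      by (intro hp_pd hY hZ)+
    have "real n * gint (\<lambda>_. 1) (\<lambda>x. Y x * Z x) = gint (\<lambda>_. 1) (\<lambda>x. \<Sum>i\<in>UNIV. x $ i * (pd i Y x * Z x))"
      by (simp add: gint_cmult[symmetric] mult.assoc[symmetric] euler[OF hY] flip: sum_distrib_right)
    also have "\<dots> = (\<Sum>i\<in>UNIV. gint (\<lambda>_. 1) (\<lambda>x. x $ i * (pd i Y x * Z x)))"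
      by (rule gint_sum) (auto intro!: hp_coord_mult hp_mult hdY hZ)
    also have "\<dots> = (\<Sum>i\<in>UNIV. gint (\<lambda>_. 1) (\<lambda>x. pd i (pd i Y) x * Z x) + gint (\<lambda>_. 1) (\<lambda>x. pd i Y x * pd i Z x))"
      by (intro sum.cong refl)
         (simp add: gint_ibp[OF _ hp_mult[OF hdY hZ]] pd_mult[OF hdY hZ] gint_add[OF _ hp_mult[OF hddY hZ] hp_mult[OF hdY hdZ]])
    also have "\<dots> = (\<Sum>i\<in>UNIV. gint (\<lambda>_. 1) (\<lambda>x. pd i (pd i Y) x * Z x)) + (\<Sum>i\<in>UNIV. gint (\<lambda>_. 1) (\<lambda>x. pd i Y x * pd i Z x))"
      by (simp add: sum.distrib)
    also have "(\<Sum>i\<in>UNIV. gint (\<lambda>_. 1) (\<lambda>x. pd i (pd i Y) x * Z x)) = gint (\<lambda>_. 1) (\<lambda>x. \<Sum>i\<in>UNIV. pd i (pd i Y) x * Z x)"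
      by (rule gint_sum[symmetric]) (auto intro!: hp_mult[OF hddY hZ])
    also have "(\<lambda>x. \<Sum>i\<in>UNIV. pd i (pd i Y) x * Z x) = (\<lambda>x. lap Y x * Z x)"
      by (simp add: lap_def sum_distrib_right)
    also have "\<dots> = (\<lambda>_. 0)" using Y by (simp add: sph_harm_iff)
    finally show ?thesis by (simp add: gint_def)
  qed
  have "real n * gint (\<lambda>_. 1) (\<lambda>x. Y x * Z x) = real m * gint (\<lambda>_. 1) (\<lambda>x. Y x * Z x)"
    using key[OF Y Z] key[OF Z Y] by (simp add: mult.commute)
  with \<open>n \<noteq> m\<close> show ?thesis by simp
qed

text \<open>Splitting one factor \<open>x \<bullet> y\<close> into coordinates and integrating by
  parts either differentiates the remaining power, lowering k by two, or replaces Y by its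
  derivative along x, a harmonic of degree n - 1, lowering both k and n by one. The parity of k - n
  is preserved by both.\<close>

lemma gint_inner_power_sph_harm:
  fixes x :: "real^'n"
  assumes x: "norm x = 1"
  shows "Y \<in> sph_harm n \<Longrightarrow> gint (\<lambda>_. 1) (\<lambda>y. (x \<bullet> y) ^ k * Y y) =
    (if n \<le> k \<and> even (k - n) then gint (\<lambda>_. 1) (\<lambda>_::real^'n. 1) * (fact k / (2 ^ ((k - n) div 2) * fact ((k - n) div 2))) * Y x else 0)"
proof (induction k arbitrary: n Y rule: less_induct)
  case (less k)
  let ?Z = "gint (\<lambda>_. 1) (\<lambda>_::real^'n. 1)"
  have hY: "hp n Y" using less.prems by (simp add: sph_harm_iff)
  show ?case
  proof (cases k)
    case 0
    show ?thesis
    proof (cases n)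
      case 0
      then obtain c where c: "Y = (\<lambda>_. c)" using less.prems sph_harm_0_const by blast
      show ?thesis using 0 \<open>k = 0\<close> gint_cmult[of "\<lambda>_. 1" c "\<lambda>_. 1"] by (simp add: c mult.commute)
    next
      case (Suc n')
      then show ?thesis using gint_sph_harm_pos[of Y n'] less.prems 0 by simp
    qed
  next
    case (Suc l)
    define DY where "DY y = (\<Sum>i\<in>UNIV. x $ i * pd i Y y)" for y
    have hd: "hp (n - 1) (pd i Y)" for i by (intro hp_pd hY)
    have hDY: "hp (n - 1) DY" unfolding DY_def[abs_def] by (intro hp_sum hp_cmult hd) auto
    have pI: "pd i (\<lambda>y. (x \<bullet> y) ^ l) = (\<lambda>y. real l * x $ i * (x \<bullet> y) ^ (l - 1))" for i
      by (rule ext, rule pd_eqI) (auto intro!: derivative_eq_intros simp: inner_add_right inner_axis)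
    have 1: "gint (\<lambda>_. 1) (\<lambda>y. (x \<bullet> y) ^ k * Y y) = real l * gint (\<lambda>_. 1) (\<lambda>y. (x \<bullet> y) ^ (l - 1) * Y y)
        + gint (\<lambda>_. 1) (\<lambda>y. (x \<bullet> y) ^ l * DY y)"
    proof -
      have hq: "hp (l + n) (\<lambda>y. (x \<bullet> y) ^ l * Y y)" by (intro hp_mult hp_inner_power hY)
      have h3: "hp (l - 1 + n) (\<lambda>y. (x \<bullet> y) ^ (l - 1) * Y y)" by (intro hp_mult hp_inner_power hY)
      have h4: "hp (l + (n - 1)) (\<lambda>y. (x \<bullet> y) ^ l * pd i Y y)" for i by (intro hp_mult hp_inner_power hd)
      have "gint (\<lambda>_. 1) (\<lambda>y. (x \<bullet> y) ^ k * Y y) = gint (\<lambda>_. 1) (\<lambda>y. \<Sum>i\<in>UNIV. x $ i * (y $ i * ((x \<bullet> y) ^ l * Y y)))"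
        by (simp add: Suc inner_vec_def sum_distrib_right mult.assoc)
      also have "\<dots> = (\<Sum>i\<in>UNIV. x $ i * gint (\<lambda>_. 1) (\<lambda>y. y $ i * ((x \<bullet> y) ^ l * Y y)))"
        by (subst gint_sum) (auto intro!: hp_cmult hp_coord_mult hq simp: gint_cmult)
      also have "\<dots> = (\<Sum>i\<in>UNIV. x $ i * gint (\<lambda>_. 1) (\<lambda>y. (real l * x $ i) * ((x \<bullet> y) ^ (l - 1) * Y y) + (x \<bullet> y) ^ l * pd i Y y))"
        by (simp add: gint_ibp[OF _ hq] pd_mult[OF hp_inner_power hY] pI mult.assoc)
      also have "\<dots> = (\<Sum>i\<in>UNIV. x $ i * ((real l * x $ i) * gint (\<lambda>_. 1) (\<lambda>y. (x \<bullet> y) ^ (l - 1) * Y y) + gint (\<lambda>_. 1) (\<lambda>y. (x \<bullet> y) ^ l * pd i Y y)))"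
        by (subst gint_add[OF _ hp_cmult[OF h3] h4]) (auto simp: gint_cmult)
      also have "\<dots> = real l * (\<Sum>i\<in>UNIV. x $ i * x $ i) * gint (\<lambda>_. 1) (\<lambda>y. (x \<bullet> y) ^ (l - 1) * Y y)
          + (\<Sum>i\<in>UNIV. gint (\<lambda>_. 1) (\<lambda>y. x $ i * ((x \<bullet> y) ^ l * pd i Y y)))"
        by (simp add: gint_cmult algebra_simps sum.distrib sum_distrib_left sum_distrib_right)
      also have "(\<Sum>i\<in>UNIV. x $ i * x $ i) = 1" using x by (simp add: norm_eq_1 inner_vec_def)
      also have "(\<Sum>i\<in>UNIV. gint (\<lambda>_. 1) (\<lambda>y. x $ i * ((x \<bullet> y) ^ l * pd i Y y))) = gint (\<lambda>_. 1) (\<lambda>y. (x \<bullet> y) ^ l * DY y)"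
        by (subst gint_sum[symmetric]) (auto intro!: hp_cmult h4 simp: DY_def sum_distrib_left mult.left_commute)
      finally show ?thesis by simp
    qed
    \<comment> \<open>The derivative along x evaluated at x itself is the Euler field, so the
      recursion returns to a multiple of \<open>Y x\<close>.\<close>
    have DYx: "DY x = real n * Y x" unfolding DY_def by (rule euler[OF hY])
    have DYz: "DY = (\<lambda>_. 0)" if "n = 0"
      using that pd_hp_0[of Y] hY by (simp add: DY_def[abs_def])
    have DYs: "DY \<in> sph_harm m" if "n = Suc m" for m
      unfolding DY_def[abs_def] using less.prems that by (intro sph_harm_sum sph_harm_cmult sph_harm_pd) auto
    have A: "real l * gint (\<lambda>_. 1) (\<lambda>y. (x \<bullet> y) ^ (l - 1) * Y y) =
      (if n + 2 \<le> k \<and> even (k - n) then ?Z * (fact l / (2 ^ ((k - n) div 2 - 1) * fact ((k - n) div 2 - 1))) * Y x else 0)"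
    proof (cases l)
      case 0
      then show ?thesis using Suc by auto
    next
      case (Suc l')
      have *: "(n \<le> l' \<and> even (l' - n)) \<longleftrightarrow> (n + 2 \<le> k \<and> even (k - n))" using \<open>k = Suc l\<close> Suc by (auto; presburger)
      have "(l' - n) div 2 = (k - n) div 2 - 1" using \<open>k = Suc l\<close> Suc by simp
      then have "gint (\<lambda>_. 1) (\<lambda>y. (x \<bullet> y) ^ l' * Y y) =
        (if n + 2 \<le> k \<and> even (k - n) then ?Z * (fact l' / (2 ^ ((k - n) div 2 - 1) * fact ((k - n) div 2 - 1))) * Y x else 0)"
        using less.IH[OF _ less.prems, of l'] * \<open>k = Suc l\<close> Suc by (simp only:)
      moreover have "real l * (if P then z * (fact l' / D) * y else 0) = (if P then z * (fact l / D) * y else 0)" for P z D y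
        by (simp add: Suc)
      moreover have "l - 1 = l'" using Suc by simp
      ultimately show ?thesis by (simp only:)
    qed
    have B: "gint (\<lambda>_. 1) (\<lambda>y. (x \<bullet> y) ^ l * DY y) =
      (if n \<le> k \<and> even (k - n) then ?Z * (fact l / (2 ^ ((k - n) div 2) * fact ((k - n) div 2))) * (real n * Y x) else 0)"
    proof (cases n)
      case 0
      then show ?thesis using DYz by (simp add: gint_def)
    next
      case (Suc m)
      have e: "k - n = l - m" "n \<le> k \<longleftrightarrow> m \<le> l" "l < k" using \<open>k = Suc l\<close> Suc by auto
      show ?thesis unfolding less.IH[OF e(3) DYs[OF Suc]] e(1,2) DYx ..
    qed
    show ?thesis
    proof (cases "n \<le> k \<and> even (k - n)")
      case False
      then show ?thesis unfolding 1 A B by auto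
    next
      case True
      then obtain j where j: "k = n + 2 * j" by (metis dvd_def le_add_diff_inverse)
      show ?thesis
      proof (cases j)
        case 0
        then have "real n * fact l = (fact k :: real)" using j Suc fact_Suc[of l, where 'a=real] by (simp del: fact_Suc)
        then show ?thesis unfolding 1 A B using True j 0 by (simp add: mult_ac)
      next
        case (Suc i)
        \<comment> \<open>The two contributions carry the weights n and 2(i + 1), whose sum is k;
          multiplied by \<open>fact l\<close> this gives \<open>fact k\<close>.\<close>
        have f: "(fact k :: real) = (real n + 2 * real i + 2) * fact l"
        proof -
          have "real k = real n + 2 * real i + 2" using j Suc by simp
          then show ?thesis using \<open>k = Suc l\<close> fact_Suc[of l, where 'a=real] by (simp del: fact_Suc)
        qed
        have e: "(k - n) div 2 = Suc i" using j Suc by simp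
        show ?thesis unfolding 1 A B f e using True j Suc
          by (simp add: divide_simps) (simp add: algebra_simps)
      qed
    qed
  qed
qed

subsection \<open>The surface measure in polar coordinates\<close>

lemma space_sphere_measure: "space (sphere_measure :: (real^'n) measure) = sphere 0 1"
  by (simp add: sphere_measure_def space_restrict_space)

lemma sets_sphere_measure: "sets (sphere_measure :: (real^'n) measure) = sets (restrict_space borel (sphere 0 1))"
  by (simp add: sphere_measure_def)

lemma borel_measurable_sphere: "g \<in> measurable borel M \<Longrightarrow> g \<in> measurable sphere_measure M"
  by (subst measurable_cong_sets[OF sets_sphere_measure refl]) (rule measurable_restrict_space1)

lemma normalize_measurable [measurable]: "(\<lambda>x::real^'n. x /\<^sub>R norm x) \<in> borel_measurable borel"
  by measurable

lemma nn_integral_sphere_measure: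
  fixes g :: "real^'n \<Rightarrow> ennreal"
  assumes [measurable]: "g \<in> borel_measurable borel"
  shows "(\<integral>\<^sup>+x. g x \<partial>sphere_measure) =
    of_nat CARD('n) * (\<integral>\<^sup>+x. g (x /\<^sub>R norm x) * indicator (cball 0 1 - {0}) x \<partial>lborel)"
proof -
  let ?R = "restrict_space lborel (cball 0 1 - {0}) :: (real^'n) measure"
  let ?B = "restrict_space borel (sphere 0 1) :: (real^'n) measure"
  have T: "(\<lambda>x. x /\<^sub>R norm x) \<in> measurable ?R ?B"
    by (intro measurable_restrict_space2 measurable_restrict_space1)
       (auto simp: space_restrict_space)
  have g: "g \<in> borel_measurable ?B" by (rule measurable_restrict_space1) simp
  have "(\<integral>\<^sup>+x. g x \<partial>sphere_measure) = (\<integral>\<^sup>+x. of_nat CARD('n) * g x \<partial>distr ?R ?B (\<lambda>x. x /\<^sub>R norm x))"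
    unfolding sphere_measure_def using g by (subst nn_integral_density) (auto simp: ennreal_of_nat_eq_real_of_nat)
  also have "\<dots> = of_nat CARD('n) * (\<integral>\<^sup>+x. g (x /\<^sub>R norm x) \<partial>?R)"
    using g T by (subst nn_integral_cmult) (auto simp: nn_integral_distr)
  also have "(\<integral>\<^sup>+x. g (x /\<^sub>R norm x) \<partial>?R) = (\<integral>\<^sup>+x. g (x /\<^sub>R norm x) * indicator (cball 0 1 - {0}) x \<partial>lborel)"
    by (rule nn_integral_restrict_space) simp
  finally show ?thesis .
qed

lemma AE_lborel_norm_neq_1: "AE x in lborel. norm (x::real^'n) \<noteq> 1"
proof -
  have "frontier (cball 0 1 :: (real^'n) set) = sphere 0 1" by simp
  then have "negligible (sphere 0 1 :: (real^'n) set)"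
    using negligible_convex_frontier[of "cball 0 1 :: (real^'n) set"] by simp
  then have "sphere 0 1 \<in> null_sets (lborel :: (real^'n) measure)"
    by (simp add: negligible_iff_null_sets null_sets_completion_iff)
  then show ?thesis by (rule AE_I') auto
qed

lemma AE_lborel_neq_0: "AE x in lborel. x \<noteq> (0::real^'n)"
  using AE_lborel_singleton by blast

text \<open>Dilation by R maps to the unit ball, on which the surface measure is defined. The open
  and the punctured closed ball differ by a null set only.\<close>

lemma nn_integral_cone_ball:
  fixes g :: "real^'n \<Rightarrow> ennreal"
  assumes [measurable]: "g \<in> borel_measurable borel" and R: "R > 0"
  shows "(\<integral>\<^sup>+x. g (x /\<^sub>R norm x) * indicator {x. norm x < R} x \<partial>lborel) =
    ennreal (R ^ CARD('n) / real CARD('n)) * (\<integral>\<^sup>+x. g x \<partial>sphere_measure)"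
proof -
  have [measurable]: "{x::real^'n. norm x < r} \<in> sets borel" for r by measurable
  have "(\<integral>\<^sup>+x. g (x /\<^sub>R norm x) * indicator {x. norm x < R} x \<partial>lborel) =
    ennreal (R ^ CARD('n)) * (\<integral>\<^sup>+x. g ((R *\<^sub>R x) /\<^sub>R norm (R *\<^sub>R x)) * indicator {x. norm x < R} (R *\<^sub>R x) \<partial>lborel)"
    using R by (subst lborel_affine[of R 0])
      (auto simp: nn_integral_density nn_integral_distr nn_integral_cmult ennreal_power)
  also have "(\<integral>\<^sup>+x. g ((R *\<^sub>R x) /\<^sub>R norm (R *\<^sub>R x)) * indicator {x. norm x < R} (R *\<^sub>R x) \<partial>lborel) =
    (\<integral>\<^sup>+x. g (x /\<^sub>R norm x) * indicator (cball 0 1 - {0}) x \<partial>lborel)"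
  proof (rule nn_integral_cong_AE)
    show "AE x in lborel. g ((R *\<^sub>R x) /\<^sub>R norm (R *\<^sub>R x)) * indicator {x. norm x < R} (R *\<^sub>R x) =
      g (x /\<^sub>R norm x) * indicator (cball 0 1 - {0}) x"
      using AE_lborel_neq_0 AE_lborel_norm_neq_1
    proof eventually_elim
      case (elim x)
      have "(R *\<^sub>R x) /\<^sub>R norm (R *\<^sub>R x) = x /\<^sub>R norm x" using R by simp
      moreover have "norm (R *\<^sub>R x) < R \<longleftrightarrow> norm x \<le> 1" using R elim by auto
      then have "indicator {x. norm x < R} (R *\<^sub>R x) = (indicator (cball 0 1 - {0}) x :: ennreal)"
        using elim by (simp add: indicator_def)
      ultimately show ?case by (simp only:)
    qed
  qed
  finally have *: "(\<integral>\<^sup>+x. g (x /\<^sub>R norm x) * indicator {x. norm x < R} x \<partial>lborel) =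
    ennreal (R ^ CARD('n)) * (\<integral>\<^sup>+x. g (x /\<^sub>R norm x) * indicator (cball 0 1 - {0}) x \<partial>lborel)" .
  have "ennreal (R ^ CARD('n) / real CARD('n)) * of_nat CARD('n) = ennreal (R ^ CARD('n))"
    using R by (simp add: ennreal_of_nat_eq_real_of_nat flip: ennreal_mult)
  then show ?thesis unfolding * nn_integral_sphere_measure[OF assms(1)]
    by (simp add: mult.assoc[symmetric])
qed

text \<open>The radial variable is half the squared norm, in which a Gaussian becomes a plain
  exponential and radial integrals become Gamma integrals. The identity is an equality of two
  measures on the line, checked on half-lines.\<close>

lemma nn_integral_polar_finite:
  fixes g :: "real^'n \<Rightarrow> ennreal"
  assumes g[measurable]: "g \<in> borel_measurable borel" and h[measurable]: "h \<in> borel_measurable borel"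
    and fin: "(\<integral>\<^sup>+x. g x \<partial>sphere_measure) < \<infinity>"
  shows "(\<integral>\<^sup>+x. h ((norm x)\<^sup>2 / 2) * g (x /\<^sub>R norm x) \<partial>lborel) =
    (\<integral>\<^sup>+q. h q * (indicator {0..} q * ennreal ((2 * q) powr (real CARD('n) / 2 - 1))) \<partial>lborel) * (\<integral>\<^sup>+x. g x \<partial>sphere_measure)"
proof -
  let ?A = "\<integral>\<^sup>+x. g x \<partial>sphere_measure"
  let ?N = "real CARD('n)"
  let ?w = "\<lambda>q. ?A * (indicator {0..} q * ennreal ((2 * q) powr (?N / 2 - 1)))"
  \<comment> \<open>The sign flip turns balls into upper half-lines, so that all of these have
    finite mass, as the uniqueness theorem for measures on half-lines requires; this is where
    finiteness of the integral of \<open>g\<close> enters.\<close>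
  define M1 where "M1 = distr (density lborel (\<lambda>x. g (x /\<^sub>R norm x))) borel (\<lambda>x. - ((norm x)\<^sup>2 / 2))"
  define M2 where "M2 = distr (density lborel ?w) borel uminus"
  have wm[measurable]: "?w \<in> borel_measurable borel" by measurable
  have e1: "emeasure M1 {a<..} = (if a < 0 then ennreal (sqrt (- 2 * a) ^ CARD('n) / ?N) * ?A else 0)" for a
  proof -
    have "emeasure M1 {a<..} = (\<integral>\<^sup>+x. g (x /\<^sub>R norm x) * indicator {x. - ((norm x)\<^sup>2 / 2) > a} x \<partial>lborel)"
      unfolding M1_def by (subst emeasure_distr, simp, simp, subst emeasure_density)
        (auto simp: vimage_def intro!: nn_integral_cong)
    also have "\<dots> = (if a < 0 then ennreal (sqrt (- 2 * a) ^ CARD('n) / ?N) * ?A else 0)"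
    proof (cases "a < 0")
      case True
      have "{x::real^'n. - ((norm x)\<^sup>2 / 2) > a} = {x. norm x < sqrt (- 2 * a)}"
      proof (intro Collect_cong)
        fix x :: "real^'n"
        have "norm x < sqrt (- 2 * a) \<longleftrightarrow> sqrt ((norm x)\<^sup>2) < sqrt (- 2 * a)" by simp
        also have "\<dots> \<longleftrightarrow> (norm x)\<^sup>2 < - 2 * a" by (rule real_sqrt_less_iff)
        finally show "- ((norm x)\<^sup>2 / 2) > a \<longleftrightarrow> norm x < sqrt (- 2 * a)" by linarith
      qed
      then show ?thesis using True nn_integral_cone_ball[OF g, of "sqrt (- 2 * a)"] by simp
    next
      case False
      then have "{x::real^'n. - ((norm x)\<^sup>2 / 2) > a} = {}"
        by (smt (verit) Collect_empty_eq divide_nonneg_pos zero_le_power2)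
      then show ?thesis using False by simp
    qed
    finally show ?thesis .
  qed
  have e2: "emeasure M2 {a<..} = (if a < 0 then ennreal (sqrt (- 2 * a) ^ CARD('n) / ?N) * ?A else 0)" for a
  proof -
    have "emeasure M2 {a<..} = (\<integral>\<^sup>+q. ?w q * indicator {q. - q > a} q \<partial>lborel)"
      unfolding M2_def by (subst emeasure_distr, simp, simp, subst emeasure_density)
        (auto simp: vimage_def intro!: nn_integral_cong)
    also have "\<dots> = (\<integral>\<^sup>+q. ?A * (ennreal ((2 * q) powr (?N / 2 - 1)) * indicator {0..<-a} q) \<partial>lborel)"
      by (intro nn_integral_cong) (auto simp: indicator_def)
    also have "\<dots> = ?A * (\<integral>\<^sup>+q. ennreal ((2 * q) powr (?N / 2 - 1)) * indicator {0..<-a} q \<partial>lborel)"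
      by (rule nn_integral_cmult) simp
    also have "(\<integral>\<^sup>+q. ennreal ((2 * q) powr (?N / 2 - 1)) * indicator {0..<-a} q \<partial>lborel) =
       (if a < 0 then ennreal (sqrt (- 2 * a) ^ CARD('n) / ?N) else 0)"
    proof (cases "a < 0")
      case True
      have N: "?N > 0" by simp
      have "((\<lambda>q. 2 powr (?N / 2 - 1) * q powr (?N / 2 - 1)) has_integral 2 powr (?N / 2 - 1) * ((- a) powr (?N / 2 - 1 + 1) / (?N / 2 - 1 + 1))) {0..-a}"
        using True N by (intro has_integral_mult_right has_integral_powr_from_0) auto
      from nn_integral_has_integral_lebesgue'[OF _ this]
      have "(\<integral>\<^sup>+q. ennreal (2 powr (?N / 2 - 1) * q powr (?N / 2 - 1)) * indicator {0..-a} q \<partial>lborel) =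
        ennreal (2 powr (?N / 2 - 1) * ((- a) powr (?N / 2 - 1 + 1) / (?N / 2 - 1 + 1)))" by auto
      also have "2 powr (?N / 2 - 1) * ((- a) powr (?N / 2 - 1 + 1) / (?N / 2 - 1 + 1)) = sqrt (- 2 * a) ^ CARD('n) / ?N"
      proof -
        have "sqrt (- 2 * a) ^ CARD('n) = (2 * (- a)) powr (?N / 2)"
          using True by (simp add: powr_half_sqrt[symmetric] powr_powr flip: powr_realpow)
        also have "\<dots> = 2 powr (?N / 2) * (- a) powr (?N / 2)" by (rule powr_mult)
        also have "2 powr (?N / 2) = 2 powr (?N / 2 - 1) * (2::real)" using powr_add[of 2 "?N / 2 - 1" 1] by simp
        finally show ?thesis by (simp add: field_simps)
      qed
      also have "(\<integral>\<^sup>+q. ennreal (2 powr (?N / 2 - 1) * q powr (?N / 2 - 1)) * indicator {0..-a} q \<partial>lborel) =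
          (\<integral>\<^sup>+q. ennreal ((2 * q) powr (?N / 2 - 1)) * indicator {0..<-a} q \<partial>lborel)"
      proof (rule nn_integral_cong_AE)
        show "AE q in lborel. ennreal (2 powr (?N / 2 - 1) * q powr (?N / 2 - 1)) * indicator {0..-a} q =
          ennreal ((2 * q) powr (?N / 2 - 1)) * indicator {0..<-a} q"
          using AE_lborel_singleton[of "-a"] by eventually_elim (auto simp: indicator_def powr_mult)
      qed
      finally show ?thesis using True by simp
    next
      case False
      then show ?thesis by simp
    qed
    finally show ?thesis by (auto simp: mult.commute)
  qed
  have "M1 = M2"
  proof (rule measure_eqI_lessThan)
    show "emeasure M1 {x<..} < \<infinity>" for x
      unfolding e1 using fin by (auto simp: ennreal_mult_less_top)
    show "emeasure M1 {x<..} = emeasure M2 {x<..}" for x by (simp only: e1 e2)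
  qed (auto simp: M1_def M2_def)
  then have "(\<integral>\<^sup>+y. h (- y) \<partial>M1) = (\<integral>\<^sup>+y. h (- y) \<partial>M2)" by simp
  also have "(\<integral>\<^sup>+y. h (- y) \<partial>M1) = (\<integral>\<^sup>+x. h ((norm x)\<^sup>2 / 2) * g (x /\<^sub>R norm x) \<partial>lborel)"
    unfolding M1_def by (subst nn_integral_distr, simp, simp, subst nn_integral_density) (auto simp: mult.commute)
  also have "(\<integral>\<^sup>+y. h (- y) \<partial>M2) = (\<integral>\<^sup>+q. (h q * (indicator {0..} q * ennreal ((2 * q) powr (?N / 2 - 1)))) * ?A \<partial>lborel)"
    unfolding M2_def by (subst nn_integral_distr, simp, simp, subst nn_integral_density) (auto simp: mult_ac)
  also have "\<dots> = (\<integral>\<^sup>+q. h q * (indicator {0..} q * ennreal ((2 * q) powr (?N / 2 - 1))) \<partial>lborel) * ?A"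
    by (rule nn_integral_multc) simp
  finally show ?thesis .
qed

lemma emeasure_sphere_measure_finite: "emeasure (sphere_measure :: (real^'n) measure) (sphere 0 1) < \<infinity>"
proof -
  have "emeasure (sphere_measure :: (real^'n) measure) (sphere 0 1) = (\<integral>\<^sup>+x. 1 \<partial>(sphere_measure :: (real^'n) measure))"
    by (simp add: space_sphere_measure)
  also have "\<dots> = of_nat CARD('n) * (\<integral>\<^sup>+x. indicator (cball 0 1 - {0}) x \<partial>(lborel::(real^'n) measure))"
    by (subst nn_integral_sphere_measure) auto
  also have "(\<integral>\<^sup>+x. indicator (cball 0 1 - {0}) x \<partial>(lborel::(real^'n) measure)) = emeasure lborel (cball 0 1 - {0::real^'n})"
    by (rule nn_integral_indicator) simp
  finally have eq: "emeasure (sphere_measure :: (real^'n) measure) (sphere 0 1) = of_nat CARD('n) * emeasure lborel (cball 0 1 - {0::real^'n})" .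
  have "emeasure lborel (cball 0 1 - {0::real^'n}) < \<infinity>" by (rule emeasure_bounded_finite) (auto intro: bounded_subset[of "cball 0 1"])
  then show ?thesis unfolding eq by (simp add: ennreal_mult_less_top of_nat_less_top)
qed

interpretation sphere: finite_measure "sphere_measure :: (real^'n) measure"
  by standard (use emeasure_sphere_measure_finite in \<open>simp add: space_sphere_measure less_top\<close>)

text \<open>Truncating \<open>g\<close> at level k makes its integral finite because the sphere has
  finite measure; monotone convergence removes the truncation.\<close>

lemma nn_integral_polar:
  fixes g :: "real^'n \<Rightarrow> ennreal"
  assumes g[measurable]: "g \<in> borel_measurable borel" and h[measurable]: "h \<in> borel_measurable borel"
  shows "(\<integral>\<^sup>+x. h ((norm x)\<^sup>2 / 2) * g (x /\<^sub>R norm x) \<partial>lborel) =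
    (\<integral>\<^sup>+q. h q * (indicator {0..} q * ennreal ((2 * q) powr (real CARD('n) / 2 - 1))) \<partial>lborel) * (\<integral>\<^sup>+x. g x \<partial>sphere_measure)"
proof -
  let ?H = "\<integral>\<^sup>+q. h q * (indicator {0..} q * ennreal ((2 * q) powr (real CARD('n) / 2 - 1))) \<partial>lborel"
  define G where "G k x = min (g x) (of_nat k)" for k :: nat and x
  have [measurable]: "G k \<in> borel_measurable borel" for k unfolding G_def by measurable
  have Gm: "G k \<in> borel_measurable sphere_measure" for k by (rule borel_measurable_sphere) simp
  have inc: "incseq G" unfolding G_def by (auto simp: incseq_def le_fun_def min.coboundedI2)
  have sup: "g x = (SUP k. G k x)" for x
    unfolding G_def using inf_SUP[of "g x" "\<lambda>k. of_nat k :: ennreal" UNIV]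
    by (simp add: inf_min ennreal_SUP_of_nat_eq_top)
  have fin: "(\<integral>\<^sup>+x. G k x \<partial>(sphere_measure::(real^'n) measure)) < \<infinity>" for k
  proof -
    have "(\<integral>\<^sup>+x. G k x \<partial>sphere_measure) \<le> (\<integral>\<^sup>+x. of_nat k \<partial>(sphere_measure :: (real^'n) measure))"
      by (intro nn_integral_mono) (auto simp: G_def)
    also have "\<dots> < \<infinity>"
      using emeasure_sphere_measure_finite[where ?'n='n] by (simp add: space_sphere_measure ennreal_mult_less_top of_nat_less_top)
    finally show ?thesis .
  qed
  have "(\<integral>\<^sup>+x. h ((norm x)\<^sup>2 / 2) * g (x /\<^sub>R norm x) \<partial>lborel) = (\<integral>\<^sup>+x. (SUP k. h ((norm x)\<^sup>2 / 2) * G k (x /\<^sub>R norm x)) \<partial>lborel)"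
    by (simp add: sup SUP_mult_left_ennreal)
  also have "\<dots> = (SUP k. \<integral>\<^sup>+x. h ((norm x)\<^sup>2 / 2) * G k (x /\<^sub>R norm x) \<partial>lborel)"
    using inc by (intro nn_integral_monotone_convergence_SUP) (auto simp: incseq_def le_fun_def intro!: mult_left_mono)
  also have "\<dots> = (SUP k. ?H * (\<integral>\<^sup>+x. G k x \<partial>sphere_measure))"
    by (subst nn_integral_polar_finite) (use fin in auto)
  also have "\<dots> = ?H * (SUP k. \<integral>\<^sup>+x. G k x \<partial>sphere_measure)" by (simp add: SUP_mult_left_ennreal)
  also have "(SUP k. \<integral>\<^sup>+x. G k x \<partial>sphere_measure) = (\<integral>\<^sup>+x. g x \<partial>sphere_measure)"
    unfolding sup by (rule nn_integral_monotone_convergence_SUP[symmetric, OF inc Gm])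
  finally show ?thesis .
qed

text \<open>Read from right to left, this writes a negative power of c as a mixture of exponentials,
  the device by which singular powers of \<open>perp\<close> are reduced to Gaussians.\<close>

lemma nn_integral_Gamma_scaled:
  assumes z: "z > 0" and c: "c > (0::real)"
  shows "(\<integral>\<^sup>+t. ennreal (t powr (z - 1) * exp (- c * t)) * indicator {0..} t \<partial>lborel) = ennreal (Gamma z / c powr z)"
proof -
  have "(\<integral>\<^sup>+t. ennreal (t powr (z - 1) * exp (- c * t)) * indicator {0..} t \<partial>lborel) =
     ennreal (1 / c) * (\<integral>\<^sup>+t. ennreal ((t / c) powr (z - 1) * exp (- t)) * indicator {0..} (t / c) \<partial>lborel)"
    using c by (subst nn_integral_real_affine[where c="1/c" and t=0]) auto
  also have "\<dots> = ennreal (1 / c) * (\<integral>\<^sup>+t. ennreal (1 / c powr (z - 1)) * ennreal (indicator {0..} t * t powr (z - 1) / exp t) \<partial>lborel)"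
  proof (rule arg_cong2[where f="(*)", OF refl nn_integral_cong])
    fix t
    have "(t / c) powr (z - 1) * exp (- t) = 1 / c powr (z - 1) * (t powr (z - 1) / exp t)" if "t \<ge> 0"
      using powr_divide[of t c "z - 1"] that c by (simp add: exp_minus field_simps)
    moreover have "0 \<le> t / c \<longleftrightarrow> 0 \<le> t" using c by (simp add: zero_le_divide_iff)
    ultimately show "ennreal ((t / c) powr (z - 1) * exp (- t)) * indicator {0..} (t / c) =
        ennreal (1 / c powr (z - 1)) * ennreal (indicator {0..} t * t powr (z - 1) / exp t)"
      by (auto simp: indicator_def simp flip: ennreal_mult)
  qed
  also have "\<dots> = ennreal (1 / c) * (ennreal (1 / c powr (z - 1)) * ennreal (Gamma z))"
    using z by (subst nn_integral_cmult) (auto simp: Gamma_conv_nn_integral_real)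
  also have "\<dots> = ennreal (Gamma z / c powr z)"
    using c z powr_add[of c "z - 1" 1] by (simp add: Gamma_real_pos less_imp_le field_simps flip: ennreal_mult)
  finally show ?thesis .
qed

text \<open>This is the integral of r to the power m + N - 1 against
  \<open>exp (- r\<^sup>2 / 2)\<close> over the positive half-line: the radial factor of a function
  homogeneous of degree m.\<close>

definition rconst :: "real \<Rightarrow> real \<Rightarrow> real" where
  "rconst N m = 2 powr ((m + N) / 2 - 1) * Gamma ((m + N) / 2)"

lemma rconst_pos: "m + N > 0 \<Longrightarrow> rconst N m > 0"
  by (simp add: rconst_def Gamma_real_pos)

lemma gw_one: "gw (\<lambda>_. 1) x = exp (- (norm x)\<^sup>2 / 2)"
proof -
  have "(norm x)\<^sup>2 = (\<Sum>i\<in>UNIV. (x $ i)\<^sup>2)"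
    by (simp only: power2_norm_eq_inner) (simp add: inner_vec_def power2_eq_square)
  then show ?thesis by (simp add: gw_def flip: sum_divide_distrib)
qed

text \<open>The bridge between Gaussian and surface integrals. The degree may be negative and
  non-integer, and homogeneity is asked only away from 0, so that singular powers of
  \<open>perp\<close> are covered as well as polynomials.\<close>

lemma nn_integral_gw_homogeneous:
  fixes g :: "real^'n \<Rightarrow> real"
  assumes g[measurable]: "g \<in> borel_measurable borel" and pos: "\<And>x. g x \<ge> 0" and m: "m + real CARD('n) > 0"
    and hom: "\<And>x. x \<noteq> 0 \<Longrightarrow> g x = norm x powr m * g (x /\<^sub>R norm x)"
  shows "(\<integral>\<^sup>+x. ennreal (g x * gw (\<lambda>_. 1) x) \<partial>lborel) = ennreal (rconst (real CARD('n)) m) * (\<integral>\<^sup>+x. ennreal (g x) \<partial>sphere_measure)"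
proof -
  let ?N = "real CARD('n)"
  have "(\<integral>\<^sup>+x. ennreal (g x * gw (\<lambda>_. 1) x) \<partial>lborel) =
    (\<integral>\<^sup>+x. ennreal ((2 * ((norm x)\<^sup>2 / 2)) powr (m / 2) * exp (- ((norm x)\<^sup>2 / 2))) * ennreal (g (x /\<^sub>R norm x)) \<partial>lborel)"
  proof (rule nn_integral_cong_AE)
    show "AE x in lborel. ennreal (g x * gw (\<lambda>_. 1) x) =
      ennreal ((2 * ((norm x)\<^sup>2 / 2)) powr (m / 2) * exp (- ((norm x)\<^sup>2 / 2))) * ennreal (g (x /\<^sub>R norm x))"
      using AE_lborel_neq_0
    proof eventually_elim
      case (elim x)
      have "((norm x)\<^sup>2) powr (m / 2) = norm x powr m" using elim powr_powr[of "norm x" 2 "m / 2"] by simp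
      then show ?case unfolding hom[OF elim] gw_one using pos by (simp add: mult_ac flip: ennreal_mult)
    qed
  qed
  also have "\<dots> = (\<integral>\<^sup>+q. ennreal ((2 * q) powr (m / 2) * exp (- q)) * (indicator {0..} q * ennreal ((2 * q) powr (?N / 2 - 1))) \<partial>lborel)
      * (\<integral>\<^sup>+x. ennreal (g x) \<partial>sphere_measure)"
    by (rule nn_integral_polar[where h="\<lambda>q. ennreal ((2 * q) powr (m / 2) * exp (- q))"]) auto
  also have "(\<integral>\<^sup>+q. ennreal ((2 * q) powr (m / 2) * exp (- q)) * (indicator {0..} q * ennreal ((2 * q) powr (?N / 2 - 1))) \<partial>lborel) =
    (\<integral>\<^sup>+q. ennreal (2 powr ((m + ?N) / 2 - 1)) * (ennreal (q powr ((m + ?N) / 2 - 1) * exp (- 1 * q)) * indicator {0..} q) \<partial>lborel)"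
  proof (intro nn_integral_cong)
    fix q :: real
    have "(2 * q) powr (m / 2) * exp (- q) * (2 * q) powr (?N / 2 - 1) = 2 powr ((m + ?N) / 2 - 1) * (q powr ((m + ?N) / 2 - 1) * exp (- 1 * q))" if "q \<ge> 0"
    proof -
      have "(2 * q) powr (m / 2) * (2 * q) powr (?N / 2 - 1) = (2 * q) powr ((m + ?N) / 2 - 1)"
        by (simp add: powr_add[symmetric] add_divide_distrib add_diff_eq)
      then show ?thesis using that by (simp add: powr_mult mult_ac)
    qed
    then show "ennreal ((2 * q) powr (m / 2) * exp (- q)) * (indicator {0..} q * ennreal ((2 * q) powr (?N / 2 - 1))) =
      ennreal (2 powr ((m + ?N) / 2 - 1)) * (ennreal (q powr ((m + ?N) / 2 - 1) * exp (- 1 * q)) * indicator {0..} q)"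
      by (auto simp: indicator_def simp flip: ennreal_mult)
  qed
  also have "\<dots> = ennreal (rconst ?N m)"
    using m by (subst nn_integral_cmult) (simp, subst nn_integral_Gamma_scaled, auto simp: rconst_def Gamma_real_pos less_imp_le simp flip: ennreal_mult)
  finally show ?thesis .
qed

lemma integral_gw_homogeneous:
  fixes g :: "real^'n \<Rightarrow> real"
  assumes g[measurable]: "g \<in> borel_measurable borel" and m: "m + real CARD('n) > 0"
    and hom: "\<And>x. x \<noteq> 0 \<Longrightarrow> g x = norm x powr m * g (x /\<^sub>R norm x)"
  shows "integrable lborel (\<lambda>x. g x * gw (\<lambda>_. 1) x) \<longleftrightarrow> integrable sphere_measure g"
    and "(LINT x|lborel. g x * gw (\<lambda>_. 1) x) = rconst (real CARD('n)) m * (LINT x|sphere_measure. g x)"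
proof -
  let ?c = "rconst (real CARD('n)) m"
  have c: "?c > 0" using m by (rule rconst_pos)
  have gs[measurable]: "g \<in> borel_measurable sphere_measure" by (rule borel_measurable_sphere) simp
  have w: "gw (\<lambda>_. 1) x > 0" for x :: "real^'n" by (simp add: gw_def)
  have abs: "(\<integral>\<^sup>+x. ennreal (norm (g x * gw (\<lambda>_. 1) x)) \<partial>lborel) = ennreal ?c * (\<integral>\<^sup>+x. ennreal (norm (g x)) \<partial>sphere_measure)"
  proof -
    have "(\<integral>\<^sup>+x. ennreal (\<bar>g x\<bar> * gw (\<lambda>_. 1) x) \<partial>lborel) = ennreal ?c * (\<integral>\<^sup>+x. ennreal \<bar>g x\<bar> \<partial>sphere_measure)"
    proof (rule nn_integral_gw_homogeneous)
      fix x :: "real^'n" assume "x \<noteq> 0"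
      then show "\<bar>g x\<bar> = norm x powr m * \<bar>g (x /\<^sub>R norm x)\<bar>" by (subst hom) (simp_all add: abs_mult)
    qed (use m in auto)
    then show ?thesis using w by (simp add: abs_mult less_imp_le)
  qed
  show int: "integrable lborel (\<lambda>x. g x * gw (\<lambda>_. 1) x) \<longleftrightarrow> integrable sphere_measure g"
    unfolding integrable_iff_bounded abs using c by (auto simp: ennreal_mult_less_top)
  have mx: "max 0 (a * b) = a * max 0 b" if "a \<ge> 0" for a b :: real using that by (auto simp: max_def mult_nonneg_nonpos zero_le_mult_iff)
  have p: "(\<integral>\<^sup>+x. ennreal (g x * gw (\<lambda>_. 1) x) \<partial>lborel) = ennreal ?c * (\<integral>\<^sup>+x. ennreal (g x) \<partial>sphere_measure)"
  proof -
    have "(\<integral>\<^sup>+x. ennreal (max 0 (g x) * gw (\<lambda>_. 1) x) \<partial>lborel) = ennreal ?c * (\<integral>\<^sup>+x. ennreal (max 0 (g x)) \<partial>sphere_measure)"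
    proof (rule nn_integral_gw_homogeneous)
      fix x :: "real^'n" assume "x \<noteq> 0"
      then show "max 0 (g x) = norm x powr m * max 0 (g (x /\<^sub>R norm x))"
        by (subst hom) (simp_all add: mx)
    qed (use m in auto)
    moreover have "ennreal (max 0 (g x) * gw (\<lambda>_. 1) x) = ennreal (g x * gw (\<lambda>_. 1) x)" for x
      using w[of x] by (cases "g x \<ge> 0") (auto simp: max_def ennreal_neg mult_nonpos_nonneg)
    moreover have "ennreal (max 0 (g x)) = ennreal (g x)" for x by (auto simp: max_def ennreal_neg)
    ultimately show ?thesis by simp
  qed
  have n: "(\<integral>\<^sup>+x. ennreal (- (g x * gw (\<lambda>_. 1) x)) \<partial>lborel) = ennreal ?c * (\<integral>\<^sup>+x. ennreal (- g x) \<partial>sphere_measure)"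
  proof -
    have "(\<integral>\<^sup>+x. ennreal (max 0 (- g x) * gw (\<lambda>_. 1) x) \<partial>lborel) = ennreal ?c * (\<integral>\<^sup>+x. ennreal (max 0 (- g x)) \<partial>sphere_measure)"
    proof (rule nn_integral_gw_homogeneous)
      fix x :: "real^'n" assume "x \<noteq> 0"
      show "max 0 (- g x) = norm x powr m * max 0 (- g (x /\<^sub>R norm x))"
        using mx[of "norm x powr m" "- g (x /\<^sub>R norm x)"] \<open>x \<noteq> 0\<close> by (subst hom) simp_all
    qed (use m in auto)
    moreover have "ennreal (max 0 (- g x) * gw (\<lambda>_. 1) x) = ennreal (- (g x * gw (\<lambda>_. 1) x))" for x
      using w[of x] by (cases "g x \<ge> 0") (auto simp: max_def ennreal_neg mult_nonpos_nonneg)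
    moreover have "ennreal (max 0 (- g x)) = ennreal (- g x)" for x by (auto simp: max_def ennreal_neg)
    ultimately show ?thesis by simp
  qed
  show "(LINT x|lborel. g x * gw (\<lambda>_. 1) x) = ?c * (LINT x|sphere_measure. g x)"
  proof (cases "integrable sphere_measure g")
    case True
    have "(LINT x|lborel. g x * gw (\<lambda>_. 1) x) = enn2real (\<integral>\<^sup>+x. ennreal (g x * gw (\<lambda>_. 1) x) \<partial>lborel) - enn2real (\<integral>\<^sup>+x. ennreal (- (g x * gw (\<lambda>_. 1) x)) \<partial>lborel)"
      using True int by (subst real_lebesgue_integral_def) auto
    also have "\<dots> = ?c * (enn2real (\<integral>\<^sup>+x. ennreal (g x) \<partial>sphere_measure) - enn2real (\<integral>\<^sup>+x. ennreal (- g x) \<partial>sphere_measure))"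
      unfolding p n using c by (simp add: enn2real_mult algebra_simps)
    also have "\<dots> = ?c * (LINT x|sphere_measure. g x)"
      using True by (subst real_lebesgue_integral_def[OF True]) auto
    finally show ?thesis .
  next
    case False
    then show ?thesis using int by (simp add: not_integrable_integral_eq)
  qed
qed

subsection \<open>Spherical harmonics and their completeness\<close>

lemma continuous_bounded_on_sphere:
  fixes h :: "real^'n \<Rightarrow> real"
  assumes "continuous_on UNIV h"
  shows "\<exists>B>0. \<forall>x\<in>sphere 0 1. \<bar>h x\<bar> \<le> B"
proof -
  have "compact (h ` sphere 0 1)" using assms by (intro compact_continuous_image) (auto intro: continuous_on_subset)
  then obtain B where "\<forall>x\<in>sphere 0 1. \<bar>h x\<bar> \<le> B" by (auto dest!: compact_imp_bounded simp: bounded_iff)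
  then show ?thesis by (intro exI[of _ "\<bar>B\<bar> + 1"]) force
qed

lemma integrable_mult_bounded_sphere:
  fixes q h :: "real^'n \<Rightarrow> real"
  assumes q: "integrable sphere_measure q" and h: "h \<in> borel_measurable sphere_measure"
    and B: "\<And>x. x \<in> sphere 0 1 \<Longrightarrow> \<bar>h x\<bar> \<le> B"
  shows "integrable sphere_measure (\<lambda>x. q x * h x)"
proof (rule Bochner_Integration.integrable_bound)
  show "integrable sphere_measure (\<lambda>x. B * q x)" using q by simp
  have "norm (q x * h x) \<le> norm (B * q x)" if "x \<in> sphere 0 1" for x
    using B[OF that] mult_left_mono[of "\<bar>h x\<bar>" "\<bar>B\<bar>" "\<bar>q x\<bar>"] by (simp add: abs_mult mult.commute)
  then show "AE x in sphere_measure. norm (q x * h x) \<le> norm (B * q x)" by (intro AE_I2) (simp add: space_sphere_measure)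
qed (use q h in simp)

lemma integrable_mult_continuous_sphere:
  fixes q h :: "real^'n \<Rightarrow> real"
  assumes "integrable sphere_measure q" "continuous_on UNIV h"
  shows "integrable sphere_measure (\<lambda>x. q x * h x)"
proof -
  obtain B where "\<And>x. x \<in> sphere 0 1 \<Longrightarrow> \<bar>h x\<bar> \<le> B" using continuous_bounded_on_sphere[OF assms(2)] by blast
  with assms show ?thesis
    by (intro integrable_mult_bounded_sphere borel_measurable_sphere borel_measurable_continuous_onI)
qed

lemma integrable_mult_hp_sphere:
  "integrable sphere_measure q \<Longrightarrow> hp n p \<Longrightarrow> integrable sphere_measure (\<lambda>x. q x * p x)"
  by (intro integrable_mult_continuous_sphere hp_continuous)

lemma hp_measurable_sphere: "hp n p \<Longrightarrow> p \<in> borel_measurable sphere_measure"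
  by (intro borel_measurable_sphere hp_measurable)

lemma hp_polar: "hp n p \<Longrightarrow> x \<noteq> 0 \<Longrightarrow> p x = norm x powr real n * p (x /\<^sub>R norm x)"
  using hp_homogeneous[of n p "norm x" "x /\<^sub>R norm x"] by (simp add: powr_realpow)

lemma nat_plus_CARD_pos: "real n + real CARD('n::finite) > 0"
  by (simp add: add_nonneg_pos)

lemma hp_integrable_sphere: "hp n p \<Longrightarrow> integrable sphere_measure p"
proof -
  assume p: "hp n p"
  have "integrable lborel (\<lambda>x. p x * gw (\<lambda>_. 1) x)" by (rule hp_integrable_gw[OF _ p]) simp
  then show ?thesis
    using integral_gw_homogeneous(1)[OF hp_measurable[OF p] nat_plus_CARD_pos hp_polar[OF p]] by blast
qed

lemma gint_one_eq_sphere: "hp n p \<Longrightarrow> gint (\<lambda>_. 1) p = rconst (real CARD('n)) (real n) * (LINT x|sphere_measure. p x)"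
  for p :: "real^'n \<Rightarrow> real"
  unfolding gint_def by (rule integral_gw_homogeneous(2)[OF hp_measurable nat_plus_CARD_pos hp_polar])

lemma rconst_CARD_pos: "rconst (real CARD('n::finite)) (real n) > 0"
  by (rule rconst_pos) (simp add: add_nonneg_pos)

lemma sph_harm_orthogonal:
  assumes "Y \<in> sph_harm n" "Z \<in> sph_harm m" "n \<noteq> m"
  shows "(LINT x|sphere_measure. Y x * Z x) = 0"
proof -
  have "rconst (real CARD('a)) (real (n + m)) * (LINT x|sphere_measure. Y x * Z x) = 0"
    using gint_one_eq_sphere[OF hp_mult[OF sph_harm_hp[OF assms(1)] sph_harm_hp[OF assms(2)]]]
      gint_sph_harm_orthogonal[OF assms] by simp
  then show ?thesis using rconst_CARD_pos[where ?'n='a, of "n + m"] by simp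
qed

text \<open>Homogeneity transfers the vanishing integral to the Gaussian one, so p vanishes almost
  everywhere; its nonzero set is open and null, hence empty. Uniqueness of the projection rests on
  this.\<close>

lemma hp_eq_zero_if_sphere_norm_zero:
  fixes p :: "real^'n \<Rightarrow> real"
  assumes p: "hp n p" and z: "(LINT x|sphere_measure. (p x)\<^sup>2) = 0"
  shows "p = (\<lambda>_. 0)"
proof -
  have h: "hp (n + n) (\<lambda>x. (p x)\<^sup>2)" using hp_mult[OF p p] by (simp add: power2_eq_square)
  have [measurable]: "p \<in> borel_measurable borel" using p by (rule hp_measurable)
  have "(LINT x|lborel. (p x)\<^sup>2 * gw (\<lambda>_. 1) x) = 0"
    using gint_one_eq_sphere[OF h] z by (simp add: gint_def)
  then have "AE x in lborel. (p x)\<^sup>2 * gw (\<lambda>_. 1) x = 0"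
    using integral_nonneg_eq_0_iff_AE[OF hp_integrable_gw[OF _ h, of "\<lambda>_. 1"]] by (simp add: gw_def)
  then have "AE x in lborel. p x = 0" by eventually_elim (auto simp: gw_def)
  then have "{x. p x \<noteq> 0} \<in> null_sets lborel" by (simp add: AE_iff_null)
  then have "negligible {x. p x \<noteq> 0}" by (simp add: negligible_iff_null_sets null_sets_completionI)
  moreover have "open {x. p x \<noteq> 0}"
    by (rule open_Collect_neq) (use hp_continuous[OF p] in \<open>auto intro: continuous_intros\<close>)
  ultimately have "{x. p x \<noteq> 0} = {}" using open_not_negligible by blast
  then show ?thesis by auto
qed

section \<open>Square-integrable functions and the orthogonal projections\<close>

definition L2s :: "(real^'n \<Rightarrow> real) \<Rightarrow> bool" where
  "L2s f \<longleftrightarrow> f \<in> borel_measurable sphere_measure \<and> integrable sphere_measure (\<lambda>x. (f x)\<^sup>2)"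

lemma hp_L2s: "hp n p \<Longrightarrow> L2s p"
  unfolding L2s_def using hp_integrable_sphere[OF hp_mult[of n p n p]] hp_measurable_sphere
  by (auto simp: power2_eq_square)

lemma L2s_mult_integrable: "L2s f \<Longrightarrow> L2s g \<Longrightarrow> integrable sphere_measure (\<lambda>x. f x * g x)"
proof -
  assume f: "L2s f" and g: "L2s g"
  have [measurable]: "f \<in> borel_measurable sphere_measure" "g \<in> borel_measurable sphere_measure"
    using f g by (auto simp: L2s_def)
  show ?thesis
  proof (rule Bochner_Integration.integrable_bound)
    show "integrable sphere_measure (\<lambda>x. (f x)\<^sup>2 + (g x)\<^sup>2)" using f g by (simp add: L2s_def)
    have "\<bar>a * b\<bar> \<le> a\<^sup>2 + b\<^sup>2" for a b :: real
    proof -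
      have "0 \<le> \<bar>a\<bar> * \<bar>b\<bar>" "2 * \<bar>a\<bar> * \<bar>b\<bar> \<le> \<bar>a\<bar>\<^sup>2 + \<bar>b\<bar>\<^sup>2" by (simp, rule sum_squares_bound)
      then show ?thesis unfolding abs_mult power2_abs by linarith
    qed
    then show "AE x in sphere_measure. norm (f x * g x) \<le> norm ((f x)\<^sup>2 + (g x)\<^sup>2)" by simp
  qed simp
qed

lemma L2s_cmult: "L2s f \<Longrightarrow> L2s (\<lambda>x. c * f x)"
  by (auto simp: L2s_def power_mult_distrib)

lemma L2s_add: "L2s f \<Longrightarrow> L2s g \<Longrightarrow> L2s (\<lambda>x. f x + g x)"
  using L2s_mult_integrable[of f g] by (auto simp: L2s_def power2_sum mult.assoc)

lemma L2s_diff: "L2s f \<Longrightarrow> L2s g \<Longrightarrow> L2s (\<lambda>x. f x - g x)"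
  using L2s_add[of f "\<lambda>x. (-1) * g x"] L2s_cmult[of g "-1"] by simp

lemma L2s_sum: "finite A \<Longrightarrow> (\<And>a. a \<in> A \<Longrightarrow> L2s (f a)) \<Longrightarrow> L2s (\<lambda>x. \<Sum>a\<in>A. f a x)"
  by (induction A rule: finite_induct) (auto intro: L2s_add simp: L2s_def[of "\<lambda>_. 0"])

lemma L2s_integrable: "L2s f \<Longrightarrow> integrable sphere_measure f"
  using L2s_mult_integrable[of f "\<lambda>_. 1"] hp_L2s[OF hp_const[of 1]] by simp

text \<open>Gram-Schmidt by induction: both \<open>f\<close> and the new vector are first made
  orthogonal to the old ones. The family may be linearly dependent, as the harmonic components of
  monomials are in general.\<close>

lemma ex_orthogonal_projection:
  fixes b :: "'i \<Rightarrow> real^'n \<Rightarrow> real"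
  assumes "finite I"
  shows "(\<forall>i\<in>I. L2s (b i)) \<Longrightarrow> L2s f \<Longrightarrow>
    \<exists>c. \<forall>j\<in>I. (LINT x|sphere_measure. (f x - (\<Sum>i\<in>I. c i * b i x)) * b j x) = 0"
  using assms
proof (induction I arbitrary: f rule: finite_induct)
  case empty
  then show ?case by simp
next
  case (insert k I)
  let ?S = "sphere_measure :: (real^'n) measure"
  have LI: "\<forall>i\<in>I. L2s (b i)" and Lk: "L2s (b k)" using insert.prems by auto
  obtain c where c: "\<And>j. j \<in> I \<Longrightarrow> (LINT x|?S. (f x - (\<Sum>i\<in>I. c i * b i x)) * b j x) = 0"
    using insert.IH[OF LI insert.prems(2)] by blast
  obtain e where e: "\<And>j. j \<in> I \<Longrightarrow> (LINT x|?S. (b k x - (\<Sum>i\<in>I. e i * b i x)) * b j x) = 0"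
    using insert.IH[OF LI Lk] by blast
  define r where "r x = f x - (\<Sum>i\<in>I. c i * b i x)" for x
  define b' where "b' x = b k x - (\<Sum>i\<in>I. e i * b i x)" for x
  \<comment> \<open>If \<open>b'\<close> has norm zero, division by zero sets t to 0. This is
    harmless: \<open>b'\<close> then vanishes almost everywhere, and its inner product with
    \<open>r\<close> is 0 too.\<close>
  define t where "t = (LINT x|?S. r x * b' x) / (LINT x|?S. b' x * b' x)"
  have Lb: "L2s (b i)" if "i \<in> I" for i using insert that by auto
  have Lr: "L2s r" and Lb': "L2s b'"
    unfolding r_def[abs_def] b'_def[abs_def] using insert Lb by (auto intro!: L2s_diff L2s_sum L2s_cmult)
  have Lrt: "L2s (\<lambda>x. r x - t * b' x)" by (intro L2s_diff L2s_cmult Lr Lb')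
  have rj: "(LINT x|?S. (r x - t * b' x) * b j x) = 0" if "j \<in> I" for j
  proof -
    have "(LINT x|?S. (r x - t * b' x) * b j x) = (LINT x|?S. r x * b j x - t * (b' x * b j x))"
      by (simp add: algebra_simps)
    also have "\<dots> = (LINT x|?S. r x * b j x) - t * (LINT x|?S. b' x * b j x)"
      using L2s_mult_integrable[OF Lr Lb[OF that]] L2s_mult_integrable[OF Lb' Lb[OF that]] by simp
    also have "\<dots> = 0" using c[OF that] e[OF that] by (simp add: r_def b'_def)
    finally show ?thesis .
  qed
  have rb: "(LINT x|?S. (r x - t * b' x) * b' x) = 0"
  proof -
    have "(LINT x|?S. (r x - t * b' x) * b' x) = (LINT x|?S. r x * b' x - t * (b' x * b' x))"
      by (simp add: algebra_simps)
    also have "\<dots> = (LINT x|?S. r x * b' x) - t * (LINT x|?S. b' x * b' x)"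
      using L2s_mult_integrable[OF Lr Lb'] L2s_mult_integrable[OF Lb' Lb'] by simp
    also have "\<dots> = 0"
    proof (cases "(LINT x|?S. b' x * b' x) = 0")
      case True
      then have "AE x in ?S. b' x * b' x = 0"
        using integral_nonneg_eq_0_iff_AE[OF L2s_mult_integrable[OF Lb' Lb']] by simp
      then have "(LINT x|?S. r x * b' x) = (LINT x|?S. 0)"
        using Lr Lb' by (intro integral_cong_AE) (auto simp: L2s_def)
      then show ?thesis using True by simp
    qed (simp add: t_def)
    finally show ?thesis .
  qed
  have rk: "(LINT x|?S. (r x - t * b' x) * b k x) = 0"
  proof -
    have "b k x = b' x + (\<Sum>i\<in>I. e i * b i x)" for x by (simp add: b'_def)
    then have "(LINT x|?S. (r x - t * b' x) * b k x) =
      (LINT x|?S. (r x - t * b' x) * b' x + (\<Sum>i\<in>I. e i * ((r x - t * b' x) * b i x)))"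
      by (simp add: algebra_simps sum_distrib_left sum_distrib_right)
    also have "\<dots> = (LINT x|?S. (r x - t * b' x) * b' x) + (\<Sum>i\<in>I. e i * (LINT x|?S. (r x - t * b' x) * b i x))"
      using L2s_mult_integrable[OF Lrt Lb'] L2s_mult_integrable[OF Lrt Lb]
      by (subst Bochner_Integration.integral_add) (auto intro!: Bochner_Integration.integrable_sum simp: Bochner_Integration.integral_sum)
    also have "\<dots> = 0" using rb rj by simp
    finally show ?thesis .
  qed
  \<comment> \<open>Coefficients of the projection after replacing \<open>b'\<close> by
    \<open>b k\<close> minus its own projection.\<close>
  define d where "d i = (if i = k then t else c i - t * e i)" for i
  have "f x - (\<Sum>i\<in>insert k I. d i * b i x) = r x - t * b' x" for x
  proof -
    have "(\<Sum>i\<in>I. d i * b i x) = (\<Sum>i\<in>I. c i * b i x) - t * (\<Sum>i\<in>I. e i * b i x)"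
    proof -
      have "(\<Sum>i\<in>I. d i * b i x) = (\<Sum>i\<in>I. c i * b i x - t * (e i * b i x))"
        using insert(2) by (intro sum.cong) (auto simp: d_def algebra_simps)
      then show ?thesis by (simp add: sum_subtractf sum_distrib_left)
    qed
    then show ?thesis using insert(1,2) by (simp add: r_def b'_def d_def algebra_simps)
  qed
  then show ?case using rj rk by (intro exI[of _ d]) auto
qed

text \<open>This justifies the definite description in \<open>proj_H\<close>. Existence comes from
  the finite spanning family; for uniqueness, the difference of two candidates is itself a harmonic,
  hence orthogonal to itself.\<close>

lemma proj_H_properties:
  fixes f :: "real^'n \<Rightarrow> real"
  assumes f: "L2s f" and N: "CARD('n) \<ge> 3"
  shows "proj_H n f \<in> sph_harm n"
    and "\<And>h. h \<in> sph_harm n \<Longrightarrow> (LINT x|sphere_measure. (f x - proj_H n f x) * h x) = 0"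
proof -
  let ?I = "{\<alpha>::'n \<Rightarrow> nat. sum \<alpha> UNIV = n}"
  let ?b = "\<lambda>\<alpha>. harm_comp n (monom_fn \<alpha>) :: real^'n \<Rightarrow> real"
  have b: "?b \<alpha> \<in> sph_harm n" if "\<alpha> \<in> ?I" for \<alpha>
    using harm_comp_sph_harm[OF _ N, of n "monom_fn \<alpha>"] hp_monom_fn[of \<alpha>] that by auto
  then have Lb: "\<forall>\<alpha>\<in>?I. L2s (?b \<alpha>)" using hp_L2s sph_harm_hp by blast
  from ex_orthogonal_projection[OF finite_multi_index Lb f] obtain c where
    c: "\<And>\<alpha>. \<alpha> \<in> ?I \<Longrightarrow> (LINT x|sphere_measure. (f x - (\<Sum>i\<in>?I. c i * ?b i x)) * ?b \<alpha> x) = 0" by blast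
  define g where "g x = (\<Sum>i\<in>?I. c i * ?b i x)" for x
  have g: "g \<in> sph_harm n" unfolding g_def[abs_def] by (intro sph_harm_sum sph_harm_cmult b finite_multi_index)
  have Lg: "L2s g" using g hp_L2s sph_harm_hp by blast
  have orth: "(LINT x|sphere_measure. (f x - g x) * h x) = 0" if "h \<in> sph_harm n" for h
  proof -
    from sph_harm_span[OF that] obtain e where h: "h = (\<lambda>x. \<Sum>\<alpha>\<in>?I. e \<alpha> * ?b \<alpha> x)" by blast
    have "(LINT x|sphere_measure. (f x - g x) * h x) = (LINT x|sphere_measure. (\<Sum>\<alpha>\<in>?I. e \<alpha> * ((f x - g x) * ?b \<alpha> x)))"
      unfolding h by (simp add: sum_distrib_left mult.left_commute)
    also have "\<dots> = (\<Sum>\<alpha>\<in>?I. e \<alpha> * (LINT x|sphere_measure. (f x - g x) * ?b \<alpha> x))"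
      using L2s_mult_integrable[OF L2s_diff[OF f Lg]] Lb by (subst Bochner_Integration.integral_sum) auto
    also have "\<dots> = 0" using c by (simp add: g_def)
    finally show ?thesis .
  qed
  have uniq: "g' = g" if g': "g' \<in> sph_harm n" "\<forall>h\<in>sph_harm n. (LINT x|sphere_measure. (f x - g' x) * h x) = 0" for g'
  proof -
    define u where "u x = g' x - g x" for x
    have u: "u \<in> sph_harm n" unfolding u_def[abs_def] by (intro sph_harm_diff g' g)
    have Lu: "L2s u" and Lg': "L2s g'" using u g' hp_L2s sph_harm_hp by blast+
    have "(LINT x|sphere_measure. (u x)\<^sup>2) = (LINT x|sphere_measure. (f x - g x) * u x - (f x - g' x) * u x)"
      by (simp add: u_def power2_eq_square algebra_simps)
    also have "\<dots> = 0"
      using L2s_mult_integrable[OF L2s_diff[OF f Lg] Lu] L2s_mult_integrable[OF L2s_diff[OF f Lg'] Lu] orth[OF u] g'(2) u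
      by simp
    finally have "u = (\<lambda>_. 0)" using hp_eq_zero_if_sphere_norm_zero[OF sph_harm_hp[OF u]] by simp
    then show ?thesis by (auto simp: u_def fun_eq_iff)
  qed
  have "proj_H n f = g" unfolding proj_H_def
    by (rule the_equality) (use g orth uniq in blast)+
  then show "proj_H n f \<in> sph_harm n"
    and "\<And>h. h \<in> sph_harm n \<Longrightarrow> (LINT x|sphere_measure. (f x - proj_H n f x) * h x) = 0" using g orth by auto
qed

section \<open>Completeness of the spherical harmonics\<close>

inductive polysum :: "(real^'n \<Rightarrow> real) \<Rightarrow> bool" where
  polysum_hp: "hp n p \<Longrightarrow> polysum p"
| polysum_add: "polysum p \<Longrightarrow> polysum q \<Longrightarrow> polysum (\<lambda>x. p x + q x)"

lemma polysum_mult: "polysum p \<Longrightarrow> polysum q \<Longrightarrow> polysum (\<lambda>x. p x * q x)"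
proof (induction rule: polysum.induct)
  case (polysum_hp n p)
  from polysum_hp(2) show ?case
  proof (induction rule: polysum.induct)
    case (polysum_add q r)
    from polysum.polysum_add[OF polysum_add.IH] show ?case by (simp add: distrib_left)
  qed (blast intro: polysum.polysum_hp hp_mult polysum_hp)
next
  case (polysum_add p r)
  from polysum.polysum_add[OF polysum_add.IH] polysum_add.prems show ?case by (simp add: distrib_right)
qed

lemma real_polynomial_function_polysum: "real_polynomial_function p \<Longrightarrow> polysum p"
  for p :: "real^'n \<Rightarrow> real"
proof (induction rule: real_polynomial_function.induct)
  case (linear f)
  then have "linear f" by (rule bounded_linear.linear)
  have "f x = (\<Sum>i\<in>UNIV. f (axis i 1) * x $ i)" for x
  proof -
    have "x = (\<Sum>i\<in>UNIV. x $ i *\<^sub>R axis i 1)" using basis_expansion[of x] by (simp add: scalar_mult_eq_scaleR)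
    then have "f x = f (\<Sum>i\<in>UNIV. x $ i *\<^sub>R axis i 1)" by simp
    also have "\<dots> = (\<Sum>i\<in>UNIV. f (axis i 1) * x $ i)"
      using \<open>linear f\<close> by (simp add: linear_sum linear_cmul mult.commute)
    finally show ?thesis .
  qed
  moreover have "hp 1 (\<lambda>x. \<Sum>i\<in>UNIV. f (axis i 1) * x $ i)" by (intro hp_sum hp_cmult hp_coord) auto
  ultimately show ?case using polysum_hp by (metis (no_types, lifting) ext)
qed (auto intro: polysum_hp hp_const polysum_add polysum_mult)

text \<open>Stone--Weierstrass upgrades orthogonality to harmonics to orthogonality to continuous functions,
  hence to indicators of closed sets, hence to all Borel sets.\<close>

lemma AE_zero_if_orthogonal_sph_harm:
  fixes g :: "real^'n \<Rightarrow> real"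
  assumes N: "CARD('n) \<ge> 3" and g: "integrable sphere_measure g"
    and orth: "\<And>n Y. Y \<in> sph_harm n \<Longrightarrow> (LINT x|sphere_measure. g x * Y x) = 0"
  shows "AE x in sphere_measure. g x = 0"
proof -
  let ?S = "sphere_measure :: (real^'n) measure"
  have gm[measurable]: "g \<in> borel_measurable ?S" using g by simp
  note cint = integrable_mult_continuous_sphere[OF g]
  have hp0: "(LINT x|?S. g x * p x) = 0" if "hp n p" for n p
  proof -
    from hp_eq_sum_harmonics_on_sphere[OF N that] obtain Y where
      Y: "\<And>m. Y m \<in> sph_harm m" "\<And>x. x \<in> sphere 0 1 \<Longrightarrow> p x = (\<Sum>m\<le>n. Y m x)" by blast
    have "(LINT x|?S. g x * p x) = (LINT x|?S. (\<Sum>m\<le>n. g x * Y m x))"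
      by (rule Bochner_Integration.integral_cong) (auto simp: space_sphere_measure Y(2) sum_distrib_left)
    also have "\<dots> = (\<Sum>m\<le>n. (LINT x|?S. g x * Y m x))"
      by (rule Bochner_Integration.integral_sum) (intro cint hp_continuous[OF sph_harm_hp[OF Y(1)]])
    also have "\<dots> = 0" using orth[OF Y(1)] by simp
    finally show ?thesis .
  qed
  have ps0: "continuous_on UNIV p \<and> (LINT x|?S. g x * p x) = 0" if "polysum p" for p
    using that
  proof (induction rule: polysum.induct)
    case (polysum_hp n p)
    then show ?case using hp0 hp_continuous by blast
  next
    case (polysum_add p q)
    then show ?case using cint[of p] cint[of q] by (auto simp: distrib_left intro: continuous_on_add)
  qed
  have c0: "(LINT x|?S. g x * h x) = 0" if h: "continuous_on UNIV h" for h
  proof -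
    have bnd: "\<bar>LINT x|?S. g x * h x\<bar> \<le> e * (LINT x|?S. \<bar>g x\<bar>)" if e: "e > 0" for e
    proof -
      obtain p where p: "real_polynomial_function p" "\<And>x. x \<in> sphere 0 1 \<Longrightarrow> \<bar>h x - p x\<bar> < e"
        using Stone_Weierstrass_real_polynomial_function[of "sphere 0 1" h e] h e
        by (metis compact_sphere continuous_on_subset subset_UNIV)
      note p0 = ps0[OF real_polynomial_function_polysum[OF p(1)]]
      have "(LINT x|?S. g x * h x) = (LINT x|?S. g x * h x - g x * p x)"
        using p0 cint[OF h] cint[of p] by simp
      also have "\<bar>\<dots>\<bar> \<le> (LINT x|?S. \<bar>g x * h x - g x * p x\<bar>)" by (rule integral_abs_bound)
      also have "\<dots> \<le> (LINT x|?S. e * \<bar>g x\<bar>)"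
      proof (rule integral_mono)
        fix x assume "x \<in> space ?S"
        then have "\<bar>h x - p x\<bar> \<le> e" using p(2)[of x] by (simp add: space_sphere_measure)
        then have "\<bar>g x\<bar> * \<bar>h x - p x\<bar> \<le> \<bar>g x\<bar> * e" by (rule mult_left_mono) simp
        then show "\<bar>g x * h x - g x * p x\<bar> \<le> e * \<bar>g x\<bar>"
          by (simp add: abs_mult[symmetric] right_diff_distrib mult.commute)
      qed (use cint[OF h] cint[of p] p0 g in auto)
      finally show ?thesis by simp
    qed
    have "\<bar>LINT x|?S. g x * h x\<bar> \<le> 0"
    proof (rule field_le_epsilon)
      fix e :: real assume "e > 0"
      \<comment> \<open>Dividing by G + 1 rather than by G avoids the case of a vanishing L1
        norm.\<close>
      define G where "G = (LINT x|?S. \<bar>g x\<bar>)"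
      have G: "G \<ge> 0" unfolding G_def by simp
      have "e / (G + 1) > 0" using G \<open>e > 0\<close> by simp
      from bnd[OF this] have "\<bar>LINT x|?S. g x * h x\<bar> \<le> e / (G + 1) * G" by (simp add: G_def)
      also have "\<dots> \<le> e" using G \<open>e > 0\<close> by (simp add: field_simps)
      finally show "\<bar>LINT x|?S. g x * h x\<bar> \<le> 0 + e" by simp
    qed
    then show ?thesis by simp
  qed
  have ind_int: "integrable ?S (\<lambda>x. g x * indicator B x)" if "B \<in> sets borel" for B
    using that by (intro integrable_mult_bounded_sphere[OF g, where B=1] borel_measurable_sphere) (auto simp: indicator_def)
  have cl0: "(LINT x|?S. g x * indicator F x) = 0" if F: "closed F" for F
  proof (cases "F = {}")
    case False
    \<comment> \<open>Continuous functions decreasing to the indicator of F. The empty set was split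
      off because \<open>infdist\<close> to it is 0, which would give the constant 1.\<close>
    define h where "h k x = max 0 (1 - real k * infdist x F)" for k :: nat and x
    have hc: "continuous_on UNIV (h k)" for k unfolding h_def by (intro continuous_intros)
    have "(\<lambda>k. LINT x|?S. g x * h k x) \<longlonglongrightarrow> (LINT x|?S. g x * indicator F x)"
    proof (rule integral_dominated_convergence[where w="\<lambda>x. \<bar>g x\<bar>"])
      show "(\<lambda>x. g x * indicator F x) \<in> borel_measurable ?S" using ind_int[of F] F by simp
      show "(\<lambda>x. g x * h k x) \<in> borel_measurable ?S" for k using cint[OF hc] by simp
      show "integrable ?S (\<lambda>x. \<bar>g x\<bar>)" using g by simp
      show "AE x in ?S. norm (g x * h k x) \<le> \<bar>g x\<bar>" for k
      proof (intro AE_I2)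
        fix x
        have "0 \<le> real k * infdist x F" by (simp add: infdist_nonneg)
        then have "\<bar>h k x\<bar> \<le> 1" unfolding h_def by linarith
        then show "norm (g x * h k x) \<le> \<bar>g x\<bar>"
          using mult_left_mono[of "\<bar>h k x\<bar>" 1 "\<bar>g x\<bar>"] by (simp add: abs_mult)
      qed
      show "AE x in ?S. (\<lambda>k. g x * h k x) \<longlonglongrightarrow> g x * indicator F x"
      proof (intro AE_I2 tendsto_mult tendsto_const)
        fix x
        show "(\<lambda>k. h k x) \<longlonglongrightarrow> indicator F x"
        proof (cases "x \<in> F")
          case True
          then show ?thesis by (simp add: h_def)
        next
          case xF: False
          then have d: "infdist x F > 0" using F False by (metis in_closed_iff_infdist_zero infdist_nonneg less_eq_real_def)
          obtain k0 :: nat where k0: "real k0 > 1 / infdist x F" using reals_Archimedean2 by blast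
          have "h k x = 0" if "k \<ge> k0" for k
          proof -
            have "real k > 1 / infdist x F" using k0 that by (meson of_nat_le_iff order_less_le_trans)
            then show ?thesis using d by (simp add: h_def field_simps)
          qed
          then show ?thesis using xF by (intro tendsto_eventually) (auto simp: eventually_sequentially)
        qed
      qed
    qed
    then have "(\<lambda>k::nat. 0) \<longlonglongrightarrow> (LINT x|?S. g x * indicator F x)" unfolding c0[OF hc] .
    from LIMSEQ_unique[OF this tendsto_const] show ?thesis .
  qed simp
  have all0: "(LINT x|?S. g x * indicator B x) = 0" if "B \<in> sigma_sets UNIV (Collect closed)" for B
  proof -
    have I: "Int_stable (Collect closed :: (real^'n) set set)" by (auto simp: Int_stable_def)
    have P: "Collect closed \<subseteq> Pow (UNIV :: (real^'n) set)" by auto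
    show ?thesis using I P that
    proof (induction rule: sigma_sets_induct_disjoint)
      case (compl A)
      have A: "A \<in> sets borel" using compl(1) by (simp add: borel_eq_closed)
      have "(LINT x|?S. g x * indicator (UNIV - A) x) = (LINT x|?S. g x * 1 - g x * indicator A x)"
        by (intro Bochner_Integration.integral_cong) (auto simp: indicator_def)
      also have "\<dots> = 0" using c0[of "\<lambda>_. 1"] compl(2) ind_int[OF A] g by simp
      finally show ?case .
    next
      case (union A)
      have A: "A i \<in> sets borel" for i using union(2) by (auto simp: borel_eq_closed)
      let ?A = "\<lambda>i. A i \<inter> sphere 0 1"
      have ss: "B \<inter> sphere 0 1 \<in> sets ?S" if "B \<in> sets borel" for B
        using that unfolding sets_sphere_measure by (auto simp: sets_restrict_space Int_commute)
      have conv: "(LINT x:(B \<inter> sphere 0 1)|?S. g x) = (LINT x|?S. g x * indicator B x)" for B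
        unfolding set_lebesgue_integral_def
        by (rule Bochner_Integration.integral_cong) (auto simp: space_sphere_measure indicator_def)
      have U: "(\<Union>i. A i) \<inter> sphere 0 1 = (\<Union>i. ?A i)" by auto
      have "(LINT x:(\<Union>i. ?A i)|?S. g x) = (\<Sum>i. (LINT x:(?A i)|?S. g x))"
      proof (rule lebesgue_integral_countable_add)
        show "?A i \<in> sets ?S" for i using ss[OF A] .
        show "?A i \<inter> ?A j = {}" if "i \<noteq> j" for i j using union(1) that by (auto simp: disjoint_family_on_def)
        show "set_integrable ?S (\<Union>i. ?A i) g"
          unfolding set_integrable_def using g by (intro integrable_mult_indicator sets.countable_UN) (auto intro: ss A)
      qed
      also have "\<dots> = 0" unfolding conv union(3) by simp
      finally show ?case unfolding U[symmetric] conv .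
    qed (auto simp: cl0)
  qed
  have "AE x in ?S. g x = (\<lambda>_. 0) x"
  proof (rule density_unique_real)
    fix B assume "B \<in> sets ?S"
    then obtain C where C: "C \<in> sets borel" "B = sphere 0 1 \<inter> C"
      unfolding sets_sphere_measure by (auto simp: sets_restrict_space)
    have "(LINT x:B|?S. g x) = (LINT x|?S. g x * indicator C x)"
      unfolding set_lebesgue_integral_def C
      by (rule Bochner_Integration.integral_cong) (auto simp: space_sphere_measure indicator_def)
    also have "\<dots> = 0" using C by (intro all0) (simp add: borel_eq_closed)
    finally show "(LINT x:B|?S. g x) = (LINT x:B|?S. (\<lambda>_. 0) x)" by (simp add: set_lebesgue_integral_def)
  qed (use g in auto)
  then show ?thesis by simp
qed

subsection \<open>The inverse operator\<close>

lemma Gamma_duplication_real: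
  fixes z :: real
  assumes "z > 0"
  shows "Gamma z * Gamma (z + 1 / 2) = 2 powr (1 - 2 * z) * sqrt pi * Gamma (2 * z)"
proof -
  let ?z = "of_real z :: complex"
  have "?z \<notin> \<int>\<^sub>\<le>\<^sub>0" "?z + 1/2 \<notin> \<int>\<^sub>\<le>\<^sub>0"
    using assms by (auto elim!: nonpos_Ints_cases simp: complex_eq_iff)
  from Gamma_legendre_duplication[OF this]
  have "Gamma ?z * Gamma (?z + 1/2) = exp ((1 - 2*?z) * of_real (ln 2)) * of_real (sqrt pi) * Gamma (2*?z)" .
  also have "?z + 1/2 = of_real (z + 1/2)" by simp
  also have "2 * ?z = of_real (2 * z)" by simp
  also have "(1 - of_real (2 * z)) * complex_of_real (ln 2) = of_real ((1 - 2 * z) * ln 2)" by simp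
  finally have "complex_of_real (Gamma z * Gamma (z + 1/2)) = of_real (exp ((1 - 2 * z) * ln 2) * sqrt pi * Gamma (2 * z))"
    unfolding Gamma_complex_of_real exp_of_real by (simp only: of_real_mult)
  then have "Gamma z * Gamma (z + 1/2) = exp ((1 - 2 * z) * ln 2) * sqrt pi * Gamma (2 * z)"
    by (simp only: of_real_eq_iff)
  then show ?thesis by (simp add: powr_def)
qed

lemma pochhammer_Gamma_real: "a > 0 \<Longrightarrow> pochhammer a k = Gamma (a + real k) / Gamma a" for a :: real
  by (rule pochhammer_Gamma) (auto elim!: nonpos_Ints_cases)

lemma sums_one_minus_powr:
  fixes t a :: real
  assumes "\<bar>t\<bar> < 1"
  shows "(\<lambda>k. pochhammer a k / fact k * t ^ k) sums (1 - t) powr (- a)"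
proof -
  have "(\<lambda>k. (- a gchoose k) * (- t) ^ k) sums (1 + - t) powr (- a)" using assms by (intro gen_binomial_real) simp
  moreover have "(- a gchoose k) * (- t) ^ k = pochhammer a k / fact k * t ^ k" for k
  proof -
    have "(- 1) ^ k * (- t) ^ k = t ^ k" by (simp flip: power_mult_distrib)
    then show ?thesis by (simp add: gbinomial_pochhammer)
  qed
  ultimately show ?thesis by simp
qed

lemma nn_integral_Beta:
  assumes "a > 0" "b > (0::real)"
  shows "(\<integral>\<^sup>+t. ennreal (t powr (a - 1) * (1 - t) powr (b - 1)) * indicator {0..1} t \<partial>lborel) = ennreal (Gamma a * Gamma b / Gamma (a + b))"
  using nn_integral_has_integral_lebesgue'[OF _ has_integral_Beta_real[OF assms]] by (simp add: Beta_def)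

text \<open>Gauss's value of the hypergeometric function at 1, in terms of Gamma functions only.
  Euler's Beta integral represents each term; summing the binomial series under the integral leaves
  another Beta integral. All terms are nonnegative, so the exchange is free.\<close>

lemma Gauss_summation:
  fixes a b c :: real
  assumes a: "a > 0" and b: "b > 0" and c: "c > a + b"
  shows "(\<lambda>j. Gamma (a + real j) * Gamma (b + real j) / (fact j * Gamma (c + real j))) sums
    (Gamma a * Gamma b * Gamma (c - a - b) / (Gamma (c - a) * Gamma (c - b)))"
proof -
  let ?f = "\<lambda>j. Gamma (a + real j) * Gamma (b + real j) / (fact j * Gamma (c + real j))"
  have pos: "Gamma (c - b) > 0" "Gamma a > 0" "Gamma b > 0" "Gamma (c - a - b) > 0" "Gamma (c - a) > 0" using assms by auto
  have f0: "?f j \<ge> 0" for j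
  proof -
    have "a + real j > 0" "b + real j > 0" "c + real j > 0" using assms by linarith+
    then show ?thesis using Gamma_real_pos by (metis divide_nonneg_pos fact_gt_zero less_imp_le mult_nonneg_nonneg mult_pos_pos)
  qed
  let ?g = "\<lambda>j t. ennreal (pochhammer a j / fact j * (t powr (b + real j - 1) * (1 - t) powr (c - b - 1))) * indicator {0..1} t"
  have trm: "ennreal (?f j * Gamma (c - b) / Gamma a) = (\<integral>\<^sup>+t. ?g j t \<partial>lborel)" for j
  proof -
    have p: "pochhammer a j / fact j \<ge> 0" using a by (simp add: pochhammer_nonneg)
    have "(\<integral>\<^sup>+t. ?g j t \<partial>lborel) = (\<integral>\<^sup>+t. ennreal (pochhammer a j / fact j) * (ennreal (t powr (b + real j - 1) * (1 - t) powr (c - b - 1)) * indicator {0..1} t) \<partial>lborel)"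
      by (simp only: ennreal_mult'[OF p] mult.assoc)
    also have "\<dots> = ennreal (pochhammer a j / fact j) * ennreal (Gamma (b + real j) * Gamma (c - b) / Gamma (b + real j + (c - b)))"
      using b c a by (subst nn_integral_cmult) (simp, subst nn_integral_Beta, auto)
    also have "\<dots> = ennreal (pochhammer a j / fact j * (Gamma (b + real j) * Gamma (c - b) / Gamma (b + real j + (c - b))))"
      by (rule ennreal_mult'[OF p, symmetric])
    also have "pochhammer a j / fact j * (Gamma (b + real j) * Gamma (c - b) / Gamma (b + real j + (c - b))) = ?f j * Gamma (c - b) / Gamma a"
      by (simp add: pochhammer_Gamma_real[OF a] add.commute mult_ac)
    finally show ?thesis ..
  qed
  have "(\<Sum>j. ennreal (?f j * Gamma (c - b) / Gamma a)) = (\<integral>\<^sup>+t. (\<Sum>j. ?g j t) \<partial>lborel)"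
    unfolding trm by (rule nn_integral_suminf[symmetric]) simp
  also have "\<dots> = (\<integral>\<^sup>+t. ennreal (t powr (b - 1) * (1 - t) powr (c - a - b - 1)) * indicator {0..1} t \<partial>lborel)"
  proof (rule nn_integral_cong_AE)
    show "AE t in lborel. (\<Sum>j. ?g j t) = ennreal (t powr (b - 1) * (1 - t) powr (c - a - b - 1)) * indicator {0..1} t"
      using AE_lborel_singleton[of "1::real"] AE_lborel_singleton[of "0::real"]
    proof eventually_elim
      case (elim t)
      show ?case
      proof (cases "t \<in> {0..1}")
        case True
        then have t: "0 < t" "t < 1" using elim by auto
        have "(\<lambda>j. pochhammer a j / fact j * t ^ j * (t powr (b - 1) * (1 - t) powr (c - b - 1))) sums
           ((1 - t) powr (- a) * (t powr (b - 1) * (1 - t) powr (c - b - 1)))"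
          using t by (intro sums_mult2 sums_one_minus_powr) auto
        moreover have "(1 - t) powr (- a) * (t powr (b - 1) * (1 - t) powr (c - b - 1)) = t powr (b - 1) * (1 - t) powr (c - a - b - 1)"
          using powr_add[of "1 - t" "- a" "c - b - 1"] by (simp add: algebra_simps)
        moreover have "pochhammer a j / fact j * t ^ j * (t powr (b - 1) * (1 - t) powr (c - b - 1)) =
           pochhammer a j / fact j * (t powr (b + real j - 1) * (1 - t) powr (c - b - 1))" for j
        proof -
          have "t powr (b + real j - 1) = t ^ j * t powr (b - 1)"
            using powr_add[of t "real j" "b - 1"] t by (simp add: powr_realpow algebra_simps)
          then show ?thesis by simp
        qed
        ultimately have s: "(\<lambda>j. pochhammer a j / fact j * (t powr (b + real j - 1) * (1 - t) powr (c - b - 1))) sums (t powr (b - 1) * (1 - t) powr (c - a - b - 1))" by (simp only:)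
        have "pochhammer a j / fact j * (t powr (b + real j - 1) * (1 - t) powr (c - b - 1)) \<ge> 0" for j
          using a by (simp add: pochhammer_nonneg)
        with s have "(\<lambda>j. ennreal (pochhammer a j / fact j * (t powr (b + real j - 1) * (1 - t) powr (c - b - 1)))) sums ennreal (t powr (b - 1) * (1 - t) powr (c - a - b - 1))"
          by (subst sums_ennreal) auto
        then show ?thesis using True by (simp add: sums_iff)
      qed simp
    qed
  qed
  also have "\<dots> = ennreal (Gamma b * Gamma (c - a - b) / Gamma (b + (c - a - b)))"
    using assms by (intro nn_integral_Beta) auto
  finally have "(\<Sum>j. ennreal (?f j * Gamma (c - b) / Gamma a)) = ennreal (Gamma b * Gamma (c - a - b) / Gamma (c - a))" by simp
  then have "(\<lambda>j. ennreal (?f j * Gamma (c - b) / Gamma a)) sums ennreal (Gamma b * Gamma (c - a - b) / Gamma (c - a))"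
    by (simp add: sums_iff)
  then have "(\<lambda>j. ?f j * Gamma (c - b) / Gamma a) sums (Gamma b * Gamma (c - a - b) / Gamma (c - a))"
  proof (subst (asm) sums_ennreal)
    show "0 \<le> ?f j * Gamma (c - b) / Gamma a" for j
      by (rule divide_nonneg_pos[OF mult_nonneg_nonneg[OF f0]]) (use pos in auto)
  qed (use pos in \<open>auto simp: less_imp_le\<close>)
  then have "(\<lambda>j. ?f j * Gamma (c - b) / Gamma a * (Gamma a / Gamma (c - b))) sums (Gamma b * Gamma (c - a - b) / Gamma (c - a) * (Gamma a / Gamma (c - b)))"
    by (rule sums_mult2)
  moreover have "F * Gamma (c - b) / Gamma a * (Gamma a / Gamma (c - b)) = F" for F using pos by (simp add: field_simps)
  moreover have "Gamma b * Gamma (c - a - b) / Gamma (c - a) * (Gamma a / Gamma (c - b)) = Gamma a * Gamma b * Gamma (c - a - b) / (Gamma (c - a) * Gamma (c - b))"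
    by simp
  ultimately show ?thesis by (simp only:)
qed

text \<open>Closure under radial extension lets the cone over the sphere part of B be compared with
  B itself, which has Lebesgue measure zero.\<close>

lemma AE_sphere_not_in_null_cone:
  fixes B :: "(real^'n) set"
  assumes B: "B \<in> null_sets lborel" and cone: "\<And>x. x \<noteq> 0 \<Longrightarrow> x /\<^sub>R norm x \<in> B \<Longrightarrow> x \<in> B"
  shows "AE y in sphere_measure. y \<notin> B"
proof -
  have [measurable]: "B \<in> sets borel" using B by auto
  have "(\<integral>\<^sup>+x. indicator B x \<partial>sphere_measure) =
    of_nat CARD('n) * (\<integral>\<^sup>+x. indicator B (x /\<^sub>R norm x) * indicator (cball 0 1 - {0}) x \<partial>lborel)"
    by (rule nn_integral_sphere_measure) simp
  also have "(\<integral>\<^sup>+x. indicator B (x /\<^sub>R norm x) * indicator (cball 0 1 - {0}) x \<partial>lborel) \<le> (\<integral>\<^sup>+x. indicator B x \<partial>lborel)"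
  proof (rule nn_integral_mono)
    fix x
    show "indicator B (x /\<^sub>R norm x) * indicator (cball 0 1 - {0}) x \<le> (indicator B x :: ennreal)"
      using cone[of x] by (cases "x = 0"; cases "x /\<^sub>R norm x \<in> B") (auto simp: indicator_def)
  qed
  also have "\<dots> = 0" using B by (simp add: null_setsD1)
  finally have "(\<integral>\<^sup>+x. indicator B x \<partial>(sphere_measure::(real^'n) measure)) = (0::ennreal)" by (simp add: mult_left_mono)
  then have "AE x in sphere_measure. indicator B x = (0::ennreal)"
    by (subst (asm) nn_integral_0_iff_AE) (auto intro!: borel_measurable_sphere)
  then show ?thesis by eventually_elim (auto simp: indicator_def split: if_splits)
qed

lemma AE_sphere_not_in_subspace:
  fixes V :: "(real^'n) set"
  assumes V: "subspace V" and dim: "dim V < CARD('n)"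
  shows "AE y in sphere_measure. y \<notin> V"
proof (rule AE_sphere_not_in_null_cone)
  have "negligible V" using dim by (intro negligible_lowdim) simp
  moreover have "V \<in> sets lborel" using closed_subspace[OF V] by simp
  ultimately show "V \<in> null_sets lborel" by (simp add: negligible_iff_null_sets null_sets_completion_iff)
  fix x :: "real^'n" assume "x \<noteq> 0" "x /\<^sub>R norm x \<in> V"
  have "norm x *\<^sub>R (x /\<^sub>R norm x) \<in> V" by (rule subspace_scale[OF V]) fact
  then show "x \<in> V" using \<open>x \<noteq> 0\<close> by simp
qed

text \<open>Equality in Cauchy-Schwarz forces y onto the line through x, a null set in dimension at
  least 3. Outside it the binomial series of the kernel converges.\<close>

lemma AE_sphere_abs_inner_less:
  fixes x :: "real^'n"
  assumes N: "CARD('n) \<ge> 3" and x: "norm x = 1"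
  shows "AE y in sphere_measure. \<bar>x \<bullet> y\<bar> < 1"
proof -
  have "dim (span {x}) \<le> 1" using dim_le_card[of "span {x}" "{x}"] by simp
  then have "AE y in sphere_measure. y \<notin> span {x}"
    using N by (intro AE_sphere_not_in_subspace) (auto intro: le_less_trans)
  moreover have "AE y in (sphere_measure :: (real^'n) measure). norm y = 1" by (rule AE_I2) (simp add: space_sphere_measure)
  ultimately show ?thesis
  proof eventually_elim
    case (elim y)
    have "\<bar>x \<bullet> y\<bar> \<le> 1" using Cauchy_Schwarz_ineq2[of x y] x elim by simp
    moreover have "\<bar>x \<bullet> y\<bar> \<noteq> 1"
    proof
      assume "\<bar>x \<bullet> y\<bar> = 1"
      then have xy: "x \<bullet> y = 1 \<or> x \<bullet> y = -1" by linarith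
      have "x \<bullet> x = 1" "y \<bullet> y = 1" using x elim by (auto simp: norm_eq_1)
      then have "(y - (x \<bullet> y) *\<^sub>R x) \<bullet> (y - (x \<bullet> y) *\<^sub>R x) = 0"
        using xy by (auto simp: inner_diff_left inner_diff_right inner_add_left inner_add_right inner_commute)
      then have "y = (x \<bullet> y) *\<^sub>R x" by simp
      then have "y \<in> span {x}" by (metis span_base span_scale singletonI)
      with elim show False by simp
    qed
    ultimately show ?case by simp
  qed
qed

section \<open>The Funk-Hecke formula for the kernel\<close>

definition gconst :: "'n::finite itself \<Rightarrow> real" where
  "gconst _ = gint (\<lambda>_. 1) (\<lambda>_::real^'n. 1)"

lemma gconst_pos: "gconst TYPE('n::finite) > 0"
  unfolding gconst_def by (subst gint_const) (auto intro!: prod_pos)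

text \<open>The degree-independent factor in the eigenvalues of the unnormalised kernel; dividing by
  it produces the exact inverse of A_sigma.\<close>

definition kconst :: "'n::finite itself \<Rightarrow> real \<Rightarrow> real \<Rightarrow> real" where
  "kconst _ \<beta> \<delta> = gconst TYPE('n) * 2 powr (2 * \<delta> - real CARD('n) / 2) * Gamma (\<delta> - \<beta>) / (sqrt pi * Gamma (2 * \<beta>))"

text \<open>For the \<beta> and \<delta> of the theorem these are the eigenvalues of A_sigma, since
  2\<delta> and 2\<beta> equal (d - 1)/2 + (1 + \<sigma>)/2 and (d - 1)/2 + (1 -
  \<sigma>)/2.\<close>

definition acoef :: "real \<Rightarrow> real \<Rightarrow> nat \<Rightarrow> real" where
  "acoef \<beta> \<delta> n = Gamma (real n + 2 * \<delta>) / Gamma (real n + 2 * \<beta>)"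

context
  fixes \<beta> \<delta> :: real
  assumes bd: "0 < \<beta>" "\<beta> < \<delta>"
begin

lemma kconst_pos: "kconst TYPE('n::finite) \<beta> \<delta> > 0"
  using bd gconst_pos[where ?'n='n] by (simp add: kconst_def)

lemma acoef_pos: "acoef \<beta> \<delta> n > 0"
  unfolding acoef_def using bd by (intro divide_pos_pos Gamma_real_pos) (auto simp: add_nonneg_pos)

text \<open>Termwise integration of the Taylor series of the kernel. Only the powers k = n + 2j
  contribute, and the duplication formula turns their coefficients into a Gauss series at 1. The
  exchange of sum and integral is postponed to \<open>funk_hecke\<close>.\<close>

lemma funk_hecke_series:
  fixes x :: "real^'n"
  assumes sum: "2 * (\<beta> + \<delta>) = real CARD('n) - 1" and x: "norm x = 1" and Y: "Y \<in> sph_harm n"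
  shows "(\<lambda>k. pochhammer (2 * \<beta>) k / fact k * (LINT y|sphere_measure. (x \<bullet> y) ^ k * Y y)) sums
    (kconst TYPE('n) \<beta> \<delta> / acoef \<beta> \<delta> n * Y x)"
proof -
  let ?N = "real CARD('n)" and ?G = "gconst TYPE('n)"
  let ?M = "\<lambda>k. LINT y|sphere_measure. (x \<bullet> y) ^ k * Y y"
  have M: "?M k = (if n \<le> k \<and> even (k - n) then ?G * (fact k / (2 ^ ((k - n) div 2) * fact ((k - n) div 2))) * Y x / rconst ?N (real (k + n)) else 0)" for k
  proof -
    have "rconst ?N (real (k + n)) * ?M k = gint (\<lambda>_. 1) (\<lambda>y. (x \<bullet> y) ^ k * Y y)"
      by (rule gint_one_eq_sphere[symmetric, OF hp_mult[OF hp_inner_power sph_harm_hp[OF Y]]])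
    moreover have "rconst ?N (real (k + n)) > 0" by (rule rconst_CARD_pos)
    moreover have "m = (if P then A / r else 0)" if "r * m = (if P then A else 0)" "r > 0" for r m A :: real and P
      using that by (auto simp: field_simps)
    moreover have "gint (\<lambda>_. 1) (\<lambda>_::real^'n. 1) = ?G" by (simp add: gconst_def)
    ultimately show ?thesis unfolding gint_inner_power_sph_harm[OF x Y] by (simp only:)
  qed
  let ?f = "\<lambda>k. pochhammer (2 * \<beta>) k / fact k * ?M k"
  \<comment> \<open>The Pochhammer symbol at n + 2j is Gamma(2(a + j)) up to a constant, which
    duplication splits into parameters a and a + 1/2. The value c + j comes from the radial constant
    of degree 2n + 2j. Then c - a - (a + 1/2) = \<delta> - \<beta> > 0 is exactly the convergence
    condition.\<close>
  define a where "a = \<beta> + real n / 2"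
  define c where "c = real n + ?N / 2"
  have a: "a > 0" using bd by (simp add: a_def add_pos_nonneg)
  have cab: "c - a - (a + 1/2) = \<delta> - \<beta>" "c - (a + 1/2) = \<delta> + real n / 2" "c - a = \<delta> + real n / 2 + 1/2"
    using sum by (simp_all add: a_def c_def field_simps)
  have G2b: "Gamma (2 * \<beta>) > 0" using bd by simp
  let ?C = "?G * Y x * 2 powr (2 * \<beta> - ?N / 2) / (sqrt pi * Gamma (2 * \<beta>))"
  have t: "?f (n + 2 * j) = ?C * (Gamma (a + real j) * Gamma (a + 1/2 + real j) / (fact j * Gamma (c + real j)))" for j
  proof -
    have m: "?M (n + 2 * j) = ?G * (fact (n + 2 * j) / (2 ^ j * fact j)) * Y x / rconst ?N (real (n + 2 * j + n))"
      unfolding M by simp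
    have p: "pochhammer (2 * \<beta>) (n + 2 * j) = Gamma (2 * (a + real j)) / Gamma (2 * \<beta>)"
      using bd by (subst pochhammer_Gamma_real) (auto simp: a_def algebra_simps)
    have "a + real j > 0" using a by simp
    note dup = Gamma_duplication_real[OF this]
    have d: "Gamma (2 * (a + real j)) = Gamma (a + real j) * Gamma (a + 1/2 + real j) * 2 powr (2 * (a + real j) - 1) / sqrt pi"
    proof -
      have "2 powr (1 - 2 * (a + real j)) * 2 powr (2 * (a + real j) - 1) = (1::real)" by (simp flip: powr_add)
      then have "Gamma (a + real j) * Gamma (a + real j + 1/2) * 2 powr (2 * (a + real j) - 1) = sqrt pi * Gamma (2 * (a + real j))"
        unfolding dup by (simp add: mult_ac)
      then show ?thesis by (simp add: field_simps)
    qed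
    have r: "rconst ?N (real (n + 2 * j + n)) = 2 powr (real n + real j + ?N / 2 - 1) * Gamma (c + real j)"
      unfolding rconst_def c_def by (simp add: add_divide_distrib algebra_simps)
    have pw: "2 powr (2 * (a + real j) - 1) / (2 ^ j * 2 powr (real n + real j + ?N / 2 - 1)) = (2::real) powr (2 * \<beta> - ?N / 2)"
      unfolding powr_realpow[symmetric, of 2 j, simplified] powr_add[symmetric] powr_diff[symmetric]
      by (simp add: a_def algebra_simps)
    have "?f (n + 2 * j) = ?G * Y x / (sqrt pi * Gamma (2 * \<beta>)) * (2 powr (2 * (a + real j) - 1) / (2 ^ j * 2 powr (real n + real j + ?N / 2 - 1)))
       * (Gamma (a + real j) * Gamma (a + 1/2 + real j) / (fact j * Gamma (c + real j)))"
      unfolding m p d r by (simp add: mult_ac)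
    then show ?thesis unfolding pw by simp
  qed
  have "(\<lambda>j. Gamma (a + real j) * Gamma (a + 1/2 + real j) / (fact j * Gamma (c + real j))) sums
     (Gamma a * Gamma (a + 1/2) * Gamma (c - a - (a + 1/2)) / (Gamma (c - a) * Gamma (c - (a + 1/2))))"
    using a cab bd by (intro Gauss_summation) (auto simp: field_simps)
  then have "(\<lambda>j. ?f (n + 2 * j)) sums (?C * (Gamma a * Gamma (a + 1/2) * Gamma (c - a - (a + 1/2)) / (Gamma (c - a) * Gamma (c - (a + 1/2)))))"
    unfolding t by (rule sums_mult)
  moreover have "?C * (Gamma a * Gamma (a + 1/2) * Gamma (c - a - (a + 1/2)) / (Gamma (c - a) * Gamma (c - (a + 1/2)))) = kconst TYPE('n) \<beta> \<delta> / acoef \<beta> \<delta> n * Y x"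
  proof -
    have da: "Gamma a * Gamma (a + 1/2) = 2 powr (1 - 2 * \<beta> - real n) * sqrt pi * Gamma (real n + 2 * \<beta>)"
      using Gamma_duplication_real[OF a] by (simp add: a_def algebra_simps)
    have dn: "\<delta> + real n / 2 > 0" using bd by (simp add: add_pos_nonneg)
    have dd: "Gamma (\<delta> + real n / 2 + 1/2) * Gamma (\<delta> + real n / 2) = 2 powr (1 - 2 * \<delta> - real n) * sqrt pi * Gamma (real n + 2 * \<delta>)"
      using Gamma_duplication_real[OF dn] by (simp add: algebra_simps)
    have pw: "2 powr (2 * \<beta> - ?N / 2) * (2 powr (1 - 2 * \<beta> - real n) / 2 powr (1 - 2 * \<delta> - real n)) = (2::real) powr (2 * \<delta> - ?N / 2)"
      unfolding powr_add[symmetric] powr_diff[symmetric] by (simp add: algebra_simps)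
    have "?C * (Gamma a * Gamma (a + 1/2) * Gamma (\<delta> - \<beta>) / (Gamma (\<delta> + real n / 2 + 1/2) * Gamma (\<delta> + real n / 2))) =
      ?G * Y x / (sqrt pi * Gamma (2 * \<beta>)) * Gamma (\<delta> - \<beta>) * (2 powr (2 * \<beta> - ?N / 2) * (2 powr (1 - 2 * \<beta> - real n) / 2 powr (1 - 2 * \<delta> - real n))) *
        (Gamma (real n + 2 * \<beta>) / Gamma (real n + 2 * \<delta>))"
      unfolding da dd by (simp add: mult_ac)
    then show ?thesis unfolding cab(1) unfolding cab(2,3) pw by (simp add: kconst_def acoef_def mult_ac)
  qed
  ultimately have "(\<lambda>j. ?f (n + 2 * j)) sums (kconst TYPE('n) \<beta> \<delta> / acoef \<beta> \<delta> n * Y x)" by (simp only:)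
  then show ?thesis
  proof (subst (asm) sums_mono_reindex)
    show "strict_mono (\<lambda>j. n + 2 * j)" by (simp add: strict_mono_def)
    fix k assume k: "k \<notin> range (\<lambda>j. n + 2 * j)"
    have "\<not> (n \<le> k \<and> even (k - n))"
    proof
      assume *: "n \<le> k \<and> even (k - n)"
      then obtain j where "k - n = 2 * j" by blast
      then have "k = n + 2 * j" using * by simp
      with k show False by blast
    qed
    then show "?f k = 0" unfolding M by (simp only: if_False mult_zero_right)
  qed
qed

text \<open>The even part of the kernel dominates the function with the absolute value, and its
  Taylor series has nonnegative terms only. Hence the series may be integrated termwise, and its sum
  is finite by the degree-0 case of \<open>funk_hecke_series\<close>.\<close>

lemma kernel_abs_integrable:
  fixes x :: "real^'n"
  assumes sum: "2 * (\<beta> + \<delta>) = real CARD('n) - 1" and N: "CARD('n) \<ge> 3" and x: "norm x = 1"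
  shows "integrable sphere_measure (\<lambda>y. (1 - \<bar>x \<bullet> y\<bar>) powr (- 2 * \<beta>))"
proof (rule integrableI_bounded)
  let ?S = "sphere_measure :: (real^'n) measure"
  let ?c = "\<lambda>k. pochhammer (2 * \<beta>) k / fact k"
  have c0: "?c k \<ge> 0" for k using bd by (simp add: pochhammer_nonneg)
  show "(\<lambda>y. (1 - \<bar>x \<bullet> y\<bar>) powr (- 2 * \<beta>)) \<in> borel_measurable ?S" by (rule borel_measurable_sphere) measurable
  let ?f = "\<lambda>j y. 2 * (?c (2 * j) * (x \<bullet> y) ^ (2 * j))"
  have ev: "(\<lambda>j. ?f j y) sums ((1 - x \<bullet> y) powr (- (2 * \<beta>)) + (1 + x \<bullet> y) powr (- (2 * \<beta>)))" if "\<bar>x \<bullet> y\<bar> < 1" for y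
  proof -
    have "(\<lambda>k. ?c k * (x \<bullet> y) ^ k + ?c k * (- (x \<bullet> y)) ^ k) sums ((1 - x \<bullet> y) powr (- (2 * \<beta>)) + (1 - - (x \<bullet> y)) powr (- (2 * \<beta>)))"
      using that by (intro sums_add sums_one_minus_powr) auto
    then have "(\<lambda>j. ?c (2 * j) * (x \<bullet> y) ^ (2 * j) + ?c (2 * j) * (- (x \<bullet> y)) ^ (2 * j)) sums ((1 - x \<bullet> y) powr (- (2 * \<beta>)) + (1 - - (x \<bullet> y)) powr (- (2 * \<beta>)))"
    proof (subst sums_mono_reindex[where g="\<lambda>j. 2 * j" and f="\<lambda>k. ?c k * (x \<bullet> y) ^ k + ?c k * (- (x \<bullet> y)) ^ k"])
      show "strict_mono (\<lambda>j::nat. 2 * j)" by (simp add: strict_mono_def)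
      fix k :: nat assume "k \<notin> range (\<lambda>j. 2 * j)"
      then have "odd k" by auto
      then show "?c k * (x \<bullet> y) ^ k + ?c k * (- (x \<bullet> y)) ^ k = 0" by simp
    qed
    then show ?thesis by (simp add: mult_ac)
  qed
  have f0: "?f j y \<ge> 0" for j y by (intro mult_nonneg_nonneg c0 zero_le_even_power) auto
  have "(\<integral>\<^sup>+y. ennreal (norm ((1 - \<bar>x \<bullet> y\<bar>) powr (- 2 * \<beta>))) \<partial>?S) \<le> (\<integral>\<^sup>+y. (\<Sum>j. ennreal (?f j y)) \<partial>?S)"
  proof (rule nn_integral_mono_AE)
    show "AE y in ?S. ennreal (norm ((1 - \<bar>x \<bullet> y\<bar>) powr (- 2 * \<beta>))) \<le> (\<Sum>j. ennreal (?f j y))"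
      using AE_sphere_abs_inner_less[OF N x]
    proof eventually_elim
      case (elim y)
      have "(1 - \<bar>x \<bullet> y\<bar>) powr (- 2 * \<beta>) \<le> (1 - x \<bullet> y) powr (- (2 * \<beta>)) + (1 + x \<bullet> y) powr (- (2 * \<beta>))"
        by (cases "x \<bullet> y \<ge> 0") auto
      moreover have "(\<Sum>j. ennreal (?f j y)) = ennreal ((1 - x \<bullet> y) powr (- (2 * \<beta>)) + (1 + x \<bullet> y) powr (- (2 * \<beta>)))"
        using ev[OF elim] f0 by (intro sums_unique[symmetric]) (subst sums_ennreal, auto)
      ultimately show ?case by (simp add: ennreal_leI del: ennreal_plus)
    qed
  qed
  also have "\<dots> = (\<Sum>j. \<integral>\<^sup>+y. ennreal (?f j y) \<partial>?S)"
    by (rule nn_integral_suminf, rule borel_measurable_sphere) measurable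
  also have "\<dots> = (\<Sum>j. ennreal (2 * (?c (2 * j) * (LINT y|?S. (x \<bullet> y) ^ (2 * j) * 1))))"
  proof (rule arg_cong[where f=suminf], rule ext)
    fix j
    have i: "integrable ?S (\<lambda>y. (x \<bullet> y) ^ (2 * j))" by (rule hp_integrable_sphere[OF hp_inner_power])
    have "(\<integral>\<^sup>+y. ennreal (?f j y) \<partial>?S) = ennreal (LINT y|?S. ?f j y)"
      using i f0 by (intro nn_integral_eq_integral) auto
    then show "(\<integral>\<^sup>+y. ennreal (?f j y) \<partial>?S) = ennreal (2 * (?c (2 * j) * (LINT y|?S. (x \<bullet> y) ^ (2 * j) * 1)))" by simp
  qed
  also have "\<dots> < \<infinity>"
  proof -
    have "summable (\<lambda>k. ?c k * (LINT y|?S. (x \<bullet> y) ^ k * 1))"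
      using funk_hecke_series[OF sum x sph_harm_const[of 1]] by (rule sums_summable)
    then have "summable (\<lambda>j. ?c (2 * j) * (LINT y|?S. (x \<bullet> y) ^ (2 * j) * 1))"
    proof (subst summable_mono_reindex[where g="\<lambda>j. 2 * j" and f="\<lambda>k. ?c k * (LINT y|?S. (x \<bullet> y) ^ k * 1)"])
      show "strict_mono (\<lambda>j::nat. 2 * j)" by (simp add: strict_mono_def)
      fix k :: nat assume "k \<notin> range (\<lambda>j. 2 * j)"
      then have "odd k" by auto
      then have "gint (\<lambda>_. 1) (\<lambda>y. (x \<bullet> y) ^ k * 1) = 0"
        using gint_inner_power_sph_harm[OF x sph_harm_const[of 1], of k] by simp
      moreover have "gint (\<lambda>_. 1) (\<lambda>y. (x \<bullet> y) ^ k * 1) = rconst (real CARD('n)) (real k) * (LINT y|?S. (x \<bullet> y) ^ k * 1)"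
        using gint_one_eq_sphere[OF hp_inner_power[of k x]] by simp
      ultimately show "?c k * (LINT y|?S. (x \<bullet> y) ^ k * 1) = 0" using rconst_CARD_pos[where ?'n='n, of k] by simp
    qed
    then have "summable (\<lambda>j. 2 * (?c (2 * j) * (LINT y|?S. (x \<bullet> y) ^ (2 * j) * 1)))" by (rule summable_mult)
    moreover have "0 \<le> 2 * (?c (2 * j) * (LINT y|?S. (x \<bullet> y) ^ (2 * j) * 1))" for j
      using c0 by (intro mult_nonneg_nonneg Bochner_Integration.integral_nonneg) (auto simp: zero_le_even_power)
    ultimately have "(\<Sum>j. ennreal (2 * (?c (2 * j) * (LINT y|?S. (x \<bullet> y) ^ (2 * j) * 1)))) = ennreal (\<Sum>j. 2 * (?c (2 * j) * (LINT y|?S. (x \<bullet> y) ^ (2 * j) * 1)))"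
      by (intro suminf_ennreal2)
    then show ?thesis by (simp only: ennreal_less_top infinity_ennreal_def)
  qed
  finally show "(\<integral>\<^sup>+y. ennreal (norm ((1 - \<bar>x \<bullet> y\<bar>) powr (- 2 * \<beta>))) \<partial>?S) < \<infinity>" .
qed

text \<open>Because the Taylor coefficients are nonnegative, every partial sum is bounded by the
  kernel at \<open>\<bar>x \<bullet> y\<bar>\<close> times a bound for Y, and this majorant has just
  been shown integrable.\<close>

lemma funk_hecke:
  fixes x :: "real^'n"
  assumes sum: "2 * (\<beta> + \<delta>) = real CARD('n) - 1" and N: "CARD('n) \<ge> 3" and x: "norm x = 1" and Y: "Y \<in> sph_harm n"
  shows "integrable sphere_measure (\<lambda>y. (1 - x \<bullet> y) powr (- 2 * \<beta>) * Y y)"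
    and "(LINT y|sphere_measure. (1 - x \<bullet> y) powr (- 2 * \<beta>) * Y y) = kconst TYPE('n) \<beta> \<delta> / acoef \<beta> \<delta> n * Y x"
proof -
  let ?S = "sphere_measure :: (real^'n) measure"
  let ?c = "\<lambda>k. pochhammer (2 * \<beta>) k / fact k"
  have c0: "?c k \<ge> 0" for k using bd by (simp add: pochhammer_nonneg)
  obtain B where B: "\<And>y. y \<in> sphere 0 1 \<Longrightarrow> \<bar>Y y\<bar> \<le> B"
    using continuous_bounded_on_sphere[OF hp_continuous[OF sph_harm_hp[OF Y]]] by blast
  have AE1: "AE y in ?S. \<bar>x \<bullet> y\<bar> < 1" by (rule AE_sphere_abs_inner_less[OF N x])
  have AEB: "AE y in ?S. \<bar>Y y\<bar> \<le> B" by (rule AE_I2) (use B in \<open>simp add: space_sphere_measure\<close>)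
  have Ym: "Y \<in> borel_measurable borel" using sph_harm_hp[OF Y] by (rule hp_measurable)
  let ?s = "\<lambda>m y. \<Sum>k<m. ?c k * ((x \<bullet> y) ^ k * Y y)"
  have iw: "integrable ?S (\<lambda>y. B * (1 - \<bar>x \<bullet> y\<bar>) powr (- 2 * \<beta>))"
    using kernel_abs_integrable[OF sum N x] by simp
  have mw: "(\<lambda>y. (1 - x \<bullet> y) powr (- 2 * \<beta>) * Y y) \<in> borel_measurable ?S"
    using Ym by (intro borel_measurable_sphere) measurable
  have ms: "?s m \<in> borel_measurable ?S" for m using Ym by (intro borel_measurable_sphere) measurable
  have conv: "AE y in ?S. (\<lambda>m. ?s m y) \<longlonglongrightarrow> (1 - x \<bullet> y) powr (- 2 * \<beta>) * Y y"
    using AE1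
  proof eventually_elim
    case (elim y)
    have "(\<lambda>k. ?c k * (x \<bullet> y) ^ k * Y y) sums ((1 - x \<bullet> y) powr (- (2 * \<beta>)) * Y y)"
      by (intro sums_mult2 sums_one_minus_powr elim)
    then show ?case unfolding sums_def by (simp add: mult.assoc)
  qed
  have bound: "AE y in ?S. norm (?s m y) \<le> B * (1 - \<bar>x \<bullet> y\<bar>) powr (- 2 * \<beta>)" for m
    using AE1 AEB
  proof eventually_elim
    case (elim y)
    have s: "(\<lambda>k. ?c k * \<bar>x \<bullet> y\<bar> ^ k) sums (1 - \<bar>x \<bullet> y\<bar>) powr (- (2 * \<beta>))"
      using elim by (intro sums_one_minus_powr) auto
    have "norm (?s m y) \<le> (\<Sum>k<m. norm (?c k * ((x \<bullet> y) ^ k * Y y)))" by (rule norm_sum)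
    also have "\<dots> \<le> (\<Sum>k<m. ?c k * \<bar>x \<bullet> y\<bar> ^ k * B)"
    proof (rule sum_mono)
      fix k
      have "norm (?c k * ((x \<bullet> y) ^ k * Y y)) = ?c k * \<bar>x \<bullet> y\<bar> ^ k * \<bar>Y y\<bar>"
        by (simp only: real_norm_def abs_mult power_abs abs_of_nonneg[OF c0] mult.assoc)
      also have "\<dots> \<le> ?c k * \<bar>x \<bullet> y\<bar> ^ k * B" by (intro mult_left_mono mult_nonneg_nonneg c0) (use elim in auto)
      finally show "norm (?c k * ((x \<bullet> y) ^ k * Y y)) \<le> ?c k * \<bar>x \<bullet> y\<bar> ^ k * B" .
    qed
    also have "\<dots> = (\<Sum>k<m. ?c k * \<bar>x \<bullet> y\<bar> ^ k) * B" by (simp add: sum_distrib_right)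
    also have "(\<Sum>k<m. ?c k * \<bar>x \<bullet> y\<bar> ^ k) \<le> (1 - \<bar>x \<bullet> y\<bar>) powr (- (2 * \<beta>))"
      unfolding sums_unique[OF s] by (intro sum_le_suminf sums_summable[OF s] mult_nonneg_nonneg c0) auto
    finally show ?case using elim by (simp add: mult.commute mult_right_mono)
  qed
  show "integrable ?S (\<lambda>y. (1 - x \<bullet> y) powr (- 2 * \<beta>) * Y y)"
    by (rule integrable_dominated_convergence[OF mw ms iw conv bound])
  have "(\<lambda>m. LINT y|?S. ?s m y) \<longlonglongrightarrow> (LINT y|?S. (1 - x \<bullet> y) powr (- 2 * \<beta>) * Y y)"
    by (rule integral_dominated_convergence[OF mw ms iw conv bound])
  moreover have "(LINT y|?S. ?s m y) = (\<Sum>k<m. ?c k * (LINT y|?S. (x \<bullet> y) ^ k * Y y))" for m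
    using hp_integrable_sphere[OF hp_mult[OF hp_inner_power sph_harm_hp[OF Y]]]
    by (subst Bochner_Integration.integral_sum) auto
  ultimately have "(\<lambda>k. ?c k * (LINT y|?S. (x \<bullet> y) ^ k * Y y)) sums (LINT y|?S. (1 - x \<bullet> y) powr (- 2 * \<beta>) * Y y)"
    by (simp add: sums_def)
  with funk_hecke_series[OF sum x Y] show "(LINT y|?S. (1 - x \<bullet> y) powr (- 2 * \<beta>) * Y y) = kconst TYPE('n) \<beta> \<delta> / acoef \<beta> \<delta> n * Y x"
    by (rule sums_unique2[symmetric])
qed

end

subsection \<open>The ground state\<close>

text \<open>The squared distance to the coordinate axis through the poles; on the unit sphere it
  equals 1 - t^2. It is defined on the whole space so that its powers are homogeneous there.\<close>

definition perp :: "'n \<Rightarrow> real^'n \<Rightarrow> real" where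
  "perp i y = (\<Sum>j\<in>UNIV - {i}. (y $ j)\<^sup>2)"

lemma perp_nonneg: "perp i y \<ge> 0"
  by (simp add: perp_def sum_nonneg)

lemma perp_measurable [measurable]: "perp i \<in> borel_measurable borel"
  unfolding perp_def[abs_def] by measurable

lemma perp_scale: "perp i (c *\<^sub>R y) = c\<^sup>2 * perp i y"
  by (simp add: perp_def power_mult_distrib sum_distrib_left)

lemma norm_sq_perp: "(norm y)\<^sup>2 = (y $ i)\<^sup>2 + perp i y"
  by (simp only: power2_norm_eq_inner) (simp add: inner_vec_def perp_def power2_eq_square sum.remove[of UNIV i])

lemma perp_eq_0_imp: "perp i y = 0 \<Longrightarrow> y \<in> span {axis i 1}"
proof -
  assume "perp i y = 0"
  then have "\<forall>j\<in>UNIV - {i}. (y $ j)\<^sup>2 = 0" unfolding perp_def by (subst (asm) sum_nonneg_eq_0_iff) auto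
  then have "y = (y $ i) *\<^sub>R axis i 1" by (auto simp: vec_eq_iff axis_def)
  then show ?thesis by (metis span_base span_scale singletonI)
qed

lemma dim_span_axis: "dim (span {axis i (1::real)} :: (real^'n) set) \<le> 1"
  using dim_le_card[of "span {axis i (1::real)}" "{axis i 1}"] by simp

lemma AE_sphere_perp_pos:
  assumes "CARD('n) \<ge> 3"
  shows "AE y in (sphere_measure :: (real^'n) measure). perp i y > 0"
proof -
  have "AE y in (sphere_measure :: (real^'n) measure). y \<notin> span {axis i 1}"
    using assms dim_span_axis[where i=i] by (intro AE_sphere_not_in_subspace) (auto intro: le_less_trans)
  then show ?thesis by eventually_elim (use perp_eq_0_imp perp_nonneg in \<open>metis less_eq_real_def\<close>)
qed

lemma AE_lborel_perp_pos:
  assumes "CARD('n) \<ge> 3"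
  shows "AE y in (lborel :: (real^'n) measure). perp i y > 0"
proof -
  let ?V = "span {axis i 1} :: (real^'n) set"
  have "negligible ?V" using assms dim_span_axis[where i=i] by (intro negligible_lowdim) (auto intro: le_less_trans)
  moreover have "?V \<in> sets lborel" using closed_subspace[of ?V] by simp
  ultimately have "?V \<in> null_sets lborel" by (simp add: negligible_iff_null_sets null_sets_completion_iff)
  then have "AE y in lborel. y \<notin> ?V" by (rule AE_not_in)
  then show ?thesis by eventually_elim (use perp_eq_0_imp perp_nonneg in \<open>metis less_eq_real_def\<close>)
qed

text \<open>The power of 1 + 2t is written as a Gamma integral in a second variable; after Tonelli
  both integrations are Gamma integrals.\<close>

lemma nn_integral_Beta_prime:
  fixes z p :: real
  assumes z: "0 < z" and p: "z < p"
  shows "(\<integral>\<^sup>+t. ennreal (t powr (z - 1) * (1 + 2 * t) powr (- p)) * indicator {0..} t \<partial>lborel) =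
    ennreal (2 powr (- z) * Gamma z * Gamma (p - z) / Gamma p)"
proof -
  have Gp: "Gamma p > 0" "Gamma z > 0" "Gamma (p - z) > 0" using z p by auto
  have inner: "ennreal (Gamma p * (1 + 2 * t) powr (- p)) =
     (\<integral>\<^sup>+u. ennreal (u powr (p - 1) * exp (- (1 + 2 * t) * u)) * indicator {0..} u \<partial>lborel)" if "t \<ge> 0" for t
    using that z p by (subst nn_integral_Gamma_scaled) (auto simp: powr_minus_divide)
  have "(\<integral>\<^sup>+t. ennreal (t powr (z - 1) * (1 + 2 * t) powr (- p)) * indicator {0..} t \<partial>lborel) * ennreal (Gamma p) =
    (\<integral>\<^sup>+t. ennreal (t powr (z - 1)) * ennreal (Gamma p * (1 + 2 * t) powr (- p)) * indicator {0..} t \<partial>lborel)"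
    using Gp by (subst nn_integral_multc[symmetric]) (auto intro!: nn_integral_cong simp: indicator_def mult_ac simp flip: ennreal_mult)
  also have "\<dots> = (\<integral>\<^sup>+t. (\<integral>\<^sup>+u. ennreal (t powr (z - 1) * exp (- (2 * u) * t)) * indicator {0..} t * (ennreal (u powr (p - 1) * exp (- u)) * indicator {0..} u) \<partial>lborel) \<partial>lborel)"
  proof (rule nn_integral_cong)
    fix t :: real
    show "ennreal (t powr (z - 1)) * ennreal (Gamma p * (1 + 2 * t) powr (- p)) * indicator {0..} t =
      (\<integral>\<^sup>+u. ennreal (t powr (z - 1) * exp (- (2 * u) * t)) * indicator {0..} t * (ennreal (u powr (p - 1) * exp (- u)) * indicator {0..} u) \<partial>lborel)"
    proof (cases "t \<ge> 0")
      case True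
      have "ennreal (t powr (z - 1)) * ennreal (Gamma p * (1 + 2 * t) powr (- p)) =
        (\<integral>\<^sup>+u. ennreal (t powr (z - 1)) * (ennreal (u powr (p - 1) * exp (- (1 + 2 * t) * u)) * indicator {0..} u) \<partial>lborel)"
        unfolding inner[OF True] by (rule nn_integral_cmult[symmetric]) measurable
      also have "\<dots> = (\<integral>\<^sup>+u. ennreal (t powr (z - 1) * exp (- (2 * u) * t)) * indicator {0..} t * (ennreal (u powr (p - 1) * exp (- u)) * indicator {0..} u) \<partial>lborel)"
      proof (rule nn_integral_cong)
        fix u :: real
        have "exp (- (1 + 2 * t) * u) = exp (- (2 * u) * t) * exp (- u)" by (simp add: algebra_simps flip: exp_add)
        then show "ennreal (t powr (z - 1)) * (ennreal (u powr (p - 1) * exp (- (1 + 2 * t) * u)) * indicator {0..} u) =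
          ennreal (t powr (z - 1) * exp (- (2 * u) * t)) * indicator {0..} t * (ennreal (u powr (p - 1) * exp (- u)) * indicator {0..} u)"
          using True by (simp add: indicator_def mult_ac flip: ennreal_mult)
      qed
      finally show ?thesis using True by simp
    qed simp
  qed
  also have "\<dots> = (\<integral>\<^sup>+u. (\<integral>\<^sup>+t. ennreal (t powr (z - 1) * exp (- (2 * u) * t)) * indicator {0..} t * (ennreal (u powr (p - 1) * exp (- u)) * indicator {0..} u) \<partial>lborel) \<partial>lborel)"
    by (rule lborel_pair.Fubini') measurable
  also have "\<dots> = (\<integral>\<^sup>+u. ennreal (Gamma z * 2 powr (- z)) * (ennreal (u powr (p - z - 1) * exp (- 1 * u)) * indicator {0..} u) \<partial>lborel)"
  proof (rule nn_integral_cong_AE)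
    show "AE u in lborel. (\<integral>\<^sup>+t. ennreal (t powr (z - 1) * exp (- (2 * u) * t)) * indicator {0..} t * (ennreal (u powr (p - 1) * exp (- u)) * indicator {0..} u) \<partial>lborel) =
      ennreal (Gamma z * 2 powr (- z)) * (ennreal (u powr (p - z - 1) * exp (- 1 * u)) * indicator {0..} u)"
      using AE_lborel_singleton[of "0::real"]
    proof eventually_elim
      case (elim u)
      show ?case
      proof (cases "u > 0")
        case True
        have "(\<integral>\<^sup>+t. ennreal (t powr (z - 1) * exp (- (2 * u) * t)) * indicator {0..} t * (ennreal (u powr (p - 1) * exp (- u)) * indicator {0..} u) \<partial>lborel) =
          ennreal (Gamma z / (2 * u) powr z) * (ennreal (u powr (p - 1) * exp (- u)) * indicator {0..} u)"
          using True z by (subst nn_integral_multc) (simp, subst nn_integral_Gamma_scaled, auto)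
        also have "\<dots> = ennreal (Gamma z / (2 * u) powr z * (u powr (p - 1) * exp (- u)))"
          using True Gp by (simp flip: ennreal_mult)
        also have "Gamma z / (2 * u) powr z * (u powr (p - 1) * exp (- u)) = Gamma z * 2 powr (- z) * (u powr (p - z - 1) * exp (- 1 * u))"
        proof -
          have "u powr (p - z - 1) = u powr (p - 1) / u powr z" by (simp add: powr_diff[symmetric] algebra_simps)
          moreover have "(2 * u) powr z = 2 powr z * u powr z" by (rule powr_mult)
          ultimately show ?thesis by (simp add: powr_minus_divide mult_ac)
        qed
        finally show ?thesis using True Gp by (simp flip: ennreal_mult)
      next
        case False
        then show ?thesis using elim by simp
      qed
    qed
  qed
  also have "\<dots> = ennreal (Gamma z * 2 powr (- z) * Gamma (p - z))"
    using p z Gp by (subst nn_integral_cmult) (simp, subst nn_integral_Gamma_scaled, auto simp: mult_ac simp flip: ennreal_mult)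
  finally have eq: "(\<integral>\<^sup>+t. ennreal (t powr (z - 1) * (1 + 2 * t) powr (- p)) * indicator {0..} t \<partial>lborel) * ennreal (Gamma p) =
    ennreal (Gamma z * 2 powr (- z) * Gamma (p - z))" .
  have "x * ennreal g = ennreal c \<Longrightarrow> g > 0 \<Longrightarrow> c \<ge> 0 \<Longrightarrow> x = ennreal (c / g)" for x g c
    by (metis divide_ennreal ennreal_mult_divide_eq ennreal_neq_top ennreal_eq_0_iff linorder_not_le less_imp_le)
  from this[OF eq Gp(1)] Gp show ?thesis by (simp add: mult_ac)
qed

text \<open>The factor \<open>exp (- t * perp i y)\<close> shrinks the variance in every direction
  but i from 1 to 1/(1 + 2t). This is what makes the axial Gaussian integrals of harmonics
  applicable to powers of \<open>perp\<close>.\<close>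

lemma gw_axial:
  assumes "t \<ge> 0"
  shows "gw (\<lambda>_. 1) y * exp (- t * perp i y) = gw (\<lambda>j. if j = i then 1 else 1 / (1 + 2 * t)) y"
proof -
  have "(\<Sum>j\<in>UNIV. (y $ j)\<^sup>2 / (2 * (if j = i then 1 else 1 / (1 + 2 * t)))) =
    (y $ i)\<^sup>2 / 2 + (\<Sum>j\<in>UNIV - {i}. (y $ j)\<^sup>2 / (2 * (if j = i then 1 else 1 / (1 + 2 * t))))"
    by (simp add: sum.remove[of UNIV i])
  also have "(\<Sum>j\<in>UNIV - {i}. (y $ j)\<^sup>2 / (2 * (if j = i then 1 else 1 / (1 + 2 * t)))) = (\<Sum>j\<in>UNIV - {i}. (y $ j)\<^sup>2 / 2 + t * (y $ j)\<^sup>2)"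
    by (intro sum.cong) (auto simp: field_simps)
  also have "\<dots> = (\<Sum>j\<in>UNIV - {i}. (y $ j)\<^sup>2 / 2) + t * perp i y"
    by (simp add: sum.distrib perp_def sum_distrib_left)
  also have "(y $ i)\<^sup>2 / 2 + \<dots> = (\<Sum>j\<in>UNIV. (y $ j)\<^sup>2 / 2) + t * perp i y"
    by (simp add: sum.remove[of UNIV i])
  finally show ?thesis by (simp add: gw_def exp_add[symmetric])
qed

lemma prod_axial:
  fixes i :: "'n::finite"
  assumes "s > 0"
  shows "(\<Prod>j\<in>UNIV. sqrt (2 * pi * (if j = i then 1 else s))) = gconst TYPE('n) * s powr ((real CARD('n) - 1) / 2)"
proof -
  have g: "gconst TYPE('n) = (\<Prod>j\<in>(UNIV::'n set). sqrt (2 * pi))" unfolding gconst_def by (subst gint_const) auto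
  have "(\<Prod>j\<in>UNIV. sqrt (2 * pi * (if j = i then 1 else s))) = (\<Prod>j\<in>UNIV. sqrt (2 * pi) * (if j = i then 1 else sqrt s))"
    by (intro prod.cong) (auto simp: real_sqrt_mult)
  also have "\<dots> = gconst TYPE('n) * (\<Prod>j\<in>UNIV. if j = i then 1 else sqrt s)" by (simp add: prod.distrib g)
  also have "(\<Prod>j\<in>UNIV. if j = i then 1 else sqrt s) = (\<Prod>j\<in>UNIV - {i}. sqrt s)"
    by (subst prod.remove[of UNIV i]) (auto intro!: prod.cong)
  also have "\<dots> = sqrt s ^ (CARD('n) - 1)" by (simp add: card_Diff_singleton)
  also have "\<dots> = s powr ((real CARD('n) - 1) / 2)"
    using assms by (simp add: powr_half_sqrt[symmetric] powr_powr of_nat_diff flip: powr_realpow)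
  finally show ?thesis .
qed

lemma integral_Gamma_scaled:
  assumes "z > 0" "c > (0::real)"
  shows "(LINT t|lborel. indicator {0..} t * (t powr (z - 1) * exp (- c * t))) = Gamma z / c powr z"
proof -
  have "(LINT t|lborel. indicator {0..} t * (t powr (z - 1) * exp (- c * t))) =
     enn2real (\<integral>\<^sup>+t. ennreal (indicator {0..} t * (t powr (z - 1) * exp (- c * t))) \<partial>lborel)"
    by (rule integral_eq_nn_integral) auto
  also have "(\<integral>\<^sup>+t. ennreal (indicator {0..} t * (t powr (z - 1) * exp (- c * t))) \<partial>lborel) =
    (\<integral>\<^sup>+t. ennreal (t powr (z - 1) * exp (- c * t)) * indicator {0..} t \<partial>lborel)"
    by (intro nn_integral_cong) (auto simp: indicator_def)
  also have "\<dots> = ennreal (Gamma z / c powr z)" by (rule nn_integral_Gamma_scaled[OF assms])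
  finally show ?thesis using assms by (simp add: less_imp_le)
qed

context
  fixes i :: "'n::finite" and \<gamma> :: real
  assumes N: "CARD('n) \<ge> 3" and \<gamma>: "0 < \<gamma>" "\<gamma> < (real CARD('n) - 1) / 2"
begin

lemma perp_powr_homogeneous:
  fixes p :: "real^'n \<Rightarrow> real"
  assumes "hp n p" "x \<noteq> 0"
  shows "perp i x powr (- \<gamma>) * p x = norm x powr (real n - 2 * \<gamma>) * (perp i (x /\<^sub>R norm x) powr (- \<gamma>) * p (x /\<^sub>R norm x))"
proof -
  have x: "x = norm x *\<^sub>R (x /\<^sub>R norm x)" using assms by simp
  have "perp i x = (norm x)\<^sup>2 * perp i (x /\<^sub>R norm x)" by (subst x) (rule perp_scale)
  then have "perp i x powr (- \<gamma>) = ((norm x)\<^sup>2) powr (- \<gamma>) * perp i (x /\<^sub>R norm x) powr (- \<gamma>)"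
    by (simp add: powr_mult)
  also have "((norm x)\<^sup>2) powr (- \<gamma>) = norm x powr (- 2 * \<gamma>)" using powr_powr[of "norm x" 2 "- \<gamma>"] assms(2) by simp
  finally have 1: "perp i x powr (- \<gamma>) = norm x powr (- 2 * \<gamma>) * perp i (x /\<^sub>R norm x) powr (- \<gamma>)" .
  have "norm x powr (real n - 2 * \<gamma>) = norm x powr real n * norm x powr (- 2 * \<gamma>)" by (simp flip: powr_add)
  then show ?thesis unfolding 1 hp_polar[OF assms, THEN trans, OF refl] by (simp add: mult_ac)
qed

lemma degree_bound: "real n - 2 * \<gamma> + real CARD('n) > 0"
  using \<gamma> by (simp add: field_simps)

text \<open>The negative power of \<open>perp\<close> is a mixture of exponentials; integrating in
  space first leaves a Beta integral in t. It converges because 2\<gamma> stays below the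
  codimension N - 1 of the axis.\<close>

lemma nn_integral_perp_gauss_finite:
  "(\<integral>\<^sup>+y. ennreal (perp i y powr (- \<gamma>) * gw (\<lambda>_. 1) y) \<partial>(lborel::(real^'n) measure)) < \<infinity>"
proof -
  let ?d = "(real CARD('n) - 1) / 2"
  have Gg: "Gamma \<gamma> > 0" using \<gamma> by simp
  have "ennreal (Gamma \<gamma>) * (\<integral>\<^sup>+y. ennreal (perp i y powr (- \<gamma>) * gw (\<lambda>_. 1) y) \<partial>(lborel::(real^'n) measure)) =
    (\<integral>\<^sup>+y. ennreal (Gamma \<gamma> / perp i y powr \<gamma>) * ennreal (gw (\<lambda>_. 1) y) \<partial>lborel)"
    using Gg by (subst nn_integral_cmult[symmetric]) (auto intro!: nn_integral_cong simp: powr_minus_divide gw_def simp flip: ennreal_mult)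
  also have "\<dots> = (\<integral>\<^sup>+y. (\<integral>\<^sup>+t. ennreal (t powr (\<gamma> - 1) * exp (- perp i y * t)) * indicator {0..} t * ennreal (gw (\<lambda>_. 1) y) \<partial>lborel) \<partial>lborel)"
  proof (rule nn_integral_cong_AE)
    show "AE y in lborel. ennreal (Gamma \<gamma> / perp i y powr \<gamma>) * ennreal (gw (\<lambda>_. 1) y) =
      (\<integral>\<^sup>+t. ennreal (t powr (\<gamma> - 1) * exp (- perp i y * t)) * indicator {0..} t * ennreal (gw (\<lambda>_. 1) y) \<partial>lborel)"
      using AE_lborel_perp_pos[OF N, of i]
      by eventually_elim (subst nn_integral_multc, simp, subst nn_integral_Gamma_scaled, use \<gamma> in auto)
  qed
  also have "\<dots> = (\<integral>\<^sup>+t. (\<integral>\<^sup>+y. ennreal (t powr (\<gamma> - 1) * exp (- perp i y * t)) * indicator {0..} t * ennreal (gw (\<lambda>_. 1) y) \<partial>lborel) \<partial>lborel)"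
    by (rule lborel_pair.Fubini') measurable
  also have "\<dots> = (\<integral>\<^sup>+t. ennreal (gconst TYPE('n)) * (ennreal (t powr (\<gamma> - 1) * (1 + 2 * t) powr (- ?d)) * indicator {0..} t) \<partial>lborel)"
  proof (rule nn_integral_cong)
    fix t :: real
    show "(\<integral>\<^sup>+y. ennreal (t powr (\<gamma> - 1) * exp (- perp i y * t)) * indicator {0..} t * ennreal (gw (\<lambda>_. 1) y) \<partial>(lborel::(real^'n) measure)) =
      ennreal (gconst TYPE('n)) * (ennreal (t powr (\<gamma> - 1) * (1 + 2 * t) powr (- ?d)) * indicator {0..} t)"
    proof (cases "t \<ge> 0")
      case True
      let ?v = "\<lambda>j. if j = i then 1 else 1 / (1 + 2 * t)"
      have v: "\<And>j. ?v j > 0" using True by simp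
      have "(\<integral>\<^sup>+y. ennreal (t powr (\<gamma> - 1) * exp (- perp i y * t)) * indicator {0..} t * ennreal (gw (\<lambda>_. 1) y) \<partial>(lborel::(real^'n) measure)) =
        (\<integral>\<^sup>+y. ennreal (t powr (\<gamma> - 1)) * ennreal (1 * gw ?v y) \<partial>lborel)"
        using True by (intro nn_integral_cong)
          (simp add: gw_axial[OF True, symmetric] mult_ac gw_def[of "\<lambda>_. 1"] flip: ennreal_mult)
      also have "\<dots> = ennreal (t powr (\<gamma> - 1)) * ennreal (gint ?v (\<lambda>_. 1))"
        unfolding gint_def using hp_integrable_gw[of ?v, OF v hp_const[of 1]]
        by (subst nn_integral_cmult) (simp, subst nn_integral_eq_integral, auto simp: gw_def)
      also have "gint ?v (\<lambda>_. 1) = gconst TYPE('n) * (1 / (1 + 2 * t)) powr ?d"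
        using True by (subst gint_const[OF v]) (simp add: prod_axial)
      also have "(1 / (1 + 2 * t)) powr ?d = (1 + 2 * t) powr (- ?d)"
        using True by (simp add: powr_divide powr_minus_divide)
      finally show ?thesis using True gconst_pos[where ?'n='n] by (simp add: mult_ac flip: ennreal_mult)
    qed simp
  qed
  also have "\<dots> = ennreal (gconst TYPE('n)) * ennreal (2 powr (- \<gamma>) * Gamma \<gamma> * Gamma (?d - \<gamma>) / Gamma ?d)"
    using \<gamma> by (subst nn_integral_cmult) (simp, subst nn_integral_Beta_prime, auto)
  also have "\<dots> < \<infinity>" by (simp add: ennreal_mult_less_top)
  finally show ?thesis using Gg by (auto simp: ennreal_mult_less_top)
qed

lemma nn_integral_perp_sphere_finite:
  "(\<integral>\<^sup>+y. ennreal (perp i y powr (- \<gamma>)) \<partial>(sphere_measure::(real^'n) measure)) < \<infinity>"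
proof -
  have "(\<integral>\<^sup>+y. ennreal (perp i y powr (- \<gamma>) * gw (\<lambda>_. 1) y) \<partial>(lborel::(real^'n) measure)) =
    ennreal (rconst (real CARD('n)) (real 0 - 2 * \<gamma>)) * (\<integral>\<^sup>+y. ennreal (perp i y powr (- \<gamma>)) \<partial>(sphere_measure::(real^'n) measure))"
  proof (rule nn_integral_gw_homogeneous)
    fix x :: "real^'n" assume "x \<noteq> 0"
    from perp_powr_homogeneous[OF hp_const[of 1] this]
    show "perp i x powr (- \<gamma>) = norm x powr (real 0 - 2 * \<gamma>) * perp i (x /\<^sub>R norm x) powr (- \<gamma>)"
      by (simp only: mult_1_right)
  qed (use degree_bound[of 0] in auto)
  then show ?thesis
    using nn_integral_perp_gauss_finite rconst_pos[OF degree_bound[of 0]] by (auto simp: ennreal_mult_less_top)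
qed

lemma perp_powr_integrable: "integrable sphere_measure (\<lambda>y::real^'n. perp i y powr (- \<gamma>))"
  by (rule integrableI_bounded) (use nn_integral_perp_sphere_finite in \<open>auto intro!: borel_measurable_sphere\<close>)

lemma perp_powr_hp_integrable:
  fixes p :: "real^'n \<Rightarrow> real"
  assumes p: "hp n p"
  shows "integrable sphere_measure (\<lambda>y. perp i y powr (- \<gamma>) * p y)"
  by (rule integrable_mult_hp_sphere[OF perp_powr_integrable p])

text \<open>The same mixture with a signed harmonic inserted. The unknown constant c of the axial
  Gaussian integral is kept as a parameter: it depends on Y but not on \<gamma>, and cancels when
  two exponents are compared.\<close>

lemma perp_sphere_integral:
  fixes Y :: "real^'n \<Rightarrow> real"
  assumes Y: "Y \<in> sph_harm n"
    and C: "\<And>s. s > 0 \<Longrightarrow> gint (\<lambda>j. if j = i then 1 else s) Y =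
      (if even n then c * (1 - s) ^ (n div 2) else 0) * (\<Prod>j\<in>UNIV. sqrt (2 * pi * (if j = i then 1 else s)))"
  shows "(LINT y|sphere_measure. perp i y powr (- \<gamma>) * Y y) = (if even n then
    c * gconst TYPE('n) / (2 powr (real n / 2 + real CARD('n) / 2 - 1) * Gamma ((real CARD('n) - 1) / 2 + real n / 2)) *
      (Gamma (\<gamma> + real n / 2) * Gamma ((real CARD('n) - 1) / 2 - \<gamma>) / (Gamma \<gamma> * Gamma (real n / 2 + real CARD('n) / 2 - \<gamma>))) else 0)"
proof -
  let ?d = "(real CARD('n) - 1) / 2" and ?L = "lborel :: (real^'n) measure"
  have h: "hp n Y" using Y by (rule sph_harm_hp)
  have Ym[measurable]: "Y \<in> borel_measurable borel" using h by (rule hp_measurable)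
  have Gg: "Gamma \<gamma> > 0" using \<gamma> by simp
  define F where "F t y = indicator {0..} t * (t powr (\<gamma> - 1) * exp (- perp i y * t)) * (Y y * gw (\<lambda>_. 1) y)" for t :: real and y
  have Fm: "case_prod F \<in> borel_measurable (lborel \<Otimes>\<^sub>M ?L)" unfolding F_def[abs_def] by measurable
  let ?g = "\<lambda>y. perp i y powr (- \<gamma>) * Y y"
  have gm: "?g \<in> borel_measurable borel" by measurable
  have hom: "x \<noteq> 0 \<Longrightarrow> ?g x = norm x powr (real n - 2 * \<gamma>) * ?g (x /\<^sub>R norm x)" for x
    by (rule perp_powr_homogeneous[OF h])
  have gi: "integrable lborel (\<lambda>y. ?g y * gw (\<lambda>_. 1) y)"
    using integral_gw_homogeneous(1)[OF gm degree_bound hom] perp_powr_hp_integrable[OF h] by blast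
  have gr: "(LINT y|lborel. ?g y * gw (\<lambda>_. 1) y) = rconst (real CARD('n)) (real n - 2 * \<gamma>) * (LINT y|sphere_measure. ?g y)"
    by (rule integral_gw_homogeneous(2)[OF gm degree_bound hom])
  \<comment> \<open>Integrating the absolute value in t first reproduces the singular function times
    the Gaussian, whose integrability is already known.\<close>
  have int: "integrable (lborel \<Otimes>\<^sub>M ?L) (case_prod F)"
  proof (rule integrableI_bounded[OF Fm])
    have "(\<integral>\<^sup>+z. ennreal (norm (case_prod F z)) \<partial>(lborel \<Otimes>\<^sub>M ?L)) = (\<integral>\<^sup>+y. (\<integral>\<^sup>+t. ennreal (norm (F t y)) \<partial>lborel) \<partial>?L)"
      using lborel_pair.nn_integral_snd[of "\<lambda>z. ennreal (norm (case_prod F z))"] Fm by simp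
    also have "\<dots> = (\<integral>\<^sup>+y. ennreal (Gamma \<gamma>) * ennreal (norm (?g y * gw (\<lambda>_. 1) y)) \<partial>?L)"
    proof (rule nn_integral_cong_AE)
      show "AE y in ?L. (\<integral>\<^sup>+t. ennreal (norm (F t y)) \<partial>lborel) = ennreal (Gamma \<gamma>) * ennreal (norm (?g y * gw (\<lambda>_. 1) y))"
        using AE_lborel_perp_pos[OF N, of i]
      proof eventually_elim
        case (elim y)
        have "(\<integral>\<^sup>+t. ennreal (norm (F t y)) \<partial>lborel) = (\<integral>\<^sup>+t. ennreal (t powr (\<gamma> - 1) * exp (- perp i y * t)) * indicator {0..} t * ennreal (norm (Y y * gw (\<lambda>_. 1) y)) \<partial>lborel)"
          by (intro nn_integral_cong) (auto simp: F_def indicator_def abs_mult simp flip: ennreal_mult)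
        also have "\<dots> = ennreal (Gamma \<gamma> / perp i y powr \<gamma>) * ennreal (norm (Y y * gw (\<lambda>_. 1) y))"
          using elim \<gamma> by (subst nn_integral_multc) (simp, subst nn_integral_Gamma_scaled, auto)
        also have "\<dots> = ennreal (Gamma \<gamma>) * ennreal (norm (?g y * gw (\<lambda>_. 1) y))"
          using Gg by (simp add: powr_minus_divide abs_mult flip: ennreal_mult)
        finally show ?case .
      qed
    qed
    also have "\<dots> = ennreal (Gamma \<gamma>) * (\<integral>\<^sup>+y. ennreal (norm (?g y * gw (\<lambda>_. 1) y)) \<partial>?L)"
      by (rule nn_integral_cmult) measurable
    also have "\<dots> < \<infinity>" using gi by (simp add: integrable_iff_bounded ennreal_mult_less_top)
    finally show "(\<integral>\<^sup>+z. ennreal (norm (case_prod F z)) \<partial>(lborel \<Otimes>\<^sub>M ?L)) < \<infinity>" .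
  qed
  have "(LINT y|?L. LINT t|lborel. F t y) = (LINT t|lborel. LINT y|?L. F t y)"
    by (rule lborel_pair.Fubini_integral[OF int])
  moreover have "(LINT y|?L. LINT t|lborel. F t y) = (LINT y|?L. Gamma \<gamma> * (?g y * gw (\<lambda>_. 1) y))"
  proof (rule integral_cong_AE)
    show "AE y in ?L. (LINT t|lborel. F t y) = Gamma \<gamma> * (?g y * gw (\<lambda>_. 1) y)"
      using AE_lborel_perp_pos[OF N, of i]
    proof eventually_elim
      case (elim y)
      have "(LINT t|lborel. F t y) = (LINT t|lborel. indicator {0..} t * (t powr (\<gamma> - 1) * exp (- perp i y * t))) * (Y y * gw (\<lambda>_. 1) y)"
        unfolding F_def by (rule integral_mult_left_zero)
      then show ?case using integral_Gamma_scaled[OF \<gamma>(1) elim] by (simp add: powr_minus_divide)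
    qed
    show "(\<lambda>y. LINT t|lborel. F t y) \<in> borel_measurable ?L"
    proof (rule lborel.borel_measurable_lebesgue_integral)
      show "(\<lambda>(y, t). F t y) \<in> borel_measurable (?L \<Otimes>\<^sub>M lborel)" unfolding F_def[abs_def] by measurable
    qed
  qed measurable
  moreover have "(LINT t|lborel. LINT y|?L. F t y) = (if even n then c * gconst TYPE('n) * (2 powr (- \<gamma>) * Gamma (\<gamma> + real n / 2) * Gamma (?d - \<gamma>) / Gamma (?d + real n / 2)) else 0)"
  proof -
    have inner: "(LINT y|?L. F t y) = indicator {0..} t * (t powr (\<gamma> - 1) * ((if even n then c * (1 - 1 / (1 + 2 * t)) ^ (n div 2) else 0) * (gconst TYPE('n) * (1 / (1 + 2 * t)) powr ?d)))" for t
    proof (cases "t \<ge> 0")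
      case True
      have "(LINT y|?L. F t y) = (LINT y|?L. t powr (\<gamma> - 1) * (Y y * gw (\<lambda>j. if j = i then 1 else 1 / (1 + 2 * t)) y))"
        using True by (intro Bochner_Integration.integral_cong) (auto simp: F_def gw_axial[OF True, symmetric] mult_ac)
      also have "\<dots> = t powr (\<gamma> - 1) * gint (\<lambda>j. if j = i then 1 else 1 / (1 + 2 * t)) Y"
        unfolding gint_def by (rule integral_mult_right_zero)
      finally show ?thesis using True C[of "1 / (1 + 2 * t)"] prod_axial[of "1 / (1 + 2 * t)" i] by simp
    qed (simp add: F_def)
    show ?thesis
    proof (cases "even n")
      case False
      then show ?thesis unfolding inner by simp
    next
      case True
      then obtain k where k: "n = 2 * k" by blast
      have t: "(LINT y|?L. F t y) = (c * gconst TYPE('n) * 2 ^ k) * (indicator {0..} t * (t powr (\<gamma> + real k - 1) * (1 + 2 * t) powr (- (?d + real k))))" if "t \<noteq> 0" for t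
      proof (cases "t > 0")
        case True
        \<comment> \<open>With s = 1/(1 + 2t) this says 1 - s = 2ts, so the degree of Y merely
          shifts both exponents of the Beta integral by k = n/2.\<close>
        have "1 - 1 / (1 + 2 * t) = 2 * t * (1 / (1 + 2 * t))" using True by (simp add: field_simps)
        then have "(1 - 1 / (1 + 2 * t)) ^ k = 2 ^ k * t powr real k * (1 + 2 * t) powr (- real k)"
          using True by (simp add: power_mult_distrib power_divide powr_realpow powr_minus_divide)
        moreover have "(1 / (1 + 2 * t)) powr ?d = (1 + 2 * t) powr (- ?d)"
          using True by (simp add: powr_divide powr_minus_divide)
        ultimately have "(LINT y|?L. F t y) = (c * gconst TYPE('n) * 2 ^ k) * ((t powr (\<gamma> - 1) * t powr real k) * ((1 + 2 * t) powr (- real k) * (1 + 2 * t) powr (- ?d)))"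
          unfolding inner k using True by simp
        also have "t powr (\<gamma> - 1) * t powr real k = t powr (\<gamma> + real k - 1)" by (simp add: powr_add[symmetric] algebra_simps)
        also have "(1 + 2 * t) powr (- real k) * (1 + 2 * t) powr (- ?d) = (1 + 2 * t) powr (- (?d + real k))"
          by (simp add: powr_add[symmetric] add.commute)
        finally show ?thesis using True by simp
      next
        case False
        then show ?thesis using that unfolding inner by simp
      qed
      have "(LINT t|lborel. LINT y|?L. F t y) = (LINT t|lborel. (c * gconst TYPE('n) * 2 ^ k) * (indicator {0..} t * (t powr (\<gamma> + real k - 1) * (1 + 2 * t) powr (- (?d + real k)))))"
      proof (rule integral_cong_AE)
        show "AE x in lborel. (LINT y|?L. F x y) = (c * gconst TYPE('n) * 2 ^ k) * (indicator {0..} x * (x powr (\<gamma> + real k - 1) * (1 + 2 * x) powr (- (?d + real k))))"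
          using AE_lborel_singleton[of "0::real"] by eventually_elim (rule t)
        show "(\<lambda>x. LINT y|?L. F x y) \<in> borel_measurable lborel" unfolding inner by measurable
      qed measurable
      also have "\<dots> = (c * gconst TYPE('n) * 2 ^ k) * (LINT t|lborel. indicator {0..} t * (t powr (\<gamma> + real k - 1) * (1 + 2 * t) powr (- (?d + real k))))"
        by (rule integral_mult_right_zero)
      also have "(LINT t|lborel. indicator {0..} t * (t powr (\<gamma> + real k - 1) * (1 + 2 * t) powr (- (?d + real k)))) =
        enn2real (\<integral>\<^sup>+t. ennreal (indicator {0..} t * (t powr (\<gamma> + real k - 1) * (1 + 2 * t) powr (- (?d + real k)))) \<partial>lborel)"
        by (rule integral_eq_nn_integral) auto
      also have "(\<integral>\<^sup>+t. ennreal (indicator {0..} t * (t powr (\<gamma> + real k - 1) * (1 + 2 * t) powr (- (?d + real k)))) \<partial>lborel) =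
         (\<integral>\<^sup>+t. ennreal (t powr (\<gamma> + real k - 1) * (1 + 2 * t) powr (- (?d + real k))) * indicator {0..} t \<partial>lborel)"
        by (intro nn_integral_cong) (auto simp: indicator_def)
      also have "\<dots> = ennreal (2 powr (- (\<gamma> + real k)) * Gamma (\<gamma> + real k) * Gamma (?d + real k - (\<gamma> + real k)) / Gamma (?d + real k))"
        using \<gamma> by (intro nn_integral_Beta_prime) auto
      also have "enn2real \<dots> = 2 powr (- (\<gamma> + real k)) * Gamma (\<gamma> + real k) * Gamma (?d + real k - (\<gamma> + real k)) / Gamma (?d + real k)"
      proof -
        have "?d > 0" using \<gamma> by linarith
        then have p: "?d + real k > 0" "\<gamma> + real k > 0" "?d + real k - (\<gamma> + real k) > 0"
          using \<gamma> by (auto intro: add_pos_nonneg)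
        show ?thesis
          by (intro enn2real_ennreal divide_nonneg_pos mult_nonneg_nonneg less_imp_le[OF Gamma_real_pos] Gamma_real_pos p) simp
      qed
      also have "(c * gconst TYPE('n) * 2 ^ k) * (2 powr (- (\<gamma> + real k)) * Gamma (\<gamma> + real k) * Gamma (?d + real k - (\<gamma> + real k)) / Gamma (?d + real k)) =
        c * gconst TYPE('n) * ((2 ^ k * 2 powr (- (\<gamma> + real k))) * Gamma (\<gamma> + real k) * Gamma (?d - \<gamma>) / Gamma (?d + real k))" by simp
      also have "2 ^ k * 2 powr (- (\<gamma> + real k)) = (2::real) powr (- \<gamma>)"
        by (simp add: powr_realpow[symmetric, of 2 k, simplified] powr_add[symmetric])
      finally show ?thesis using True k by simp
    qed
  qed
  ultimately have eq: "Gamma \<gamma> * (rconst (real CARD('n)) (real n - 2 * \<gamma>) * (LINT y|sphere_measure. ?g y)) =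
    (if even n then c * gconst TYPE('n) * (2 powr (- \<gamma>) * Gamma (\<gamma> + real n / 2) * Gamma (?d - \<gamma>) / Gamma (?d + real n / 2)) else 0)"
    using gr by simp
  let ?q = "real n / 2 + real CARD('n) / 2"
  have r: "rconst (real CARD('n)) (real n - 2 * \<gamma>) = 2 powr (?q - 1) * 2 powr (- \<gamma>) * Gamma (?q - \<gamma>)"
    unfolding rconst_def powr_add[symmetric] by (simp add: field_simps)
  have rp: "rconst (real CARD('n)) (real n - 2 * \<gamma>) > 0" by (rule rconst_pos[OF degree_bound])
  have Gq: "Gamma (?q - \<gamma>) > 0" using degree_bound[of n] by (intro Gamma_real_pos) (simp add: field_simps)
  show ?thesis
  proof (cases "even n")
    case True
    have "Gamma \<gamma> * ((P * T * Gq) * J) = cg * (T * G1 * G2 / G3) \<Longrightarrow> T \<noteq> 0 \<Longrightarrow> P \<noteq> 0 \<Longrightarrow> Gq \<noteq> 0 \<Longrightarrow> G3 \<noteq> 0 \<Longrightarrow>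
       J = cg / (P * G3) * (G1 * G2 / (Gamma \<gamma> * Gq))" for P T Gq J cg G1 G2 G3
      using Gg by (simp add: field_simps)
    moreover have "Gamma (?d + real n / 2) \<noteq> 0" using N by (intro less_imp_neq[symmetric] Gamma_real_pos) (auto simp: add_pos_nonneg)
    ultimately show ?thesis using eq[unfolded r] Gq True by simp
  next
    case False
    then show ?thesis using eq Gg rp by simp
  qed
qed

end

text \<open>The weak form of K \<phi> = \<psi>/Q. The relation between \<beta> and \<delta> makes
  the two moment formulas mirror images with the same constant c; in the quotient the duplication
  formula merges Gamma(\<beta> + n/2) and Gamma(\<beta> + n/2 + 1/2), and likewise for \<delta>,
  leaving the eigenvalue and Q.\<close>

lemma ground_state_moments:
  fixes Y :: "real^'n \<Rightarrow> real" and i :: 'n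
  assumes N: "CARD('n) \<ge> 3" and bd: "0 < \<beta>" "\<beta> < \<delta>" and sum: "2 * (\<beta> + \<delta>) = real CARD('n) - 1"
    and Y: "Y \<in> sph_harm n"
  shows "acoef \<beta> \<delta> n * (LINT y|sphere_measure. perp i y powr (- \<beta>) * Y y) =
    2 powr (2 * (\<delta> - \<beta>)) * (Gamma \<delta> / Gamma \<beta>)\<^sup>2 * (LINT y|sphere_measure. perp i y powr (- \<delta>) * Y y)"
proof -
  from gint_axial_sph_harm[OF Y, of i] obtain c where c: "\<And>s. s > 0 \<Longrightarrow> gint (\<lambda>j. if j = i then 1 else s) Y =
      (if even n then c * (1 - s) ^ (n div 2) else 0) * (\<Prod>j\<in>UNIV. sqrt (2 * pi * (if j = i then 1 else s)))" by blast
  have b: "0 < \<beta>" "\<beta> < (real CARD('n) - 1) / 2" and d: "0 < \<delta>" "\<delta> < (real CARD('n) - 1) / 2" using bd sum by auto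
  show ?thesis
  proof (cases "even n")
    case False
    then show ?thesis using perp_sphere_integral[OF N b Y c] perp_sphere_integral[OF N d Y c] by simp
  next
    case True
    define K where "K = c * gconst TYPE('n) / (2 powr (real n / 2 + real CARD('n) / 2 - 1) * Gamma ((real CARD('n) - 1) / 2 + real n / 2))"
    have d1: "(real CARD('n) - 1) / 2 - \<beta> = \<delta>" "(real CARD('n) - 1) / 2 - \<delta> = \<beta>"
      "real n / 2 + real CARD('n) / 2 - \<beta> = \<delta> + real n / 2 + 1 / 2" "real n / 2 + real CARD('n) / 2 - \<delta> = \<beta> + real n / 2 + 1 / 2"
      using sum by (auto simp: field_simps)
    have Jb: "(LINT y|sphere_measure. perp i y powr (- \<beta>) * Y y) = K * (Gamma (\<beta> + real n / 2) * Gamma \<delta> / (Gamma \<beta> * Gamma (\<delta> + real n / 2 + 1 / 2)))"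
      using perp_sphere_integral[OF N b Y c] True unfolding K_def[symmetric] d1 by simp
    have Jd: "(LINT y|sphere_measure. perp i y powr (- \<delta>) * Y y) = K * (Gamma (\<delta> + real n / 2) * Gamma \<beta> / (Gamma \<delta> * Gamma (\<beta> + real n / 2 + 1 / 2)))"
      using perp_sphere_integral[OF N d Y c] True unfolding K_def[symmetric] d1 by simp
    have p: "\<beta> + real n / 2 > 0" "\<delta> + real n / 2 > 0" using bd by (auto simp: add_pos_nonneg)
    have pos: "Gamma \<beta> > 0" "Gamma \<delta> > 0" "Gamma (\<beta> + real n / 2) > 0" "Gamma (\<delta> + real n / 2) > 0"
      "Gamma (\<beta> + real n / 2 + 1 / 2) > 0" "Gamma (\<delta> + real n / 2 + 1 / 2) > 0" "Gamma (real n + 2 * \<beta>) > 0" using bd p by (auto simp: add_nonneg_pos)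
    have db: "Gamma (real n + 2 * \<beta>) = 2 powr (2 * \<beta> + real n - 1) / sqrt pi * (Gamma (\<beta> + real n / 2) * Gamma (\<beta> + real n / 2 + 1 / 2))"
      unfolding Gamma_duplication_real[OF p(1)] by (simp add: algebra_simps powr_diff powr_add)
    have dd: "Gamma (real n + 2 * \<delta>) = 2 powr (2 * \<delta> + real n - 1) / sqrt pi * (Gamma (\<delta> + real n / 2) * Gamma (\<delta> + real n / 2 + 1 / 2))"
      unfolding Gamma_duplication_real[OF p(2)] by (simp add: algebra_simps powr_diff powr_add)
    have pw: "2 powr (2 * \<delta> + real n - 1) = 2 powr (2 * (\<delta> - \<beta>)) * (2::real) powr (2 * \<beta> + real n - 1)"
      by (simp add: powr_add[symmetric] algebra_simps)
    show ?thesis unfolding Jb Jd acoef_def db dd pw using pos by (simp add: field_simps power2_eq_square)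
  qed
qed

subsection \<open>The inequality for polynomials\<close>

interpretation sphere_pair: pair_sigma_finite "sphere_measure :: (real^'n) measure" "sphere_measure :: (real^'n) measure" ..

text \<open>The surface measure lives on a restricted sigma-algebra; this transfers measurability
  proved once and for all on the full Borel product.\<close>

lemma sphere_pair_measurable:
  assumes "g \<in> measurable ((borel :: (real^'n) measure) \<Otimes>\<^sub>M (borel :: (real^'n) measure)) M"
  shows "g \<in> measurable (sphere_measure \<Otimes>\<^sub>M sphere_measure) M"
proof -
  have id: "(\<lambda>x::real^'n. x) \<in> measurable sphere_measure borel" by (rule borel_measurable_sphere) simp
  have "(\<lambda>z. (fst z, snd z)) \<in> measurable (sphere_measure \<Otimes>\<^sub>M sphere_measure) ((borel :: (real^'n) measure) \<Otimes>\<^sub>M (borel :: (real^'n) measure))"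
    by (intro measurable_Pair measurable_compose[OF measurable_fst id] measurable_compose[OF measurable_snd id])
  from measurable_compose[OF this assms] show ?thesis by simp
qed

lemma AE_sphere_pair:
  assumes "Measurable.pred ((borel :: (real^'n) measure) \<Otimes>\<^sub>M (borel :: (real^'n) measure)) (case_prod P)"
    and "\<And>x. x \<in> sphere 0 1 \<Longrightarrow> AE y in sphere_measure. P x y"
  shows "AE z in sphere_measure \<Otimes>\<^sub>M sphere_measure. P (fst z) (snd z)"
proof (rule sphere_pair.AE_pair_measure)
  have "Measurable.pred (sphere_measure \<Otimes>\<^sub>M sphere_measure) (case_prod P)"
    by (rule sphere_pair_measurable[OF assms(1)])
  then show "{z \<in> space (sphere_measure \<Otimes>\<^sub>M sphere_measure). P (fst z) (snd z)} \<in> sets (sphere_measure \<Otimes>\<^sub>M sphere_measure)"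
    by (simp add: case_prod_unfold pred_def)
  show "AE x in sphere_measure. AE y in sphere_measure. P (fst (x, y)) (snd (x, y))"
    by (rule AE_I2) (use assms(2) in \<open>simp add: space_sphere_measure\<close>)
qed

lemma integrable_sphere_pair_mult:
  fixes p q :: "real^'n \<Rightarrow> real"
  assumes p: "integrable sphere_measure p" and q: "integrable sphere_measure q"
  shows "integrable (sphere_measure \<Otimes>\<^sub>M sphere_measure) (\<lambda>z. p (fst z) * q (snd z))"
proof -
  have [measurable]: "p \<in> borel_measurable sphere_measure" "q \<in> borel_measurable sphere_measure" using p q by auto
  have "integrable (sphere_measure \<Otimes>\<^sub>M sphere_measure) (\<lambda>(x, y). p x * q y)"
  proof (rule sphere_pair.Fubini_integrable)
    show "integrable sphere_measure (\<lambda>x. LINT y|sphere_measure. norm (case (x, y) of (x, y) \<Rightarrow> p x * q y))"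
      using p by (simp add: abs_mult)
  qed (use q in auto)
  then show ?thesis by (simp add: case_prod_unfold)
qed

text \<open>One factor of the inner product splits into coordinates, and each coordinate is absorbed
  into w, which is why w varies in the induction. At k = 0 the double integral is the square of the
  integral of w.\<close>

lemma inner_power_positive_definite:
  fixes w :: "real^'n \<Rightarrow> real"
  shows "integrable sphere_measure w \<Longrightarrow>
    integrable (sphere_measure \<Otimes>\<^sub>M sphere_measure) (\<lambda>z. (fst z \<bullet> snd z) ^ k * (w (fst z) * w (snd z))) \<and>
    0 \<le> (LINT z|(sphere_measure \<Otimes>\<^sub>M sphere_measure). (fst z \<bullet> snd z) ^ k * (w (fst z) * w (snd z)))"
proof (induction k arbitrary: w)
  case 0
  let ?P = "sphere_measure \<Otimes>\<^sub>M sphere_measure :: ((real^'n) \<times> (real^'n)) measure"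
  have i: "integrable ?P (\<lambda>(x, y). w x * w y)"
    using integrable_sphere_pair_mult[OF 0 0] by (simp add: case_prod_unfold)
  have "(LINT z|?P. w (fst z) * w (snd z)) = (LINT x|sphere_measure. LINT y|sphere_measure. w x * w y)"
    using sphere_pair.integral_fst[OF i] by (simp add: case_prod_unfold)
  also have "\<dots> = (LINT x|sphere_measure. w x) * (LINT x|sphere_measure. w x)" by simp
  finally show ?case using i by (simp add: case_prod_unfold)
next
  case (Suc k)
  let ?P = "sphere_measure \<Otimes>\<^sub>M sphere_measure :: ((real^'n) \<times> (real^'n)) measure"
  have wm: "w \<in> borel_measurable sphere_measure" using Suc.prems by simp
  have wi: "integrable sphere_measure (\<lambda>x. x $ i * w x)" for i
  proof (rule Bochner_Integration.integrable_bound[OF Suc.prems])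
    have "(\<lambda>x::real^'n. x $ i) \<in> borel_measurable sphere_measure" by (rule borel_measurable_sphere) measurable
    then show "(\<lambda>x. x $ i * w x) \<in> borel_measurable sphere_measure" using wm by measurable
    have "norm (x $ i * w x) \<le> norm (w x)" if "x \<in> sphere 0 1" for x
    proof -
      have "\<bar>x $ i\<bar> \<le> 1" using component_le_norm_cart[of x i] that by simp
      then show ?thesis by (simp add: abs_mult mult_left_le_one_le)
    qed
    then show "AE x in sphere_measure. norm (x $ i * w x) \<le> norm (w x)" by (intro AE_I2) (simp add: space_sphere_measure)
  qed
  have eq: "(fst z \<bullet> snd z) ^ Suc k * (w (fst z) * w (snd z)) =
     (\<Sum>i\<in>UNIV. (fst z \<bullet> snd z) ^ k * ((fst z $ i * w (fst z)) * (snd z $ i * w (snd z))))" for z :: "(real^'n) \<times> (real^'n)"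
    by (simp add: inner_vec_def sum_distrib_left sum_distrib_right mult_ac)
  note IH = Suc.IH[OF wi]
  show ?case unfolding eq
    by (subst Bochner_Integration.integral_sum) (use IH in \<open>auto intro!: Bochner_Integration.integrable_sum sum_nonneg\<close>)
qed

context
  fixes \<beta> \<delta> :: real and i :: "'n::finite"
  assumes bd: "0 < \<beta>" "\<beta> < \<delta>" and dsum: "2 * (\<beta> + \<delta>) = real CARD('n) - 1" and N: "CARD('n) \<ge> 3"
begin

definition kern :: "real^'n \<Rightarrow> real^'n \<Rightarrow> real" where
  "kern x y = (1 - x \<bullet> y) powr (- 2 * \<beta>) / kconst TYPE('n) \<beta> \<delta>"

definition qconst :: real where
  "qconst = 2 powr (2 * (\<delta> - \<beta>)) * (Gamma \<delta> / Gamma \<beta>)\<^sup>2"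

abbreviation "surf2 \<equiv> (sphere_measure \<Otimes>\<^sub>M sphere_measure :: ((real^'n) \<times> (real^'n)) measure)"
abbreviation "surf \<equiv> (sphere_measure :: (real^'n) measure)"

lemma qconst_pos: "qconst > 0"
  unfolding qconst_def using bd by (intro mult_pos_pos zero_less_power divide_pos_pos Gamma_real_pos) auto

lemma kern_nonneg: "kern x y \<ge> 0"
  unfolding kern_def using kconst_pos[OF bd, where ?'n='n] by simp

lemma kern_sym: "kern x y = kern y x"
  by (simp add: kern_def inner_commute)

lemma kern_measurable [measurable]: "(\<lambda>z. kern (fst z) (snd z)) \<in> borel_measurable (borel \<Otimes>\<^sub>M borel)"
  unfolding kern_def by measurable

lemma kern_measurable1 [measurable]: "kern x \<in> borel_measurable borel"
  unfolding kern_def[abs_def] by measurable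

lemma kern_harmonic:
  assumes x: "x \<in> sphere 0 1" and Y: "Y \<in> sph_harm n"
  shows "integrable surf (\<lambda>y. kern x y * Y y)" and "(LINT y|surf. kern x y * Y y) = Y x / acoef \<beta> \<delta> n"
  using funk_hecke[OF bd dsum N _ Y, of x] x kconst_pos[OF bd, where ?'n='n] by (auto simp: kern_def)

lemma kern_nn_integral:
  assumes x: "x \<in> sphere 0 1"
  shows "(\<integral>\<^sup>+y. ennreal (kern x y) \<partial>surf) = ennreal (1 / acoef \<beta> \<delta> 0)"
  using kern_harmonic[OF x sph_harm_const[of 1]] nn_integral_eq_integral[of surf "kern x"] kern_nonneg by simp

text \<open>All rows of the kernel have the same finite mass, so pairing an integrable with a
  bounded function converges absolutely.\<close>

lemma kern_pair_integrable:
  fixes q p :: "real^'n \<Rightarrow> real"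
  assumes q: "integrable surf q" and qm[measurable]: "q \<in> borel_measurable borel"
    and pm[measurable]: "p \<in> borel_measurable borel" and B: "\<And>y. y \<in> sphere 0 1 \<Longrightarrow> \<bar>p y\<bar> \<le> B"
  shows "integrable surf2 (\<lambda>z. kern (fst z) (snd z) * (q (fst z) * p (snd z)))"
proof (rule integrableI_bounded)
  have m: "(\<lambda>z. kern (fst z) (snd z) * (q (fst z) * p (snd z))) \<in> borel_measurable surf2"
    by (rule sphere_pair_measurable) measurable
  then show "(\<lambda>z. kern (fst z) (snd z) * (q (fst z) * p (snd z))) \<in> borel_measurable surf2" .
  have B0: "B \<ge> 0" using B[of "axis undefined 1"] by (auto intro: order_trans[of _ "\<bar>p (axis undefined 1)\<bar>"] simp: norm_axis_1)
  have "(\<integral>\<^sup>+z. ennreal (norm (kern (fst z) (snd z) * (q (fst z) * p (snd z)))) \<partial>surf2) =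
    (\<integral>\<^sup>+x. (\<integral>\<^sup>+y. ennreal (norm (kern x y * (q x * p y))) \<partial>surf) \<partial>surf)"
    using sphere.nn_integral_fst[of "\<lambda>z. ennreal (norm (kern (fst z) (snd z) * (q (fst z) * p (snd z))))" surf] m by simp
  also have "\<dots> \<le> (\<integral>\<^sup>+x. ennreal (B * \<bar>q x\<bar> * (1 / acoef \<beta> \<delta> 0)) \<partial>surf)"
  proof (rule nn_integral_mono)
    fix x assume "x \<in> space surf"
    then have x: "x \<in> sphere 0 1" by (simp add: space_sphere_measure)
    have "(\<integral>\<^sup>+y. ennreal (norm (kern x y * (q x * p y))) \<partial>surf) \<le> (\<integral>\<^sup>+y. ennreal (B * \<bar>q x\<bar>) * ennreal (kern x y) \<partial>surf)"
    proof (rule nn_integral_mono)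
      fix y assume "y \<in> space surf"
      then have "\<bar>p y\<bar> \<le> B" using B by (simp add: space_sphere_measure)
      then have "kern x y * \<bar>q x\<bar> * \<bar>p y\<bar> \<le> kern x y * \<bar>q x\<bar> * B"
        using kern_nonneg by (intro mult_left_mono) auto
      then show "ennreal (norm (kern x y * (q x * p y))) \<le> ennreal (B * \<bar>q x\<bar>) * ennreal (kern x y)"
        using kern_nonneg B0 by (simp add: abs_mult mult_ac ennreal_leI flip: ennreal_mult)
    qed
    also have "\<dots> = ennreal (B * \<bar>q x\<bar>) * (\<integral>\<^sup>+y. ennreal (kern x y) \<partial>surf)"
      by (rule nn_integral_cmult, rule borel_measurable_sphere) measurable
    also have "\<dots> = ennreal (B * \<bar>q x\<bar> * (1 / acoef \<beta> \<delta> 0))"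
      unfolding kern_nn_integral[OF x] using B0 acoef_pos[OF bd, of 0] by (intro ennreal_mult[symmetric]) auto
    finally show "(\<integral>\<^sup>+y. ennreal (norm (kern x y * (q x * p y))) \<partial>surf) \<le> ennreal (B * \<bar>q x\<bar> * (1 / acoef \<beta> \<delta> 0))" .
  qed
  also have "\<dots> < \<infinity>"
  proof -
    have "integrable surf (\<lambda>x. B * \<bar>q x\<bar> * (1 / acoef \<beta> \<delta> 0))" using q by simp
    moreover have "0 \<le> B * \<bar>q x\<bar> * (1 / acoef \<beta> \<delta> 0)" for x using B0 acoef_pos[OF bd, of 0] by simp
    ultimately show ?thesis by (subst nn_integral_eq_integral) auto
  qed
  finally show "(\<integral>\<^sup>+z. ennreal (norm (kern (fst z) (snd z) * (q (fst z) * p (snd z)))) \<partial>surf2) < \<infinity>" .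
qed

lemma kern_pair_integral:
  fixes q :: "real^'n \<Rightarrow> real"
  assumes q: "integrable surf q" and qm: "q \<in> borel_measurable borel" and Y: "Y \<in> sph_harm n"
  shows "integrable surf2 (\<lambda>z. kern (fst z) (snd z) * (q (fst z) * Y (snd z)))"
    and "(LINT z|surf2. kern (fst z) (snd z) * (q (fst z) * Y (snd z))) = (LINT x|surf. q x * Y x) / acoef \<beta> \<delta> n"
proof -
  obtain B where B: "\<And>y. y \<in> sphere 0 1 \<Longrightarrow> \<bar>Y y\<bar> \<le> B"
    using continuous_bounded_on_sphere[OF hp_continuous[OF sph_harm_hp[OF Y]]] by blast
  show i: "integrable surf2 (\<lambda>z. kern (fst z) (snd z) * (q (fst z) * Y (snd z)))"
    by (rule kern_pair_integrable[OF q qm hp_measurable[OF sph_harm_hp[OF Y]] B])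
  have "(LINT z|surf2. kern (fst z) (snd z) * (q (fst z) * Y (snd z))) = (LINT x|surf. LINT y|surf. kern x y * (q x * Y y))"
    using sphere_pair.integral_fst[of "\<lambda>x y. kern x y * (q x * Y y)"] i by (simp add: case_prod_unfold)
  also have "\<dots> = (LINT x|surf. q x * Y x / acoef \<beta> \<delta> n)"
  proof (rule Bochner_Integration.integral_cong[OF refl])
    fix x assume "x \<in> space surf"
    then have "x \<in> sphere 0 1" by (simp add: space_sphere_measure)
    have "(LINT y|surf. kern x y * (q x * Y y)) = (LINT y|surf. q x * (kern x y * Y y))" by (simp add: mult_ac)
    also have "\<dots> = q x * (LINT y|surf. kern x y * Y y)" by (rule integral_mult_right_zero)
    also have "\<dots> = q x * Y x / acoef \<beta> \<delta> n" using kern_harmonic(2)[OF \<open>x \<in> sphere 0 1\<close> Y] by simp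
    finally show "(LINT y|surf. kern x y * (q x * Y y)) = q x * Y x / acoef \<beta> \<delta> n" .
  qed
  also have "\<dots> = (LINT x|surf. q x * Y x) / acoef \<beta> \<delta> n" by simp
  finally show "(LINT z|surf2. kern (fst z) (snd z) * (q (fst z) * Y (snd z))) = (LINT x|surf. q x * Y x) / acoef \<beta> \<delta> n" .
qed

lemma delta_range: "0 < \<delta>" "\<delta> < (real CARD('n) - 1) / 2" and beta_range: "0 < \<beta>" "\<beta> < (real CARD('n) - 1) / 2"
  using bd dsum by auto

text \<open>K \<phi> and \<psi>/Q are both integrable and have equal moments against every harmonic:
  Fubini and the symmetry of the kernel move K onto the harmonic, where it acts as a scalar.
  Completeness then gives equality almost everywhere.\<close>

lemma kern_ground_state:
  "AE x in surf. (\<integral>\<^sup>+y. ennreal (kern x y * perp i y powr (- \<delta>)) \<partial>surf) = ennreal (perp i x powr (- \<beta>) / qconst)"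
proof -
  let ?\<phi> = "\<lambda>y. perp i y powr (- \<delta>)" and ?\<psi> = "\<lambda>y. perp i y powr (- \<beta>)"
  have \<phi>i: "integrable surf ?\<phi>" by (rule perp_powr_integrable[OF N delta_range])
  have \<psi>i: "integrable surf ?\<psi>" by (rule perp_powr_integrable[OF N beta_range])
  have \<phi>m: "?\<phi> \<in> borel_measurable borel" by measurable
  have swap: "integrable surf2 (\<lambda>(x, y). kern x y * (?\<phi> y * Y x))" if "Y \<in> sph_harm n" for Y n
    using sphere_pair.integrable_product_swap[OF kern_pair_integral(1)[OF \<phi>i \<phi>m that]]
    by (simp add: case_prod_unfold kern_sym[of "snd _"])
  define k where "k x = (LINT y|surf. kern x y * ?\<phi> y)" for x
  have i1: "integrable surf2 (\<lambda>(x, y). kern x y * ?\<phi> y)" using swap[OF sph_harm_const[of 1]] by simp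
  have ki: "integrable surf k" unfolding k_def[abs_def] using sphere_pair.integrable_fst[OF i1] by simp
  have AEi: "AE x in surf. integrable surf (\<lambda>y. kern x y * ?\<phi> y)" using sphere_pair.AE_integrable_fst[OF i1] by simp
  have "AE x in surf. k x - ?\<psi> x / qconst = 0"
  proof (rule AE_zero_if_orthogonal_sph_harm[OF N])
    show "integrable surf (\<lambda>x. k x - ?\<psi> x / qconst)" using ki \<psi>i by simp
    fix n and Y :: "real^'n \<Rightarrow> real" assume Y: "Y \<in> sph_harm n"
    have "(LINT x|surf. k x * Y x) = (LINT x|surf. LINT y|surf. kern x y * (?\<phi> y * Y x))"
      by (simp add: k_def mult.assoc[symmetric])
    also have "\<dots> = (LINT z|surf2. kern (fst z) (snd z) * (?\<phi> (snd z) * Y (fst z)))"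
      using sphere_pair.integral_fst[OF swap[OF Y]] by (simp add: case_prod_unfold)
    also have "\<dots> = (LINT z|surf2. kern (fst z) (snd z) * (?\<phi> (fst z) * Y (snd z)))"
      using sphere_pair.integral_product_swap[of "\<lambda>z. kern (fst z) (snd z) * (?\<phi> (fst z) * Y (snd z))"]
        kern_pair_integral(1)[OF \<phi>i \<phi>m Y]
      by (simp add: case_prod_unfold kern_sym[of "snd _"])
    also have "\<dots> = (LINT x|surf. ?\<phi> x * Y x) / acoef \<beta> \<delta> n" by (rule kern_pair_integral(2)[OF \<phi>i \<phi>m Y])
    also have "\<dots> = (LINT x|surf. ?\<psi> x * Y x) / qconst"
      using ground_state_moments[OF N bd dsum Y, of i] acoef_pos[OF bd, of n] qconst_pos
      unfolding qconst_def[symmetric] by (simp add: field_simps)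
    finally have e: "(LINT x|surf. k x * Y x) = (LINT x|surf. ?\<psi> x * Y x) / qconst" .
    have kY: "integrable surf (\<lambda>x. k x * Y x)" by (rule integrable_mult_hp_sphere[OF ki sph_harm_hp[OF Y]])
    have \<psi>Y: "integrable surf (\<lambda>x. ?\<psi> x * Y x)" by (rule perp_powr_hp_integrable[OF N beta_range sph_harm_hp[OF Y]])
    have "(LINT x|surf. (k x - ?\<psi> x / qconst) * Y x) = (LINT x|surf. k x * Y x - ?\<psi> x * Y x / qconst)" by (simp add: left_diff_distrib)
    also have "\<dots> = 0" using e kY \<psi>Y by simp
    finally show "(LINT x|surf. (k x - ?\<psi> x / qconst) * Y x) = 0" .
  qed
  with AEi show ?thesis
  proof eventually_elim
    case (elim x)
    then have "(\<integral>\<^sup>+y. ennreal (kern x y * ?\<phi> y) \<partial>surf) = ennreal (k x)"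
      unfolding k_def using kern_nonneg by (intro nn_integral_eq_integral) auto
    with elim show ?case by simp
  qed
qed

text \<open>Weighted arithmetic-geometric mean with weights \<phi>(x) and \<phi>(y), followed by K
  \<phi> = \<psi>/Q. Since \<phi> = W \<psi> and g = W f, the quotient of g^2 \<psi> by \<phi> is W
  f^2. Nonnegative integrals make the bound meaningful before the left side is known to be
  finite.\<close>

lemma kern_schur:
  fixes f :: "real^'n \<Rightarrow> real"
  assumes fm[measurable]: "f \<in> borel_measurable borel"
  defines "g \<equiv> (\<lambda>y. perp i y powr (- (\<delta> - \<beta>)) * f y)"
  shows "(\<integral>\<^sup>+z. ennreal (kern (fst z) (snd z) * (\<bar>g (fst z)\<bar> * \<bar>g (snd z)\<bar>)) \<partial>surf2)
    \<le> ennreal (1 / qconst) * (\<integral>\<^sup>+y. ennreal (perp i y powr (- (\<delta> - \<beta>)) * (f y)\<^sup>2) \<partial>surf)"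
proof -
  let ?\<phi> = "\<lambda>y. perp i y powr (- \<delta>)" and ?\<psi> = "\<lambda>y. perp i y powr (- \<beta>)" and ?W = "\<lambda>y. perp i y powr (- (\<delta> - \<beta>))"
  have gm[measurable]: "g \<in> borel_measurable borel" unfolding g_def by measurable
  define h where "h x y = ennreal (kern x y * ((g x)\<^sup>2 / (2 * ?\<phi> x) * ?\<phi> y))" for x y
  have hm[measurable]: "(\<lambda>z. h (fst z) (snd z)) \<in> borel_measurable (borel \<Otimes>\<^sub>M borel)" unfolding h_def by measurable
  have hm2[measurable]: "(\<lambda>z. h (snd z) (fst z)) \<in> borel_measurable (borel \<Otimes>\<^sub>M borel)"
    unfolding h_def kern_sym[of "snd _"] by measurable
  have AEp: "AE z in surf2. perp i (fst z) > 0 \<and> perp i (snd z) > 0"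
  proof (rule AE_conjI)
    have m1: "(\<lambda>z. perp i (fst z) > 0) \<in> measurable surf2 (count_space UNIV)" by (rule sphere_pair_measurable) measurable
    have m2: "(\<lambda>z. perp i (snd z) > 0) \<in> measurable surf2 (count_space UNIV)" by (rule sphere_pair_measurable) measurable
    show "AE z in surf2. perp i (fst z) > 0"
      by (rule sphere_pair.AE_pair_measure) (use m1 AE_sphere_perp_pos[OF N, of i] in \<open>auto simp: pred_def\<close>)
    show "AE z in surf2. perp i (snd z) > 0"
      by (rule sphere_pair.AE_pair_measure) (use m2 AE_sphere_perp_pos[OF N, of i] in \<open>auto simp: pred_def\<close>)
  qed
  have "(\<integral>\<^sup>+z. ennreal (kern (fst z) (snd z) * (\<bar>g (fst z)\<bar> * \<bar>g (snd z)\<bar>)) \<partial>surf2) \<le> (\<integral>\<^sup>+z. h (fst z) (snd z) + h (snd z) (fst z) \<partial>surf2)"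
  proof (rule nn_integral_mono_AE)
    show "AE z in surf2. ennreal (kern (fst z) (snd z) * (\<bar>g (fst z)\<bar> * \<bar>g (snd z)\<bar>)) \<le> h (fst z) (snd z) + h (snd z) (fst z)"
      using AEp
    proof eventually_elim
      case (elim z)
      define a where "a = ?\<phi> (fst z)"
      define b where "b = ?\<phi> (snd z)"
      define p where "p = \<bar>g (fst z)\<bar>"
      define q where "q = \<bar>g (snd z)\<bar>"
      have ab: "a > 0" "b > 0" using elim by (auto simp: a_def b_def)
      \<comment> \<open>The mean inequality in quotient form: the square vanishes when g is
        proportional to \<phi>, which is how the sharp constant survives.\<close>
      have "0 \<le> (p * b - q * a)\<^sup>2 / (2 * a * b)" using ab by simp
      also have "\<dots> = p\<^sup>2 / (2 * a) * b + q\<^sup>2 / (2 * b) * a - p * q"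
        using ab by (simp add: field_simps power2_eq_square)
      finally have "p * q \<le> p\<^sup>2 / (2 * a) * b + q\<^sup>2 / (2 * b) * a" by simp
      then have "kern (fst z) (snd z) * (p * q) \<le> kern (fst z) (snd z) * (p\<^sup>2 / (2 * a) * b + q\<^sup>2 / (2 * b) * a)"
        using kern_nonneg by (rule mult_left_mono)
      then have "ennreal (kern (fst z) (snd z) * (p * q)) \<le> ennreal (kern (fst z) (snd z) * (p\<^sup>2 / (2 * a) * b) + kern (snd z) (fst z) * (q\<^sup>2 / (2 * b) * a))"
        by (intro ennreal_leI) (simp add: distrib_left kern_sym[of "snd z"])
      also have "\<dots> = h (fst z) (snd z) + h (snd z) (fst z)"
        unfolding h_def using ab kern_nonneg by (subst ennreal_plus) (auto simp: p_def q_def a_def b_def)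
      finally show ?case by (simp add: p_def q_def)
    qed
  qed
  also have "\<dots> = (\<integral>\<^sup>+z. h (fst z) (snd z) \<partial>surf2) + (\<integral>\<^sup>+z. h (snd z) (fst z) \<partial>surf2)"
    by (rule nn_integral_add) (rule sphere_pair_measurable, measurable)+
  also have "(\<integral>\<^sup>+z. h (snd z) (fst z) \<partial>surf2) = (\<integral>\<^sup>+z. h (fst z) (snd z) \<partial>surf2)"
  proof -
    have "(\<lambda>z. h (snd z) (fst z)) \<in> borel_measurable surf2" "(\<lambda>z. h (fst z) (snd z)) \<in> borel_measurable surf2"
      by (rule sphere_pair_measurable, measurable)+
    then show ?thesis
      using sphere_pair.nn_integral_snd[of "\<lambda>z. h (snd z) (fst z)"] sphere.nn_integral_fst[of "\<lambda>z. h (fst z) (snd z)" surf] by simp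
  qed
  also have "(\<integral>\<^sup>+z. h (fst z) (snd z) \<partial>surf2) = (\<integral>\<^sup>+x. (\<integral>\<^sup>+y. h x y \<partial>surf) \<partial>surf)"
  proof -
    have "(\<lambda>z. h (fst z) (snd z)) \<in> borel_measurable surf2" by (rule sphere_pair_measurable) measurable
    then show ?thesis using sphere.nn_integral_fst[of "\<lambda>z. h (fst z) (snd z)" surf] by simp
  qed
  also have "\<dots> = (\<integral>\<^sup>+x. ennreal (1 / (2 * qconst)) * ennreal (?W x * (f x)\<^sup>2) \<partial>surf)"
  proof (rule nn_integral_cong_AE)
    show "AE x in surf. (\<integral>\<^sup>+y. h x y \<partial>surf) = ennreal (1 / (2 * qconst)) * ennreal (?W x * (f x)\<^sup>2)"
      using kern_ground_state AE_sphere_perp_pos[OF N, of i]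
    proof eventually_elim
      case (elim x)
      have c0: "(g x)\<^sup>2 / (2 * ?\<phi> x) \<ge> 0" by simp
      have "(\<integral>\<^sup>+y. h x y \<partial>surf) = (\<integral>\<^sup>+y. ennreal ((g x)\<^sup>2 / (2 * ?\<phi> x)) * ennreal (kern x y * ?\<phi> y) \<partial>surf)"
        unfolding h_def ennreal_mult'[OF c0, symmetric] by (simp add: mult_ac)
      also have "\<dots> = ennreal ((g x)\<^sup>2 / (2 * ?\<phi> x)) * (\<integral>\<^sup>+y. ennreal (kern x y * ?\<phi> y) \<partial>surf)"
        by (rule nn_integral_cmult, rule borel_measurable_sphere) measurable
      also have "\<dots> = ennreal ((g x)\<^sup>2 / (2 * ?\<phi> x) * (?\<psi> x / qconst))"
        unfolding elim(1) by (rule ennreal_mult'[OF c0, symmetric])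
      also have "(g x)\<^sup>2 / (2 * ?\<phi> x) * (?\<psi> x / qconst) = 1 / (2 * qconst) * (?W x * (f x)\<^sup>2)"
      proof -
        have "?\<phi> x = ?W x * ?\<psi> x" by (simp flip: powr_add)
        moreover have "?W x > 0" "?\<psi> x > 0" using elim by auto
        ultimately show ?thesis unfolding g_def by (simp add: power_mult_distrib power2_eq_square field_simps)
      qed
      also have "ennreal \<dots> = ennreal (1 / (2 * qconst)) * ennreal (?W x * (f x)\<^sup>2)"
        using qconst_pos by (intro ennreal_mult) auto
      finally show ?case .
    qed
  qed
  also have "\<dots> = ennreal (1 / (2 * qconst)) * (\<integral>\<^sup>+x. ennreal (?W x * (f x)\<^sup>2) \<partial>surf)"
    by (rule nn_integral_cmult, rule borel_measurable_sphere) measurable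
  also have "\<dots> + \<dots> = ennreal (1 / qconst) * (\<integral>\<^sup>+x. ennreal (?W x * (f x)\<^sup>2) \<partial>surf)"
  proof -
    have "ennreal (1 / qconst) = ennreal (1 / (2 * qconst)) + ennreal (1 / (2 * qconst))"
      using qconst_pos by (subst ennreal_plus[symmetric]) auto
    then show ?thesis by (simp add: distrib_right)
  qed
  finally show ?thesis .
qed

lemma AE_pair_abs_inner_less: "AE z in surf2. \<bar>fst z \<bullet> snd z\<bar> < 1"
proof (rule AE_sphere_pair)
  show "AE y in surf. \<bar>x \<bullet> y\<bar> < 1" if "x \<in> sphere 0 1" for x
    using AE_sphere_abs_inner_less[OF N, of x] that by simp
qed measurable

text \<open>Positive definiteness is inherited from the powers of the inner product, since
  \<open>(1 - r s)\<^sup>-\<^sup>2\<^sup>\<beta>\<close> has nonnegative Taylor coefficients, by letting \<open>r\<close> tend to 1.\<close>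

lemma kern_positive_definite:
  fixes w :: "real^'n \<Rightarrow> real"
  assumes w: "integrable surf w" and wm[measurable]: "w \<in> borel_measurable borel"
    and int: "integrable surf2 (\<lambda>z. kern (fst z) (snd z) * (w (fst z) * w (snd z)))"
  shows "0 \<le> (LINT z|surf2. kern (fst z) (snd z) * (w (fst z) * w (snd z)))"
proof -
  let ?c = "\<lambda>k. pochhammer (2 * \<beta>) k / fact k"
  let ?ww = "\<lambda>z. w (fst z) * w (snd z)"
  have c0: "?c k \<ge> 0" for k using bd by (simp add: pochhammer_nonneg)
  have wwi: "integrable surf2 ?ww" by (rule integrable_sphere_pair_mult[OF w w])
  have AEs: "AE z in surf2. \<bar>fst z \<bullet> snd z\<bar> < 1" by (rule AE_pair_abs_inner_less)
  have step: "0 \<le> (LINT z|surf2. (1 - r * (fst z \<bullet> snd z)) powr (- 2 * \<beta>) * ?ww z)" if r: "0 < r" "r < 1" for r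
  proof -
    let ?s = "\<lambda>m z. \<Sum>k<m. ?c k * r ^ k * ((fst z \<bullet> snd z) ^ k * ?ww z)"
    have "(\<lambda>m. LINT z|surf2. ?s m z) \<longlonglongrightarrow> (LINT z|surf2. (1 - r * (fst z \<bullet> snd z)) powr (- 2 * \<beta>) * ?ww z)"
    proof (rule integral_dominated_convergence)
      show "(\<lambda>z. (1 - r * (fst z \<bullet> snd z)) powr (- 2 * \<beta>) * ?ww z) \<in> borel_measurable surf2" by (rule sphere_pair_measurable) measurable
      show "(\<lambda>z. ?s m z) \<in> borel_measurable surf2" for m by (rule sphere_pair_measurable) measurable
      \<comment> \<open>For fixed r < 1 the kernel is bounded, so this crude majorant suffices;
        integrability against \<open>kern\<close> enters only in the limit r -> 1.\<close>
      show "integrable surf2 (\<lambda>z. (1 - r) powr (- (2 * \<beta>)) * \<bar>?ww z\<bar>)" using wwi by simp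
      show "AE z in surf2. (\<lambda>m. ?s m z) \<longlonglongrightarrow> (1 - r * (fst z \<bullet> snd z)) powr (- 2 * \<beta>) * ?ww z"
        using AEs
      proof eventually_elim
        case (elim z)
        have "r * \<bar>fst z \<bullet> snd z\<bar> < 1 * 1" using r elim by (intro mult_strict_mono) auto
        then have "\<bar>r * (fst z \<bullet> snd z)\<bar> < 1" using r by (simp add: abs_mult)
        then have "(\<lambda>k. ?c k * (r * (fst z \<bullet> snd z)) ^ k * ?ww z) sums ((1 - r * (fst z \<bullet> snd z)) powr (- (2 * \<beta>)) * ?ww z)"
          by (intro sums_mult2 sums_one_minus_powr)
        then show ?case unfolding sums_def by (simp add: power_mult_distrib mult_ac)
      qed
      show "AE z in surf2. norm (?s m z) \<le> (1 - r) powr (- (2 * \<beta>)) * \<bar>?ww z\<bar>" for m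
        using AEs
      proof eventually_elim
        case (elim z)
        have s: "(\<lambda>k. ?c k * r ^ k) sums (1 - r) powr (- (2 * \<beta>))" using r by (intro sums_one_minus_powr) auto
        have "norm (?s m z) \<le> (\<Sum>k<m. norm (?c k * r ^ k * ((fst z \<bullet> snd z) ^ k * ?ww z)))" by (rule norm_sum)
        also have "\<dots> \<le> (\<Sum>k<m. ?c k * r ^ k * \<bar>?ww z\<bar>)"
        proof (rule sum_mono)
          fix k
          have cr: "?c k * r ^ k \<ge> 0" using c0[of k] r by (intro mult_nonneg_nonneg) auto
          have "\<bar>fst z \<bullet> snd z\<bar> ^ k \<le> 1" using elim by (intro power_le_one) auto
          then have "\<bar>fst z \<bullet> snd z\<bar> ^ k * \<bar>?ww z\<bar> \<le> \<bar>?ww z\<bar>" by (intro mult_left_le_one_le) auto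
          then have "?c k * r ^ k * (\<bar>fst z \<bullet> snd z\<bar> ^ k * \<bar>?ww z\<bar>) \<le> ?c k * r ^ k * \<bar>?ww z\<bar>" by (rule mult_left_mono[OF _ cr])
          moreover have "norm (?c k * r ^ k * ((fst z \<bullet> snd z) ^ k * ?ww z)) = ?c k * r ^ k * (\<bar>fst z \<bullet> snd z\<bar> ^ k * \<bar>?ww z\<bar>)"
            by (simp only: real_norm_def abs_mult[of "?c k * r ^ k"] abs_of_nonneg[OF cr] abs_mult[of "(fst z \<bullet> snd z) ^ k"] power_abs)
          ultimately show "norm (?c k * r ^ k * ((fst z \<bullet> snd z) ^ k * ?ww z)) \<le> ?c k * r ^ k * \<bar>?ww z\<bar>" by simp
        qed
        also have "\<dots> = (\<Sum>k<m. ?c k * r ^ k) * \<bar>?ww z\<bar>" by (simp add: sum_distrib_right)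
        also have "\<dots> \<le> (1 - r) powr (- (2 * \<beta>)) * \<bar>?ww z\<bar>"
          unfolding sums_unique[OF s] using r
          by (intro mult_right_mono sum_le_suminf sums_summable[OF s] mult_nonneg_nonneg c0) auto
        finally show ?case .
      qed
    qed
    moreover have "0 \<le> (LINT z|surf2. ?s m z)" for m
    proof -
      have "(LINT z|surf2. ?s m z) = (\<Sum>k<m. ?c k * r ^ k * (LINT z|surf2. (fst z \<bullet> snd z) ^ k * ?ww z))"
        using inner_power_positive_definite[OF w] by (subst Bochner_Integration.integral_sum) auto
      also have "\<dots> \<ge> 0" using inner_power_positive_definite[OF w] r by (intro sum_nonneg mult_nonneg_nonneg c0) auto
      finally show ?thesis .
    qed
    ultimately show ?thesis by (intro LIMSEQ_le_const) auto
  qed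
  define \<kappa> where "\<kappa> = kconst TYPE('n) \<beta> \<delta>"
  have \<kappa>: "\<kappa> > 0" unfolding \<kappa>_def by (rule kconst_pos[OF bd])
  have k1: "(1 - fst z \<bullet> snd z) powr (- 2 * \<beta>) = \<kappa> * kern (fst z) (snd z)" for z :: "(real^'n) \<times> (real^'n)"
    unfolding kern_def \<kappa>_def[symmetric] using \<kappa> by simp
  define r where "r m = 1 - 1 / (real m + 2)" for m :: nat
  \<comment> \<open>The lower bound 1/2 yields 1 - rs >= (1 - s)/2 for |s| < 1, so a multiple of the
    limit kernel dominates all the approximating kernels.\<close>
  have r: "0 < r m" "1 / 2 \<le> r m" "r m < 1" for m unfolding r_def by (auto simp: field_simps)
  have rlim: "r \<longlonglongrightarrow> 1"
  proof -
    have "(\<lambda>m. 1 / (real m + 2)) \<longlonglongrightarrow> 0" using LIMSEQ_ignore_initial_segment[OF lim_1_over_n, of 2] by (simp add: add.commute)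
    from tendsto_diff[OF tendsto_const[of 1] this] show ?thesis by (simp add: r_def[abs_def])
  qed
  have "(\<lambda>m. LINT z|surf2. (1 - r m * (fst z \<bullet> snd z)) powr (- 2 * \<beta>) * ?ww z) \<longlonglongrightarrow> (LINT z|surf2. (1 - fst z \<bullet> snd z) powr (- 2 * \<beta>) * ?ww z)"
  proof (rule integral_dominated_convergence)
    show "(\<lambda>z. (1 - fst z \<bullet> snd z) powr (- 2 * \<beta>) * ?ww z) \<in> borel_measurable surf2" by (rule sphere_pair_measurable) measurable
    show "(\<lambda>z. (1 - r m * (fst z \<bullet> snd z)) powr (- 2 * \<beta>) * ?ww z) \<in> borel_measurable surf2" for m by (rule sphere_pair_measurable) measurable
    show "integrable surf2 (\<lambda>z. 2 powr (2 * \<beta>) * \<kappa> * \<bar>kern (fst z) (snd z) * ?ww z\<bar>)" using int by simp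
    show "AE z in surf2. (\<lambda>m. (1 - r m * (fst z \<bullet> snd z)) powr (- 2 * \<beta>) * ?ww z) \<longlonglongrightarrow> (1 - fst z \<bullet> snd z) powr (- 2 * \<beta>) * ?ww z"
      using AEs
    proof eventually_elim
      case (elim z)
      have "(\<lambda>m. (1 - r m * (fst z \<bullet> snd z)) powr (- 2 * \<beta>) * ?ww z) \<longlonglongrightarrow> (1 - 1 * (fst z \<bullet> snd z)) powr (- 2 * \<beta>) * ?ww z"
        using elim by (intro tendsto_intros rlim) auto
      then show ?case by simp
    qed
    show "AE z in surf2. norm ((1 - r m * (fst z \<bullet> snd z)) powr (- 2 * \<beta>) * ?ww z) \<le> 2 powr (2 * \<beta>) * \<kappa> * \<bar>kern (fst z) (snd z) * ?ww z\<bar>" for m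
      using AEs
    proof eventually_elim
      case (elim z)
      let ?t = "fst z \<bullet> snd z"
      have "(1 - ?t) / 2 \<le> 1 - r m * ?t"
      proof -
        have "\<bar>(r m - 1 / 2) * ?t\<bar> \<le> (1 / 2) * 1" unfolding abs_mult using r[of m] elim by (intro mult_mono) auto
        then have "(r m - 1 / 2) * ?t \<le> 1 / 2" by linarith
        then show ?thesis by (simp add: field_simps)
      qed
      then have "(1 - r m * ?t) powr (- 2 * \<beta>) \<le> ((1 - ?t) / 2) powr (- 2 * \<beta>)"
        using elim bd by (intro powr_mono2') auto
      also have "\<dots> = 2 powr (2 * \<beta>) * (1 - ?t) powr (- 2 * \<beta>)"
        using elim by (simp add: powr_divide powr_minus_divide)
      finally have "(1 - r m * ?t) powr (- 2 * \<beta>) \<le> 2 powr (2 * \<beta>) * \<kappa> * kern (fst z) (snd z)"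
        unfolding k1 by simp
      then have "(1 - r m * ?t) powr (- 2 * \<beta>) * \<bar>?ww z\<bar> \<le> 2 powr (2 * \<beta>) * \<kappa> * kern (fst z) (snd z) * \<bar>?ww z\<bar>"
        by (rule mult_right_mono) simp
      then show ?case using kern_nonneg[of "fst z" "snd z"] by (simp add: abs_mult mult.assoc)
    qed
  qed
  then have "0 \<le> (LINT z|surf2. (1 - fst z \<bullet> snd z) powr (- 2 * \<beta>) * ?ww z)"
    using step[OF r(1,3)] by (intro LIMSEQ_le_const) auto
  also have "\<dots> = \<kappa> * (LINT z|surf2. kern (fst z) (snd z) * ?ww z)"
    unfolding k1 by (simp add: mult.assoc)
  finally show ?thesis using \<kappa> by (simp add: zero_le_mult_iff)
qed

lemma hardy_polynomial:
  fixes Y :: "nat \<Rightarrow> real^'n \<Rightarrow> real" and M :: nat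
  assumes Y: "\<And>n. Y n \<in> sph_harm n"
  defines "f \<equiv> (\<lambda>x. \<Sum>n\<le>M. Y n x)"
  shows "ennreal qconst * (\<integral>\<^sup>+y. ennreal (perp i y powr (- (\<delta> - \<beta>)) * (f y)\<^sup>2) \<partial>surf)
    \<le> ennreal (\<Sum>n\<le>M. acoef \<beta> \<delta> n * (LINT x|surf. (Y n x)\<^sup>2))"
proof -
  let ?W = "\<lambda>y. perp i y powr (- (\<delta> - \<beta>))" and ?K = "\<lambda>z. kern (fst z) (snd z)" and ?a = "acoef \<beta> \<delta>"
  \<comment> \<open>This is A_sigma f. The kernel divides the n-th component by the same
    coefficient, so its image is f exactly.\<close>
  define u where "u x = (\<Sum>n\<le>M. ?a n * Y n x)" for x
  define g where "g y = ?W y * f y" for y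
  have hY: "hp n (Y n)" for n by (rule sph_harm_hp[OF Y])
  have Ym[measurable]: "Y n \<in> borel_measurable borel" for n by (rule hp_measurable[OF hY])
  have fm[measurable]: "f \<in> borel_measurable borel" unfolding f_def by measurable
  have um[measurable]: "u \<in> borel_measurable borel" unfolding u_def[abs_def] by measurable
  have gm[measurable]: "g \<in> borel_measurable borel" unfolding g_def[abs_def] by measurable
  have fc: "continuous_on UNIV f" unfolding f_def by (intro continuous_on_sum hp_continuous[OF hY])
  have \<gamma>: "0 < \<delta> - \<beta>" "\<delta> - \<beta> < (real CARD('n) - 1) / 2" using bd dsum by auto
  have Wi: "integrable surf ?W" by (rule perp_powr_integrable[OF N \<gamma>])
  have gi: "integrable surf g" unfolding g_def[abs_def] by (rule integrable_mult_continuous_sphere[OF Wi fc])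
  have Wfi: "integrable surf (\<lambda>y. ?W y * (f y)\<^sup>2)"
    by (rule integrable_mult_continuous_sphere[OF Wi continuous_on_power[OF fc]])
  have ui: "integrable surf u" unfolding u_def[abs_def] by (intro Bochner_Integration.integrable_sum integrable_mult_right hp_integrable_sphere[OF hY])
  have Wf: "(\<integral>\<^sup>+y. ennreal (?W y * (f y)\<^sup>2) \<partial>surf) = ennreal (LINT y|surf. ?W y * (f y)\<^sup>2)"
    using Wfi by (intro nn_integral_eq_integral) auto
  define I where "I = (LINT y|surf. ?W y * (f y)\<^sup>2)"
  have I0: "I \<ge> 0" unfolding I_def by (intro Bochner_Integration.integral_nonneg) simp
  have Bu: "integrable surf2 (\<lambda>z. ?K z * (q (fst z) * u (snd z)))" "(LINT z|surf2. ?K z * (q (fst z) * u (snd z))) = (LINT x|surf. q x * f x)"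
    if q: "integrable surf q" "q \<in> borel_measurable borel" for q
  proof -
    have e: "?K z * (q (fst z) * u (snd z)) = (\<Sum>n\<le>M. ?a n * (?K z * (q (fst z) * Y n (snd z))))" for z
      by (simp add: u_def sum_distrib_left mult_ac)
    note k = kern_pair_integral[OF q Y]
    show "integrable surf2 (\<lambda>z. ?K z * (q (fst z) * u (snd z)))"
      unfolding e by (intro Bochner_Integration.integrable_sum integrable_mult_right k)
    have qY: "integrable surf (\<lambda>x. q x * Y n x)" for n by (rule integrable_mult_hp_sphere[OF q(1) hY])
    have "(LINT z|surf2. ?K z * (q (fst z) * u (snd z))) = (\<Sum>n\<le>M. ?a n * (LINT z|surf2. ?K z * (q (fst z) * Y n (snd z))))"
      unfolding e by (subst Bochner_Integration.integral_sum) (auto intro!: integrable_mult_right k)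
    also have "\<dots> = (\<Sum>n\<le>M. (LINT x|surf. q x * Y n x))"
    proof (intro sum.cong refl)
      fix n
      have "?a n \<noteq> 0" using acoef_pos[OF bd, of n] by simp
      then show "?a n * (LINT z|surf2. ?K z * (q (fst z) * Y n (snd z))) = (LINT x|surf. q x * Y n x)" unfolding k(2) by simp
    qed
    also have "\<dots> = (LINT x|surf. (\<Sum>n\<le>M. q x * Y n x))" by (rule Bochner_Integration.integral_sum[symmetric]) (rule qY)
    also have "\<dots> = (LINT x|surf. q x * f x)" by (simp add: f_def sum_distrib_left)
    finally show "(LINT z|surf2. ?K z * (q (fst z) * u (snd z))) = (LINT x|surf. q x * f x)" .
  qed
  have uf: "(LINT x|surf. u x * f x) = (\<Sum>n\<le>M. ?a n * (LINT x|surf. (Y n x)\<^sup>2))"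
  proof -
    have ii: "integrable surf (\<lambda>x. Y n x * Y m x)" for n m by (rule hp_integrable_sphere[OF hp_mult[OF hY hY]])
    have "(LINT x|surf. u x * f x) = (LINT x|surf. (\<Sum>n\<le>M. \<Sum>m\<le>M. ?a n * (Y n x * Y m x)))"
      by (simp only: u_def f_def sum_product mult.assoc)
    also have "\<dots> = (\<Sum>n\<le>M. \<Sum>m\<le>M. ?a n * (LINT x|surf. Y n x * Y m x))"
      using ii by (simp add: Bochner_Integration.integral_sum Bochner_Integration.integrable_sum)
    also have "\<dots> = (\<Sum>n\<le>M. \<Sum>m\<le>M. if n = m then ?a n * (LINT x|surf. (Y n x)\<^sup>2) else 0)"
      by (intro sum.cong refl) (auto simp: power2_eq_square sph_harm_orthogonal[OF Y Y])
    also have "\<dots> = (\<Sum>n\<le>M. ?a n * (LINT x|surf. (Y n x)\<^sup>2))" by simp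
    finally show ?thesis .
  qed
  have gf: "(LINT x|surf. g x * f x) = I" by (simp add: g_def I_def power2_eq_square mult.assoc)
  have gu: "integrable surf2 (\<lambda>z. ?K z * (u (fst z) * g (snd z)))" "(LINT z|surf2. ?K z * (u (fst z) * g (snd z))) = I"
  proof -
    note b = Bu[OF gi gm]
    show "integrable surf2 (\<lambda>z. ?K z * (u (fst z) * g (snd z)))"
      using sphere_pair.integrable_product_swap[OF b(1)] by (simp add: case_prod_unfold kern_sym[of "snd _"] mult_ac)
    have "(LINT z|surf2. ?K z * (u (fst z) * g (snd z))) = (LINT z|surf2. ?K z * (g (fst z) * u (snd z)))"
      using sphere_pair.integral_product_swap[of "\<lambda>z. ?K z * (g (fst z) * u (snd z))"] b(1)
      by (simp add: case_prod_unfold kern_sym[of "snd _"] mult_ac)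
    then show "(LINT z|surf2. ?K z * (u (fst z) * g (snd z))) = I" using b(2) gf by simp
  qed
  have schur: "(\<integral>\<^sup>+z. ennreal (?K z * (\<bar>g (fst z)\<bar> * \<bar>g (snd z)\<bar>)) \<partial>surf2) \<le> ennreal (I / qconst)"
  proof -
    have "(\<integral>\<^sup>+z. ennreal (?K z * (\<bar>g (fst z)\<bar> * \<bar>g (snd z)\<bar>)) \<partial>surf2) \<le> ennreal (1 / qconst) * ennreal I"
      using kern_schur[OF fm] unfolding Wf I_def[symmetric] g_def[symmetric] .
    also have "\<dots> = ennreal (I / qconst)" using I0 qconst_pos by (simp flip: ennreal_mult)
    finally show ?thesis .
  qed
  have gg: "integrable surf2 (\<lambda>z. ?K z * (g (fst z) * g (snd z)))"
  proof (rule integrableI_bounded)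
    show "(\<lambda>z. ?K z * (g (fst z) * g (snd z))) \<in> borel_measurable surf2" by (rule sphere_pair_measurable) measurable
    have "(\<integral>\<^sup>+z. ennreal (norm (?K z * (g (fst z) * g (snd z)))) \<partial>surf2) = (\<integral>\<^sup>+z. ennreal (?K z * (\<bar>g (fst z)\<bar> * \<bar>g (snd z)\<bar>)) \<partial>surf2)"
      using kern_nonneg by (simp add: abs_mult)
    also have "\<dots> < \<infinity>" using schur by (rule le_less_trans) simp
    finally show "(\<integral>\<^sup>+z. ennreal (norm (?K z * (g (fst z) * g (snd z)))) \<partial>surf2) < \<infinity>" .
  qed
  have ggI: "(LINT z|surf2. ?K z * (g (fst z) * g (snd z))) \<le> I / qconst"
  proof -
    have "(LINT z|surf2. ?K z * (g (fst z) * g (snd z))) \<le> (LINT z|surf2. \<bar>?K z * (g (fst z) * g (snd z))\<bar>)"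
      using gg by (intro integral_mono) auto
    moreover have "ennreal (LINT z|surf2. \<bar>?K z * (g (fst z) * g (snd z))\<bar>) = (\<integral>\<^sup>+z. ennreal (?K z * (\<bar>g (fst z)\<bar> * \<bar>g (snd z)\<bar>)) \<partial>surf2)"
    proof -
      have "ennreal (LINT z|surf2. \<bar>?K z * (g (fst z) * g (snd z))\<bar>) = (\<integral>\<^sup>+z. ennreal \<bar>?K z * (g (fst z) * g (snd z))\<bar> \<partial>surf2)"
        by (rule nn_integral_eq_integral[symmetric, OF integrable_abs[OF gg]]) simp
      then show ?thesis using kern_nonneg by (simp add: abs_mult)
    qed
    ultimately show ?thesis using schur I0 qconst_pos by (smt (verit) divide_nonneg_pos ennreal_le_iff)
  qed
  \<comment> \<open>Subtracting c times g gives the form <u,f> - 2cI plus at most c^2 I/Q; the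
    choice c = Q minimises this bound and leaves <u,f> - QI.\<close>
  define w where "w x = u x - qconst * g x" for x
  have wi: "integrable surf w" unfolding w_def[abs_def] using ui gi by simp
  have wm: "w \<in> borel_measurable borel" unfolding w_def[abs_def] by measurable
  note uu = Bu[OF ui um] and gu' = Bu[OF gi gm]
  have we: "?K z * (w (fst z) * w (snd z)) = ?K z * (u (fst z) * u (snd z)) - qconst * (?K z * (u (fst z) * g (snd z)))
      - qconst * (?K z * (g (fst z) * u (snd z))) + qconst\<^sup>2 * (?K z * (g (fst z) * g (snd z)))" for z
    by (simp add: w_def algebra_simps power2_eq_square)
  have "integrable surf2 (\<lambda>z. ?K z * (w (fst z) * w (snd z)))"
    unfolding we using uu(1) gu(1) gu'(1) gg by (intro Bochner_Integration.integrable_add Bochner_Integration.integrable_diff integrable_mult_right)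
  from kern_positive_definite[OF wi wm this]
  have "0 \<le> (LINT x|surf. u x * f x) - qconst * I - qconst * I + qconst\<^sup>2 * (LINT z|surf2. ?K z * (g (fst z) * g (snd z)))"
    unfolding we using uu gu gu' gg gf by simp
  also have "\<dots> \<le> (LINT x|surf. u x * f x) - qconst * I - qconst * I + qconst\<^sup>2 * (I / qconst)"
    using ggI by (intro add_left_mono mult_left_mono) auto
  also have "\<dots> = (LINT x|surf. u x * f x) - qconst * I" using qconst_pos by (simp add: power2_eq_square)
  finally have "qconst * I \<le> (\<Sum>n\<le>M. ?a n * (LINT x|surf. (Y n x)\<^sup>2))" unfolding uf by simp
  moreover have "ennreal qconst * ennreal I = ennreal (qconst * I)" using qconst_pos I0 by (intro ennreal_mult[symmetric]) auto
  ultimately show ?thesis unfolding Wf I_def[symmetric] by (simp add: ennreal_leI)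
qed

end

subsection \<open>Passage to general functions\<close>

text \<open>Log-convexity of Gamma between z and z + 1, with Gamma(z + 1) = z Gamma(z). It lets the
  Sobolev weight dominate the eigenvalues of A_sigma.\<close>

lemma Gamma_ratio_le_powr:
  fixes z s :: real
  assumes z: "z > 0" and s: "0 < s" "s < 1"
  shows "Gamma (z + s) / Gamma z \<le> z powr s"
proof -
  have pos: "Gamma z > 0" "Gamma (z + s) > 0" "Gamma (z + 1) > 0" using z s by auto
  have "(ln \<circ> Gamma) ((1 - s) *\<^sub>R z + s *\<^sub>R (z + 1)) \<le> (1 - s) * (ln \<circ> Gamma) z + s * (ln \<circ> Gamma) (z + 1)"
    using z s by (intro convex_onD[OF log_convex_Gamma_real]) auto
  moreover have "(1 - s) *\<^sub>R z + s *\<^sub>R (z + 1) = z + s" by (simp add: algebra_simps)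
  moreover have "Gamma (z + 1) = z * Gamma z"
    using z by (intro Gamma_plus1) (auto elim!: nonpos_Ints_cases)
  ultimately have "ln (Gamma (z + s)) \<le> (1 - s) * ln (Gamma z) + s * ln (z * Gamma z)" by simp
  also have "ln (z * Gamma z) = ln z + ln (Gamma z)" using z pos by (intro ln_mult_pos)
  also have "(1 - s) * ln (Gamma z) + s * (ln z + ln (Gamma z)) = ln (Gamma z) + ln (z powr s)"
    using z by (simp add: ln_powr algebra_simps)
  also have "\<dots> = ln (Gamma z * z powr s)" using z pos by (intro ln_mult_pos[symmetric]) auto
  finally have "ln (Gamma (z + s)) \<le> ln (Gamma z * z powr s)" .
  then have "Gamma (z + s) \<le> Gamma z * z powr s" using z pos by (subst (asm) ln_le_cancel_iff) auto
  then show ?thesis using pos by (simp add: field_simps)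
qed

text \<open>A substitute for Cauchy-Schwarz on a finite measure space: for every e > 0, |t| is at
  most e or at most t^2/e.\<close>

lemma L1_norm_le_L2s:
  fixes h :: "real^'n \<Rightarrow> real"
  assumes h: "L2s h" and e: "e > 0"
  shows "(LINT x|sphere_measure. \<bar>h x\<bar>) \<le> e * measure (sphere_measure :: (real^'n) measure) (sphere 0 1) + (LINT x|sphere_measure. (h x)\<^sup>2) / e"
proof -
  have "\<bar>t\<bar> \<le> e + t\<^sup>2 / e" for t :: real
  proof (cases "\<bar>t\<bar> \<le> e")
    case False
    then have "\<bar>t\<bar> * e \<le> \<bar>t\<bar> * \<bar>t\<bar>" by (intro mult_left_mono) auto
    then have "\<bar>t\<bar> \<le> t\<^sup>2 / e" using e by (simp add: field_simps power2_eq_square)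
    then show ?thesis using e by linarith
  qed (use e in \<open>auto intro: order_trans\<close>)
  then have "(LINT x|sphere_measure. \<bar>h x\<bar>) \<le> (LINT x|sphere_measure. e + (h x)\<^sup>2 / e)"
    using h L2s_integrable[OF h] by (intro integral_mono) (auto simp: L2s_def)
  also have "\<dots> = e * measure (sphere_measure :: (real^'n) measure) (sphere 0 1) + (LINT x|sphere_measure. (h x)\<^sup>2) / e"
    using h by (simp add: L2s_def space_sphere_measure)
  finally show ?thesis .
qed

section \<open>Almost everywhere convergence of the harmonic expansion\<close>

context
  fixes f :: "real^'n \<Rightarrow> real"
  assumes N: "CARD('n) \<ge> 3" and f: "L2s f"
begin

abbreviation "prj n \<equiv> proj_H n f"

definition partial :: "nat \<Rightarrow> real^'n \<Rightarrow> real" where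
  "partial M x = (\<Sum>n\<le>M. prj n x)"

lemma prj_harm: "prj n \<in> sph_harm n"
  by (rule proj_H_properties(1)[OF f N])

lemma prj_L2s: "L2s (prj n)"
  by (rule hp_L2s[OF sph_harm_hp[OF prj_harm]])

lemma partial_L2s: "L2s (partial M)"
  unfolding partial_def[abs_def] by (intro L2s_sum prj_L2s) auto

lemma sum_prj_L2s: "finite A \<Longrightarrow> L2s (\<lambda>x. \<Sum>n\<in>A. prj n x)"
  by (intro L2s_sum prj_L2s)

lemma integral_f_harm:
  assumes "Y \<in> sph_harm n"
  shows "(LINT x|sphere_measure. f x * Y x) = (LINT x|sphere_measure. prj n x * Y x)"
proof -
  have LY: "L2s Y" by (rule hp_L2s[OF sph_harm_hp[OF assms]])
  have "0 = (LINT x|sphere_measure. (f x - prj n x) * Y x)" using proj_H_properties(2)[OF f N assms] by simp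
  also have "\<dots> = (LINT x|sphere_measure. f x * Y x) - (LINT x|sphere_measure. prj n x * Y x)"
    using L2s_mult_integrable[OF f LY] L2s_mult_integrable[OF prj_L2s LY] by (simp add: left_diff_distrib)
  finally show ?thesis by simp
qed

lemma integral_partial_harm:
  assumes "Y \<in> sph_harm n" "n \<le> M"
  shows "(LINT x|sphere_measure. partial M x * Y x) = (LINT x|sphere_measure. f x * Y x)"
proof -
  have LY: "L2s Y" by (rule hp_L2s[OF sph_harm_hp[OF assms(1)]])
  have "(LINT x|sphere_measure. partial M x * Y x) = (\<Sum>m\<le>M. (LINT x|sphere_measure. prj m x * Y x))"
    using L2s_mult_integrable[OF prj_L2s LY] by (simp add: partial_def sum_distrib_right Bochner_Integration.integral_sum)
  also have "\<dots> = (\<Sum>m\<le>M. if n = m then (LINT x|sphere_measure. prj n x * Y x) else 0)"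
    by (intro sum.cong refl) (auto simp: sph_harm_orthogonal[OF prj_harm assms(1)])
  also have "\<dots> = (LINT x|sphere_measure. f x * Y x)" using assms(2) integral_f_harm[OF assms(1)] by simp
  finally show ?thesis .
qed

lemma proj_norm2_nonneg: "proj_norm2 n f \<ge> 0"
  unfolding proj_norm2_def by (intro Bochner_Integration.integral_nonneg) simp

lemma integral_sum_prj_squared:
  assumes "finite A"
  shows "(LINT x|sphere_measure. (\<Sum>n\<in>A. prj n x)\<^sup>2) = (\<Sum>n\<in>A. proj_norm2 n f)"
proof -
  have i: "integrable sphere_measure (\<lambda>x. prj n x * prj m x)" for n m by (rule L2s_mult_integrable[OF prj_L2s prj_L2s])
  have "(LINT x|sphere_measure. (\<Sum>n\<in>A. prj n x)\<^sup>2) = (LINT x|sphere_measure. (\<Sum>n\<in>A. \<Sum>m\<in>A. prj n x * prj m x))"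
    by (simp only: power2_eq_square sum_product)
  also have "\<dots> = (\<Sum>n\<in>A. \<Sum>m\<in>A. (LINT x|sphere_measure. prj n x * prj m x))"
    using i by (simp add: Bochner_Integration.integral_sum Bochner_Integration.integrable_sum)
  also have "\<dots> = (\<Sum>n\<in>A. \<Sum>m\<in>A. if n = m then proj_norm2 n f else 0)"
    by (intro sum.cong refl) (auto simp: sph_harm_orthogonal[OF prj_harm prj_harm] proj_norm2_def power2_eq_square)
  also have "\<dots> = (\<Sum>n\<in>A. proj_norm2 n f)" using assms by simp
  finally show ?thesis .
qed

lemma bessel: "summable (\<lambda>n. proj_norm2 n f)"
proof (rule summableI_nonneg_bounded)
  show "0 \<le> proj_norm2 n f" for n by (rule proj_norm2_nonneg)
  show "(\<Sum>n<M. proj_norm2 n f) \<le> (LINT x|sphere_measure. (f x)\<^sup>2)" for M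
  proof -
    let ?g = "\<lambda>x. \<Sum>n<M. prj n x"
    have Lg: "L2s ?g" by (rule sum_prj_L2s) simp
    have fg: "(LINT x|sphere_measure. f x * ?g x) = (\<Sum>n<M. proj_norm2 n f)"
    proof -
      have "(LINT x|sphere_measure. f x * ?g x) = (\<Sum>n<M. (LINT x|sphere_measure. f x * prj n x))"
        using L2s_mult_integrable[OF f prj_L2s] by (simp add: sum_distrib_left Bochner_Integration.integral_sum)
      then show ?thesis by (simp add: integral_f_harm[OF prj_harm] proj_norm2_def power2_eq_square)
    qed
    have "0 \<le> (LINT x|sphere_measure. (f x - ?g x)\<^sup>2)" by (intro Bochner_Integration.integral_nonneg) simp
    also have "\<dots> = (LINT x|sphere_measure. (f x)\<^sup>2 - 2 * (f x * ?g x) + (?g x)\<^sup>2)"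
      by (simp add: power2_diff algebra_simps)
    also have "\<dots> = (LINT x|sphere_measure. (f x)\<^sup>2) - 2 * (LINT x|sphere_measure. f x * ?g x) + (LINT x|sphere_measure. (?g x)\<^sup>2)"
      using f Lg L2s_mult_integrable[OF f Lg] by (simp add: L2s_def)
    also have "\<dots> = (LINT x|sphere_measure. (f x)\<^sup>2) - (\<Sum>n<M. proj_norm2 n f)"
      unfolding fg by (simp add: integral_sum_prj_squared)
    finally show ?thesis by simp
  qed
qed

text \<open>L1 is the norm in which an almost everywhere Cauchy subsequence is extracted below; the
  Bessel inequality provides the smallness in L2.\<close>

lemma partial_L1_Cauchy:
  assumes e: "e > 0"
  shows "\<exists>K. \<forall>i\<ge>K. \<forall>j\<ge>K. (LINT x|sphere_measure. norm (partial i x - partial j x)) < e"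
proof -
  define m where "m = measure (sphere_measure :: (real^'n) measure) (sphere 0 1)"
  have m: "m \<ge> 0" by (simp add: m_def)
  \<comment> \<open>The factor d is chosen so that the measure term stays below e/2, while an L2
    tail below d(e/2) contributes at most e/2 after division by d.\<close>
  define d where "d = e / (2 * (m + 1))"
  have d: "d > 0" using e m by (simp add: d_def)
  have dm: "d * m < e / 2" using e m by (simp add: d_def field_simps)
  from bessel have "\<forall>t>0. \<exists>K. \<forall>i\<ge>K. \<forall>j. norm (\<Sum>n=i..<j. proj_norm2 n f) < t" by (simp add: summable_Cauchy)
  then obtain K where K: "\<And>i j. i \<ge> K \<Longrightarrow> norm (\<Sum>n=i..<j. proj_norm2 n f) < d * (e / 2)"
    using d e by (metis half_gt_zero mult_pos_pos)
  have main: "(LINT x|sphere_measure. \<bar>partial i x - partial j x\<bar>) < e" if "j \<ge> K" "i \<ge> j" for i j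
  proof -
    have eq: "partial i x - partial j x = (\<Sum>n\<in>{Suc j..<Suc i}. prj n x)" for x
    proof -
      have "{..i} = {..j} \<union> {Suc j..<Suc i}" using that by auto
      then have "partial i x = partial j x + (\<Sum>n\<in>{Suc j..<Suc i}. prj n x)"
        unfolding partial_def by (simp only:) (rule sum.union_disjoint, auto)
      then show ?thesis by simp
    qed
    have L: "L2s (\<lambda>x. partial i x - partial j x)" by (intro L2s_diff partial_L2s)
    have "(LINT x|sphere_measure. \<bar>partial i x - partial j x\<bar>) \<le> d * m + (LINT x|sphere_measure. (partial i x - partial j x)\<^sup>2) / d"
      unfolding m_def by (rule L1_norm_le_L2s[OF L d])
    also have "(LINT x|sphere_measure. (partial i x - partial j x)\<^sup>2) = (\<Sum>n\<in>{Suc j..<Suc i}. proj_norm2 n f)"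
      unfolding eq by (rule integral_sum_prj_squared) simp
    also have "(\<Sum>n\<in>{Suc j..<Suc i}. proj_norm2 n f) \<le> d * (e / 2)" using K[of "Suc j" "Suc i"] that by simp
    finally have "(LINT x|sphere_measure. \<bar>partial i x - partial j x\<bar>) \<le> d * m + d * (e / 2) / d"
      using d by (simp add: divide_right_mono)
    then show ?thesis using dm d by simp
  qed
  have "(LINT x|sphere_measure. norm (partial i x - partial j x)) < e" if "i \<ge> K" "j \<ge> K" for i j
    using main[of j i] main[of i j] that by (cases "i \<ge> j") (auto simp: abs_minus_commute)
  then show ?thesis by blast
qed

text \<open>The subsequence has some limit F; it is identified with f by completeness, as both have
  the same moments against every harmonic. Norm convergence of the expansion to f is not assumed
  anywhere.\<close>

lemma partial_AE_subsequence:
  obtains r where "strict_mono r" "AE x in sphere_measure. (\<lambda>k. partial (r k) x) \<longlonglongrightarrow> f x"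
proof -
  let ?S = "sphere_measure :: (real^'n) measure"
  have pi: "integrable ?S (partial M)" for M by (rule L2s_integrable[OF partial_L2s])
  have pm[measurable]: "partial M \<in> borel_measurable ?S" for M using pi by simp
  obtain r where r: "strict_mono r" "AE x in ?S. Cauchy (\<lambda>k. partial (r k) x)"
    using cauchy_L1_AE_cauchy_subseq[of ?S partial] pi partial_L1_Cauchy by blast
  define F where "F x = lim (\<lambda>k. partial (r k) x)" for x
  have Fm[measurable]: "F \<in> borel_measurable ?S" unfolding F_def[abs_def] by measurable
  have conv: "AE x in ?S. (\<lambda>k. partial (r k) x) \<longlonglongrightarrow> F x"
    using r(2) by eventually_elim (simp add: F_def Cauchy_convergent_iff convergent_LIMSEQ_iff)
  \<comment> \<open>Fatou in the second index upgrades the Cauchy property to L1 closeness of F to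
    the partial sums, from which integrability of F and convergence of its moments follow.\<close>
  have close: "\<exists>K. \<forall>k\<ge>K. (\<integral>\<^sup>+x. ennreal \<bar>F x - partial (r k) x\<bar> \<partial>?S) \<le> ennreal e" if e: "e > 0" for e
  proof -
    from partial_L1_Cauchy[OF e] obtain K where K: "\<And>i j. i \<ge> K \<Longrightarrow> j \<ge> K \<Longrightarrow> (LINT x|?S. norm (partial i x - partial j x)) < e" by blast
    have "(\<integral>\<^sup>+x. ennreal \<bar>F x - partial (r k) x\<bar> \<partial>?S) \<le> ennreal e" if k: "k \<ge> K" for k
    proof -
      have "(\<integral>\<^sup>+x. ennreal \<bar>F x - partial (r k) x\<bar> \<partial>?S) = (\<integral>\<^sup>+x. liminf (\<lambda>j. ennreal \<bar>partial (r j) x - partial (r k) x\<bar>) \<partial>?S)"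
      proof (rule nn_integral_cong_AE)
        show "AE x in ?S. ennreal \<bar>F x - partial (r k) x\<bar> = liminf (\<lambda>j. ennreal \<bar>partial (r j) x - partial (r k) x\<bar>)"
          using conv
        proof eventually_elim
          case (elim x)
          have "(\<lambda>j. ennreal \<bar>partial (r j) x - partial (r k) x\<bar>) \<longlonglongrightarrow> ennreal \<bar>F x - partial (r k) x\<bar>"
            by (intro tendsto_ennrealI tendsto_rabs tendsto_diff elim tendsto_const)
          then show ?case by (intro lim_imp_Liminf[symmetric]) auto
        qed
      qed
      also have "\<dots> \<le> liminf (\<lambda>j. \<integral>\<^sup>+x. ennreal \<bar>partial (r j) x - partial (r k) x\<bar> \<partial>?S)"
        by (rule nn_integral_liminf) measurable
      also have "\<dots> \<le> ennreal e"
      proof (rule Liminf_le)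
        show "\<forall>\<^sub>F j in sequentially. (\<integral>\<^sup>+x. ennreal \<bar>partial (r j) x - partial (r k) x\<bar> \<partial>?S) \<le> ennreal e"
          unfolding eventually_sequentially
        proof (intro exI allI impI)
          fix j assume "K \<le> j"
          have "K \<le> r j" "K \<le> r k" using seq_suble[OF r(1), of j] seq_suble[OF r(1), of k] \<open>K \<le> j\<close> k by auto
          have "(\<integral>\<^sup>+x. ennreal \<bar>partial (r j) x - partial (r k) x\<bar> \<partial>?S) = ennreal (LINT x|?S. \<bar>partial (r j) x - partial (r k) x\<bar>)"
            using pi by (intro nn_integral_eq_integral) auto
          also have "\<dots> \<le> ennreal e" using K[OF \<open>K \<le> r j\<close> \<open>K \<le> r k\<close>] by (intro ennreal_leI) simp
          finally show "(\<integral>\<^sup>+x. ennreal \<bar>partial (r j) x - partial (r k) x\<bar> \<partial>?S) \<le> ennreal e" .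
        qed
      qed simp
      finally show ?thesis .
    qed
    then show ?thesis by blast
  qed
  have Fi: "integrable ?S F"
  proof -
    obtain K where K: "(\<integral>\<^sup>+x. ennreal \<bar>F x - partial (r K) x\<bar> \<partial>?S) \<le> ennreal 1" using close[of 1] by auto
    have "integrable ?S (\<lambda>x. F x - partial (r K) x)"
    proof (rule integrableI_bounded)
      show "(\<integral>\<^sup>+x. ennreal (norm (F x - partial (r K) x)) \<partial>?S) < \<infinity>"
        using le_less_trans[OF K ennreal_less_top] by simp
    qed measurable
    from Bochner_Integration.integrable_add[OF this pi[of "r K"]] show ?thesis by simp
  qed
  have fi: "integrable ?S f" by (rule L2s_integrable[OF f])
  have "AE x in ?S. F x - f x = 0"
  proof (rule AE_zero_if_orthogonal_sph_harm[OF N])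
    show "integrable ?S (\<lambda>x. F x - f x)" using Fi fi by simp
    fix n and Y :: "real^'n \<Rightarrow> real" assume Y: "Y \<in> sph_harm n"
    obtain B where B: "B > 0" "\<And>y. y \<in> sphere 0 1 \<Longrightarrow> \<bar>Y y\<bar> \<le> B"
      using continuous_bounded_on_sphere[OF hp_continuous[OF sph_harm_hp[OF Y]]] by blast
    have hY: "integrable ?S (\<lambda>x. h x * Y x)" "\<bar>LINT x|?S. h x * Y x\<bar> \<le> B * (LINT x|?S. \<bar>h x\<bar>)" if h: "integrable ?S h" for h
    proof -
      have le: "\<bar>h x * Y x\<bar> \<le> B * \<bar>h x\<bar>" if "x \<in> space ?S" for x
        using B(2)[of x] that mult_left_mono[of "\<bar>Y x\<bar>" B "\<bar>h x\<bar>"] by (simp add: space_sphere_measure abs_mult mult.commute)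
      show i: "integrable ?S (\<lambda>x. h x * Y x)" by (rule integrable_mult_hp_sphere[OF h sph_harm_hp[OF Y]])
      have "\<bar>LINT x|?S. h x * Y x\<bar> \<le> (LINT x|?S. \<bar>h x * Y x\<bar>)" by (rule integral_abs_bound)
      also have "\<dots> \<le> (LINT x|?S. B * \<bar>h x\<bar>)" using i h le by (intro integral_mono) auto
      finally show "\<bar>LINT x|?S. h x * Y x\<bar> \<le> B * (LINT x|?S. \<bar>h x\<bar>)" by simp
    qed
    have "\<bar>LINT x|?S. (F x - f x) * Y x\<bar> \<le> 0"
    proof (rule field_le_epsilon)
      fix e :: real assume e: "e > 0"
      then have "e / B > 0" using B by simp
      from close[OF this] obtain K where K: "\<And>k. k \<ge> K \<Longrightarrow> (\<integral>\<^sup>+x. ennreal \<bar>F x - partial (r k) x\<bar> \<partial>?S) \<le> ennreal (e / B)" by blast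
      \<comment> \<open>Besides closeness, r k >= n is wanted: from there on the partial sum has the
        same moment against Y as f.\<close>
      define k where "k = max K n"
      have rk: "n \<le> r k" using seq_suble[OF r(1), of k] by (simp add: k_def)
      have i: "integrable ?S (\<lambda>x. F x - partial (r k) x)" using Fi pi by simp
      have "ennreal (LINT x|?S. \<bar>F x - partial (r k) x\<bar>) \<le> ennreal (e / B)"
        using K[of k] i by (subst nn_integral_eq_integral[symmetric]) (auto simp: k_def)
      then have "(LINT x|?S. \<bar>F x - partial (r k) x\<bar>) \<le> e / B" using \<open>e / B > 0\<close> by (subst (asm) ennreal_le_iff) auto
      then have "B * (LINT x|?S. \<bar>F x - partial (r k) x\<bar>) \<le> e" using B by (simp add: field_simps)
      moreover have "(LINT x|?S. (F x - f x) * Y x) = (LINT x|?S. (F x - partial (r k) x) * Y x)"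
        using integral_partial_harm[OF Y rk] hY(1)[OF Fi] hY(1)[OF fi] hY(1)[OF pi]
        by (simp add: left_diff_distrib)
      ultimately show "\<bar>LINT x|?S. (F x - f x) * Y x\<bar> \<le> 0 + e" using hY(2)[OF i] by simp
    qed
    then show "(LINT x|?S. (F x - f x) * Y x) = 0" by simp
  qed
  with conv have "AE x in ?S. (\<lambda>k. partial (r k) x) \<longlonglongrightarrow> f x" by eventually_elim simp
  with r(1) that show ?thesis by blast
qed

end

text \<open>Fatou along the convergent subsequence carries over the inequality for polynomials; on
  the right all terms are nonnegative, so partial sums are bounded by the series. The weighted
  integral of f is not known to be finite beforehand, hence the \<open>ennreal\<close> form.\<close>

lemma hardy_L2s:
  fixes f :: "real^'n \<Rightarrow> real" and i :: 'n
  assumes N: "CARD('n) \<ge> 3" and bd: "0 < \<beta>" "\<beta> < \<delta>" and dsum: "2 * (\<beta> + \<delta>) = real CARD('n) - 1"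
    and f: "L2s f" and sm: "summable (\<lambda>n. acoef \<beta> \<delta> n * proj_norm2 n f)"
  shows "ennreal (qconst \<beta> \<delta>) * (\<integral>\<^sup>+y. ennreal (perp i y powr (- (\<delta> - \<beta>)) * (f y)\<^sup>2) \<partial>sphere_measure)
    \<le> ennreal (\<Sum>n. acoef \<beta> \<delta> n * proj_norm2 n f)"
proof -
  let ?S = "sphere_measure :: (real^'n) measure" and ?W = "\<lambda>y. perp i y powr (- (\<delta> - \<beta>))" and ?q = "qconst \<beta> \<delta>"
  obtain r where r: "AE x in ?S. (\<lambda>k. partial f (r k) x) \<longlonglongrightarrow> f x"
    using partial_AE_subsequence[OF N f] by blast
  have Wm[measurable]: "?W \<in> borel_measurable ?S" by (rule borel_measurable_sphere) measurable
  have fm[measurable]: "f \<in> borel_measurable ?S" using f by (simp add: L2s_def)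
  have pm[measurable]: "partial f M \<in> borel_measurable ?S" for M using partial_L2s[OF N f] by (simp add: L2s_def)
  have "ennreal ?q * (\<integral>\<^sup>+y. ennreal (?W y * (f y)\<^sup>2) \<partial>?S) = (\<integral>\<^sup>+y. ennreal ?q * ennreal (?W y * (f y)\<^sup>2) \<partial>?S)"
    by (rule nn_integral_cmult[symmetric]) measurable
  also have "\<dots> = (\<integral>\<^sup>+y. liminf (\<lambda>k. ennreal ?q * ennreal (?W y * (partial f (r k) y)\<^sup>2)) \<partial>?S)"
  proof (rule nn_integral_cong_AE)
    show "AE y in ?S. ennreal ?q * ennreal (?W y * (f y)\<^sup>2) = liminf (\<lambda>k. ennreal ?q * ennreal (?W y * (partial f (r k) y)\<^sup>2))"
      using r
    proof eventually_elim
      case (elim y)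
      have "(\<lambda>k. ennreal (?q * (?W y * (partial f (r k) y)\<^sup>2))) \<longlonglongrightarrow> ennreal (?q * (?W y * (f y)\<^sup>2))"
        by (intro tendsto_ennrealI tendsto_mult tendsto_const tendsto_power elim)
      then have "(\<lambda>k. ennreal ?q * ennreal (?W y * (partial f (r k) y)\<^sup>2)) \<longlonglongrightarrow> ennreal ?q * ennreal (?W y * (f y)\<^sup>2)"
        using qconst_pos[OF bd dsum N] by (simp add: ennreal_mult)
      then show ?case by (intro lim_imp_Liminf[symmetric]) auto
    qed
  qed
  also have "\<dots> \<le> liminf (\<lambda>k. \<integral>\<^sup>+y. ennreal ?q * ennreal (?W y * (partial f (r k) y)\<^sup>2) \<partial>?S)"
    by (rule nn_integral_liminf) measurable
  also have "\<dots> \<le> ennreal (\<Sum>n. acoef \<beta> \<delta> n * proj_norm2 n f)"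
  proof (rule Liminf_le[OF _ always_eventually[OF allI]])
    fix k
    have "(\<integral>\<^sup>+y. ennreal ?q * ennreal (?W y * (partial f (r k) y)\<^sup>2) \<partial>?S) = ennreal ?q * (\<integral>\<^sup>+y. ennreal (?W y * (partial f (r k) y)\<^sup>2) \<partial>?S)"
      by (rule nn_integral_cmult) measurable
    also have "\<dots> \<le> ennreal (\<Sum>n\<le>r k. acoef \<beta> \<delta> n * proj_norm2 n f)"
      using hardy_polynomial[OF bd dsum N, of "\<lambda>n. proj_H n f" i "r k"] proj_H_properties(1)[OF f N]
      by (simp add: partial_def[OF N f] proj_norm2_def)
    also have "\<dots> \<le> ennreal (\<Sum>n. acoef \<beta> \<delta> n * proj_norm2 n f)"
      by (intro ennreal_leI sum_le_suminf sm mult_nonneg_nonneg less_imp_le[OF acoef_pos[OF bd]] proj_norm2_nonneg[OF N f]) simp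
    finally show "(\<integral>\<^sup>+y. ennreal ?q * ennreal (?W y * (partial f (r k) y)\<^sup>2) \<partial>?S) \<le> ennreal (\<Sum>n. acoef \<beta> \<delta> n * proj_norm2 n f)" .
  qed simp
  finally show ?thesis .
qed

text \<open>The squared distances to the two poles are 2 - 2t and 2 + 2t, with product 4(1 -
  t^2).\<close>

lemma pole_weight:
  fixes x :: "real^'n"
  assumes x: "norm x = 1"
  shows "norm (x - axis i 1) * norm (x + axis i 1) = 2 * sqrt (perp i x)"
proof -
  have xx: "x \<bullet> x = 1" using x by (simp add: norm_eq_1)
  have xa: "x \<bullet> axis i 1 = x $ i" by (simp add: inner_axis)
  have aa: "axis i 1 \<bullet> axis i (1::real) = 1" by (simp add: inner_axis)
  have "(norm (x - axis i 1))\<^sup>2 = 2 - 2 * x $ i"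
    unfolding power2_norm_eq_inner by (simp add: inner_diff_left inner_diff_right xx xa aa inner_commute)
  moreover have "(norm (x + axis i 1))\<^sup>2 = 2 + 2 * x $ i"
    unfolding power2_norm_eq_inner by (simp add: inner_add_left inner_add_right xx xa aa inner_commute)
  moreover have "perp i x = 1 - (x $ i)\<^sup>2" using norm_sq_perp[of x i] x by simp
  ultimately have "(norm (x - axis i 1) * norm (x + axis i 1))\<^sup>2 = 2\<^sup>2 * perp i x"
    by (simp only: power_mult_distrib) (simp add: algebra_simps power2_eq_square)
  then have "norm (x - axis i 1) * norm (x + axis i 1) = sqrt (2\<^sup>2 * perp i x)"
    by (metis abs_of_nonneg mult_nonneg_nonneg norm_ge_zero real_sqrt_abs)
  then show ?thesis by (simp add: real_sqrt_mult)
qed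

theorem theorem2:
  fixes f :: "real^'n \<Rightarrow> real" and \<sigma> :: real and i :: 'n
  assumes "CARD('n) \<ge> 3" and "0 < \<sigma>" and "\<sigma> < 1" and "sobolev_H \<sigma> f"
  shows "ennreal (2 powr \<sigma> * (2 powr \<sigma> *
            Gamma ((real CARD('n) - 1 + \<sigma>) / 4) ^ 2 / Gamma ((real CARD('n) - 1 - \<sigma>) / 4) ^ 2))
         * (\<integral>\<^sup>+ x. ennreal ((f x)\<^sup>2 / (norm (x - axis i 1) * norm (x + axis i 1)) powr \<sigma>)
             \<partial>sphere_measure)
         \<le> ennreal (A_form \<sigma> f)"
proof -
  define \<beta> where "\<beta> = (real CARD('n) - 1 - \<sigma>) / 4"
  define \<delta> where "\<delta> = (real CARD('n) - 1 + \<sigma>) / 4"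
  note N = assms(1)
  have N3: "real CARD('n) \<ge> 3" using N by simp
  have bd: "0 < \<beta>" "\<beta> < \<delta>" using N3 assms(2,3) by (auto simp: \<beta>_def \<delta>_def)
  have dsum: "2 * (\<beta> + \<delta>) = real CARD('n) - 1" by (simp add: \<beta>_def \<delta>_def field_simps)
  have f: "L2s f" using assms(4) by (simp add: sobolev_H_def L2s_def)
  have fm[measurable]: "f \<in> borel_measurable sphere_measure" using f by (simp add: L2s_def)
  have ac: "acoef \<beta> \<delta> n = Gamma (real n + lam TYPE('n) + (1 + \<sigma>) / 2) / Gamma (real n + lam TYPE('n) + (1 - \<sigma>) / 2)" for n
  proof -
    have "real n + 2 * \<delta> = real n + lam TYPE('n) + (1 + \<sigma>) / 2" "real n + 2 * \<beta> = real n + lam TYPE('n) + (1 - \<sigma>) / 2"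
      by (auto simp: lam_def \<beta>_def \<delta>_def field_simps)
    then show ?thesis by (simp only: acoef_def)
  qed
  have A: "A_form \<sigma> f = (\<Sum>n. acoef \<beta> \<delta> n * proj_norm2 n f)" unfolding A_form_def ac ..
  \<comment> \<open>Membership in the Sobolev space enters here: without convergence the
    \<open>suminf\<close> in \<open>A_form\<close> would carry no information.\<close>
  have sm: "summable (\<lambda>n. acoef \<beta> \<delta> n * proj_norm2 n f)"
  proof (rule summable_comparison_test')
    show "summable (\<lambda>n. 2 powr \<sigma> * ((real n + lam TYPE('n)) powr \<sigma> * proj_norm2 n f))"
      using assms(4) by (intro summable_mult) (simp add: sobolev_H_def)
    fix n :: nat
    have z: "real n + 2 * \<beta> > 0" using bd by (simp add: add_nonneg_pos)
    have "acoef \<beta> \<delta> n = Gamma (real n + 2 * \<beta> + \<sigma>) / Gamma (real n + 2 * \<beta>)"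
      by (simp add: acoef_def \<beta>_def \<delta>_def field_simps)
    also have "\<dots> \<le> (real n + 2 * \<beta>) powr \<sigma>" by (rule Gamma_ratio_le_powr[OF z assms(2,3)])
    \<comment> \<open>The factor 2 absorbs the difference between 2\<beta> = lam + (1 - \<sigma>)/2
      and lam, using lam >= 1/2.\<close>
    also have "\<dots> \<le> (2 * (real n + lam TYPE('n))) powr \<sigma>"
      using z N3 assms(2) by (intro powr_mono2) (auto simp: lam_def \<beta>_def field_simps)
    also have "\<dots> = 2 powr \<sigma> * (real n + lam TYPE('n)) powr \<sigma>" by (rule powr_mult)
    finally show "norm (acoef \<beta> \<delta> n * proj_norm2 n f) \<le> 2 powr \<sigma> * ((real n + lam TYPE('n)) powr \<sigma> * proj_norm2 n f)"
      using proj_norm2_nonneg[OF N f, of n] acoef_pos[OF bd, of n] mult_right_mono by (fastforce simp: abs_mult)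
  qed
  have q: "2 powr \<sigma> * Gamma ((real CARD('n) - 1 + \<sigma>) / 4) ^ 2 / Gamma ((real CARD('n) - 1 - \<sigma>) / 4) ^ 2 = qconst \<beta> \<delta>"
  proof -
    have "2 * (\<delta> - \<beta>) = \<sigma>" by (simp add: \<beta>_def \<delta>_def field_simps)
    then show ?thesis unfolding qconst_def[OF bd dsum N] \<beta>_def[symmetric] \<delta>_def[symmetric] by (simp add: power_divide)
  qed
  \<comment> \<open>The product of the distances contributes 2 to the power \<sigma>, which cancels
    the leading factor of the claimed constant; the remaining exponent of \<open>perp\<close> is
    \<sigma>/2 = \<delta> - \<beta>.\<close>
  have w: "(\<integral>\<^sup>+ x. ennreal ((f x)\<^sup>2 / (norm (x - axis i 1) * norm (x + axis i 1)) powr \<sigma>) \<partial>sphere_measure) =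
    ennreal (1 / 2 powr \<sigma>) * (\<integral>\<^sup>+y. ennreal (perp i y powr (- (\<delta> - \<beta>)) * (f y)\<^sup>2) \<partial>sphere_measure)"
  proof -
    have "(\<integral>\<^sup>+ x. ennreal ((f x)\<^sup>2 / (norm (x - axis i 1) * norm (x + axis i 1)) powr \<sigma>) \<partial>sphere_measure) =
      (\<integral>\<^sup>+ x. ennreal (1 / 2 powr \<sigma>) * ennreal (perp i x powr (- (\<delta> - \<beta>)) * (f x)\<^sup>2) \<partial>sphere_measure)"
    proof (rule nn_integral_cong)
      fix x :: "real^'n" assume "x \<in> space sphere_measure"
      then have x: "norm x = 1" by (simp add: space_sphere_measure)
      have "(norm (x - axis i 1) * norm (x + axis i 1)) powr \<sigma> = 2 powr \<sigma> * (perp i x powr (1 / 2)) powr \<sigma>"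
        unfolding pole_weight[OF x] using perp_nonneg[of i x] by (simp add: powr_mult powr_half_sqrt)
      also have "(perp i x powr (1 / 2)) powr \<sigma> = perp i x powr (\<delta> - \<beta>)"
        by (simp add: powr_powr \<beta>_def \<delta>_def field_simps)
      finally have "(f x)\<^sup>2 / (norm (x - axis i 1) * norm (x + axis i 1)) powr \<sigma> = 1 / 2 powr \<sigma> * (perp i x powr (- (\<delta> - \<beta>)) * (f x)\<^sup>2)"
        unfolding powr_minus_divide by simp
      then show "ennreal ((f x)\<^sup>2 / (norm (x - axis i 1) * norm (x + axis i 1)) powr \<sigma>) =
         ennreal (1 / 2 powr \<sigma>) * ennreal (perp i x powr (- (\<delta> - \<beta>)) * (f x)\<^sup>2)" by (simp flip: ennreal_mult)
    qed
    also have "\<dots> = ennreal (1 / 2 powr \<sigma>) * (\<integral>\<^sup>+y. ennreal (perp i y powr (- (\<delta> - \<beta>)) * (f y)\<^sup>2) \<partial>sphere_measure)"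
    proof (rule nn_integral_cmult)
      have "(\<lambda>y. perp i y powr (- (\<delta> - \<beta>))) \<in> borel_measurable sphere_measure" by (rule borel_measurable_sphere) measurable
      then show "(\<lambda>y. ennreal (perp i y powr (- (\<delta> - \<beta>)) * (f y)\<^sup>2)) \<in> borel_measurable sphere_measure" by measurable
    qed
    finally show ?thesis .
  qed
  have "ennreal (2 powr \<sigma> * qconst \<beta> \<delta>) * ennreal (1 / 2 powr \<sigma>) = ennreal (qconst \<beta> \<delta>)"
    using qconst_pos[OF bd dsum N] by (simp flip: ennreal_mult)
  then show ?thesis
    unfolding q w A mult.assoc[symmetric] using hardy_L2s[OF N bd dsum f sm, of i] by simp
qed

end
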